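(* Let $k$ be a field. Consider the fiberwise opfibration in $\mathbf{Fib}(\mathbf{AssAlg})$ given by $$\Pi\colon(\mathbf{XExt}(\mathbf{AssAlg}),\Pi_0)\to(\mathbf{Mod}(\mathbf{AssAlg}),(\underline{\ })_0),$$ where $\Pi$ sends a crossed extension $0\to M\to A\to B\to C\to0$ to the $C$-module $M$, $(\underline{\ })_0$ sends a $C$-module to $C$, and $\Pi_0=(\underline{\ })_0\cdot\Pi$. It restricts to a fiberwise opfibration $$\Pi\colon(\mathbf{XBiext},\Pi_0)\to(\mathbf{Bimod},(\underline{\ })_0)$$ in $\mathbf{Fib}(\mathbf{AssAlg}_1)$, where $\mathbf{XBiext}$ and $\mathbf{Bimod}$ are identified with (non-full) subcategories of $\mathbf{XExt}(\mathbf{AssAlg})$ and $\mathbf{Mod}(\mathbf{AssAlg})$ respectively.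
   Context: $\mathbf{AssAlg}$: associative, not necessarily unital, $k$-algebras. $\mathbf{AssAlg}_1$: unital associative $k$-algebras with unit-preserving morphisms, included in $\mathbf{AssAlg}$. For $A,B$ in $\mathbf{AssAlg}$, a $B$-action on $A$ is a pair of bilinear operations $B\times A\to A$, $A\times B\to A$, all written $*$ like the multiplications, such that for $a,a'\in A$, $b,b'\in B$: $(a*a')*b=a*(a'*b)$, $b*(a*a')=(b*a)*a'$, $a*(b*b')=(a*b)*b'$, $(b*b')*a=b*(b'*a)$, $(b*a)*b'=b*(a*b')$, $a*(b*a')=(a*b)*a'$. If $B$ is unital the action is unital if $1*a=a=a*1$. A crossed module in $\mathbf{AssAlg}$ is a morphism $\partial\colon A\to B$ with a $B$-action on $A$ such that $\partial(a_1)*a_2=a_1*a_2=a_1*\partial(a_2)$, $\partial(b*a)=b*\partial(a)$ and $\partial(a*b)=\partial(a)*b$. The objects of $\mathbf{Mod}(\mathbf{AssAlg})$ are pairs $(C,M)$ with $M$ an algebra with zero multiplication and a $C$-action; morphisms are pairs $(\gamma\colon C\to C',\mu\colon M\to M')$ of algebra morphisms with $\mu(c*m)=\gamma(c)*\mu(m)$, $\mu(m*c)=\mu(m)*\gamma(c)$. The objects of $\mathbf{XExt}(\mathbf{AssAlg})$ are exact sequences $0\to M\xrightarrow{j}A\xrightarrow{\partial}B\xrightarrow{p}C\to0$ in $\mathbf{AssAlg}$ with $\partial$ a crossed module; $M$ is a $C$-module via $j(p(b)*m)=b*j(m)$, $j(m*p(b))=j(m)*b$. Morphisms are morphisms of exact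 sequences $(\gamma,\beta,\alpha,\mu)$ in $\mathbf{AssAlg}$ with $\alpha$ compatible with the actions along $\beta$. A bimodule over a unital algebra $C$ is a $k$-vector space $M$ with unital left and right $C$-module structures such that $(c*m)*c'=c*(m*c')$. The objects of $\mathbf{Bimod}$ are pairs $(C,M)$ with $C$ unital and $M$ a $C$-bimodule; morphisms are pairs $(\gamma,\mu)$ with $\gamma$ a unital algebra morphism and $\mu$ a linear map compatible with the two actions along $\gamma$. Regarding $M$ as an algebra with zero multiplication, $\mathbf{Bimod}$ is a subcategory of $\mathbf{Mod}(\mathbf{AssAlg})$. A crossed bimodule is a morphism of $B$-bimodules $\partial\colon A\to B$, with $B$ unital, satisfying $\partial(a)*a'=a*\partial(a')$. With the product $a_1*a_2=\partial(a_1)*a_2$ on $A$ it is a crossed module in $\mathbf{AssAlg}$. A crossed biextension of a unital algebra $C$ by a $C$-bimodule $M$ is an exact sequence $0\to M\xrightarrow{j}A\xrightarrow{\partial}B\xrightarrow{p}C\to0$ of $k$-vector spaces with $\partial$ a crossed bimodule, $p$ a morphism of unital algebras, and such that the action of $C$ on $M$ induced by that of $B$ on $A$ is the given bimodule structure. Morphisms are morphisms of exact sequences $(\gamma,\beta,\alpha,\mu)$ with $\gamma,\beta$ unital algebra morphisms and $\alpha$ compatible with the actions along $\beta$. This gives the category $\mathbf{XBiext}$, identified with a subcategory of $\mathbf{XExt}(\mathbf{AssAlg})$. $\mathbf{Fib}(\mathcal A)$: the objects are Grothendieck fibrations $(\mathcal X,F)$ over $\mathcal A$; a morphism $(\mathcal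 X,F)\to(\mathcal M,G)$ is a functor $P$ with $G\cdot P=F$ preserving cartesian arrows. $P$ is a fiberwise opfibration if for every object $a$ of $\mathcal A$ its restriction $P_a\colon\mathcal X_a\to\mathcal M_a$ to the fibers over $a$ (arrows over $1_a$) is an opfibration. *)

theory Defs
  imports "HOL-Library.FuncSet" "HOL-Algebra.Group"
begin

section \<open>Categories, fibrations and opfibrations\<close>

record ('o, 'a) cat =
  obj :: "'o set"
  arr :: "'a set"
  src :: "'a \<Rightarrow> 'o"
  tgt :: "'a \<Rightarrow> 'o"
  ident :: "'o \<Rightarrow> 'a"
  cmp :: "'a \<Rightarrow> 'a \<Rightarrow> 'a"  \<comment> \<open>\<open>cmp X g f\<close> is \<open>g\<close> after \<open>f\<close>\<close>

definition category :: "('o, 'a) cat \<Rightarrow> bool" where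
  "category X \<longleftrightarrow>
     (\<forall>f\<in>arr X. src X f \<in> obj X \<and> tgt X f \<in> obj X) \<and>
     (\<forall>x\<in>obj X. ident X x \<in> arr X \<and> src X (ident X x) = x \<and> tgt X (ident X x) = x) \<and>
     (\<forall>f\<in>arr X. \<forall>g\<in>arr X. tgt X f = src X g \<longrightarrow>
        cmp X g f \<in> arr X \<and> src X (cmp X g f) = src X f \<and> tgt X (cmp X g f) = tgt X g) \<and>
     (\<forall>f\<in>arr X. cmp X f (ident X (src X f)) = f \<and> cmp X (ident X (tgt X f)) f = f) \<and>
     (\<forall>f\<in>arr X. \<forall>g\<in>arr X. \<forall>h\<in>arr X. tgt X f = src X g \<and> tgt X g = src X h \<longrightarrow>
        cmp X h (cmp X g f) = cmp X (cmp X h g) f)"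

record ('o, 'a, 'p, 'b) fctr =
  on_obj :: "'o \<Rightarrow> 'p"
  on_arr :: "'a \<Rightarrow> 'b"

definition is_functor :: "('o, 'a) cat \<Rightarrow> ('p, 'b) cat \<Rightarrow> ('o, 'a, 'p, 'b) fctr \<Rightarrow> bool" where
  "is_functor X Y F \<longleftrightarrow> category X \<and> category Y \<and>
     (\<forall>x\<in>obj X. on_obj F x \<in> obj Y) \<and>
     (\<forall>f\<in>arr X. on_arr F f \<in> arr Y \<and>
        src Y (on_arr F f) = on_obj F (src X f) \<and> tgt Y (on_arr F f) = on_obj F (tgt X f)) \<and>
     (\<forall>x\<in>obj X. on_arr F (ident X x) = ident Y (on_obj F x)) \<and>
     (\<forall>f\<in>arr X. \<forall>g\<in>arr X. tgt X f = src X g \<longrightarrow>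
        on_arr F (cmp X g f) = cmp Y (on_arr F g) (on_arr F f))"

definition fcomp :: "('p, 'b, 'q, 'c) fctr \<Rightarrow> ('o, 'a, 'p, 'b) fctr \<Rightarrow> ('o, 'a, 'q, 'c) fctr"
  (infixr "\<cdot>\<^sub>F" 70) where
  "G \<cdot>\<^sub>F F = \<lparr>on_obj = on_obj G \<circ> on_obj F, on_arr = on_arr G \<circ> on_arr F\<rparr>"

text \<open>Equality of functors out of \<open>X\<close>; the HOL functions may differ outside \<open>X\<close>.\<close>

definition functor_eq :: "('o, 'a) cat \<Rightarrow> ('o, 'a, 'p, 'b) fctr \<Rightarrow> ('o, 'a, 'p, 'b) fctr \<Rightarrow> bool" where
  "functor_eq X F G \<longleftrightarrow>
     (\<forall>x\<in>obj X. on_obj F x = on_obj G x) \<and> (\<forall>f\<in>arr X. on_arr F f = on_arr G f)"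

definition embedding :: "('o, 'a) cat \<Rightarrow> ('p, 'b) cat \<Rightarrow> ('o, 'a, 'p, 'b) fctr \<Rightarrow> bool" where
  "embedding X Y I \<longleftrightarrow> is_functor X Y I \<and> inj_on (on_obj I) (obj X) \<and> inj_on (on_arr I) (arr X)"

definition full :: "('o, 'a) cat \<Rightarrow> ('p, 'b) cat \<Rightarrow> ('o, 'a, 'p, 'b) fctr \<Rightarrow> bool" where
  "full X Y F \<longleftrightarrow> (\<forall>x\<in>obj X. \<forall>y\<in>obj X. \<forall>g\<in>arr Y.
     src Y g = on_obj F x \<and> tgt Y g = on_obj F y \<longrightarrow>
     (\<exists>f\<in>arr X. src X f = x \<and> tgt X f = y \<and> on_arr F f = g))"

definition cartesian ::
  "('o, 'a) cat \<Rightarrow> ('p, 'b) cat \<Rightarrow> ('o, 'a, 'p, 'b) fctr \<Rightarrow> 'a \<Rightarrow> bool" where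
  "cartesian X A F f \<longleftrightarrow> f \<in> arr X \<and>
     (\<forall>h\<in>arr X. \<forall>u\<in>arr A.
        tgt X h = tgt X f \<and> src A u = on_obj F (src X h) \<and> tgt A u = on_obj F (src X f) \<and>
        cmp A (on_arr F f) u = on_arr F h \<longrightarrow>
        (\<exists>!g. g \<in> arr X \<and> src X g = src X h \<and> tgt X g = src X f \<and>
              on_arr F g = u \<and> cmp X f g = h))"

definition fibration :: "('o, 'a) cat \<Rightarrow> ('p, 'b) cat \<Rightarrow> ('o, 'a, 'p, 'b) fctr \<Rightarrow> bool" where
  "fibration X A F \<longleftrightarrow> is_functor X A F \<and>
     (\<forall>x\<in>obj X. \<forall>u\<in>arr A. tgt A u = on_obj F x \<longrightarrow>
        (\<exists>f. cartesian X A F f \<and> tgt X f = x \<and> on_arr F f = u))"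

definition opposite :: "('o, 'a) cat \<Rightarrow> ('o, 'a) cat" where
  "opposite X = X\<lparr>src := tgt X, tgt := src X, cmp := (\<lambda>g f. cmp X f g)\<rparr>"

definition opfibration :: "('o, 'a) cat \<Rightarrow> ('p, 'b) cat \<Rightarrow> ('o, 'a, 'p, 'b) fctr \<Rightarrow> bool" where
  "opfibration X A F \<longleftrightarrow> fibration (opposite X) (opposite A) F"

definition fibre ::
  "('o, 'a) cat \<Rightarrow> ('p, 'b) cat \<Rightarrow> ('o, 'a, 'p, 'b) fctr \<Rightarrow> 'p \<Rightarrow> ('o, 'a) cat" where
  "fibre X A F a =
     X\<lparr>obj := {x \<in> obj X. on_obj F x = a}, arr := {f \<in> arr X. on_arr F f = ident A a}\<rparr>"

definition fib_morphism ::
  "('p, 'b) cat \<Rightarrow> ('o, 'a) cat \<Rightarrow> ('o, 'a, 'p, 'b) fctr \<Rightarrow>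
   ('q, 'c) cat \<Rightarrow> ('q, 'c, 'p, 'b) fctr \<Rightarrow> ('o, 'a, 'q, 'c) fctr \<Rightarrow> bool" where
  "fib_morphism A X F M G P \<longleftrightarrow>
     fibration X A F \<and> fibration M A G \<and> is_functor X M P \<and> functor_eq X (G \<cdot>\<^sub>F P) F \<and>
     (\<forall>f. cartesian X A F f \<longrightarrow> cartesian M A G (on_arr P f))"

definition fiberwise_opfibration ::
  "('p, 'b) cat \<Rightarrow> ('o, 'a) cat \<Rightarrow> ('o, 'a, 'p, 'b) fctr \<Rightarrow>
   ('q, 'c) cat \<Rightarrow> ('q, 'c, 'p, 'b) fctr \<Rightarrow> ('o, 'a, 'q, 'c) fctr \<Rightarrow> bool" where
  "fiberwise_opfibration A X F M G P \<longleftrightarrow> fib_morphism A X F M G P \<and>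
     (\<forall>a\<in>obj A. opfibration (fibre X A F a) (fibre M A G a) P)"

text \<open>
  The categories below consist of structures on carrier sets. Their arrows are structure-preserving
  (tuples of) functions tagged with source and target. The first argument of the composition \<open>c\<close> is
  the source object, which is needed because functions are extensional, that is \<open>undefined\<close> outside
  the carrier of their source.
\<close>

datatype ('o, 'f) arrow = Arrow (arrow_src: 'o) (arrow_tgt: 'o) (arrow_map: 'f)

definition concrete_cat ::
  "'o set \<Rightarrow> ('o \<Rightarrow> 'o \<Rightarrow> 'f set) \<Rightarrow> ('o \<Rightarrow> 'f) \<Rightarrow> ('o \<Rightarrow> 'f \<Rightarrow> 'f \<Rightarrow> 'f) \<Rightarrow> ('o, ('o, 'f) arrow) cat" where
  "concrete_cat Obj Hom i c =
     \<lparr>obj = Obj,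
      arr = {Arrow x y f | x y f. x \<in> Obj \<and> y \<in> Obj \<and> f \<in> Hom x y},
      src = arrow_src,
      tgt = arrow_tgt,
      ident = (\<lambda>x. Arrow x x (i x)),
      cmp = (\<lambda>g f. Arrow (arrow_src f) (arrow_tgt g) (c (arrow_src f) (arrow_map g) (arrow_map f)))\<rparr>"

definition concrete_functor ::
  "('o \<Rightarrow> 'p) \<Rightarrow> ('f \<Rightarrow> 'g) \<Rightarrow> ('o, ('o, 'f) arrow, 'p, ('p, 'g) arrow) fctr" where
  "concrete_functor F \<phi> = \<lparr>on_obj = F, on_arr = map_arrow F \<phi>\<rparr>"


section \<open>Vector spaces and associative algebras\<close>

text \<open>
  The ground field is the type \<open>'k\<close>. Carriers are subsets of a type \<open>'u\<close>, which plays the role of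
  the universe of sets. All operations are extensional, so that two objects are equal as soon as
  their carriers and the operations on these carriers agree.
\<close>

record ('k, 'u) vect = "'u partial_object" +
  vadd :: "'u \<Rightarrow> 'u \<Rightarrow> 'u"
  vzero :: 'u
  vscale :: "'k \<Rightarrow> 'u \<Rightarrow> 'u"

definition vspace :: "('k::field, 'u, 'z) vect_scheme \<Rightarrow> bool" where
  "vspace V \<longleftrightarrow>
     comm_group \<lparr>carrier = carrier V, monoid.mult = vadd V, one = vzero V\<rparr> \<and>
     (\<lambda>(x, y). vadd V x y) \<in> extensional (carrier V \<times> carrier V) \<and>
     (\<lambda>(r, x). vscale V r x) \<in> UNIV \<times> carrier V \<rightarrow>\<^sub>E carrier V \<and>
     (\<forall>r. \<forall>x\<in>carrier V. \<forall>y\<in>carrier V. vscale V r (vadd V x y) = vadd V (vscale V r x) (vscale V r y)) \<and>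
     (\<forall>r s. \<forall>x\<in>carrier V. vscale V (r + s) x = vadd V (vscale V r x) (vscale V s x)) \<and>
     (\<forall>r s. \<forall>x\<in>carrier V. vscale V (r * s) x = vscale V r (vscale V s x)) \<and>
     (\<forall>x\<in>carrier V. vscale V 1 x = x)"

definition linear_maps ::
  "('k::field, 'u, 'y) vect_scheme \<Rightarrow> ('k, 'u, 'z) vect_scheme \<Rightarrow> ('u \<Rightarrow> 'u) set" where
  "linear_maps V W = {f \<in> carrier V \<rightarrow>\<^sub>E carrier W.
     (\<forall>x\<in>carrier V. \<forall>y\<in>carrier V. f (vadd V x y) = vadd W (f x) (f y)) \<and>
     (\<forall>r. \<forall>x\<in>carrier V. f (vscale V r x) = vscale W r (f x))}"

definition bilinear_op ::
  "('k::field, 'u, 'x) vect_scheme \<Rightarrow> ('k, 'u, 'y) vect_scheme \<Rightarrow> ('k, 'u, 'z) vect_scheme \<Rightarrow>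
   ('u \<Rightarrow> 'u \<Rightarrow> 'u) \<Rightarrow> bool" where
  "bilinear_op U V W f \<longleftrightarrow>
     (\<lambda>(x, y). f x y) \<in> carrier U \<times> carrier V \<rightarrow>\<^sub>E carrier W \<and>
     (\<forall>x\<in>carrier U. (\<lambda>y\<in>carrier V. f x y) \<in> linear_maps V W) \<and>
     (\<forall>y\<in>carrier V. (\<lambda>x\<in>carrier U. f x y) \<in> linear_maps U W)"

definition kernel_of ::
  "('k, 'u, 'y) vect_scheme \<Rightarrow> ('k, 'u, 'z) vect_scheme \<Rightarrow> ('u \<Rightarrow> 'u) \<Rightarrow> 'u set" where
  "kernel_of V W f = {x \<in> carrier V. f x = vzero W}"

definition id_map :: "('k, 'u, 'z) vect_scheme \<Rightarrow> 'u \<Rightarrow> 'u" where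
  "id_map V = (\<lambda>x\<in>carrier V. x)"

text \<open>Exactness of \<open>0 \<rightarrow> M \<rightarrow> A \<rightarrow> B \<rightarrow> C \<rightarrow> 0\<close>.\<close>

definition exact_seq ::
  "('k, 'u, 'w) vect_scheme \<Rightarrow> ('k, 'u, 'x) vect_scheme \<Rightarrow>
   ('k, 'u, 'y) vect_scheme \<Rightarrow> ('k, 'u, 'z) vect_scheme \<Rightarrow>
   ('u \<Rightarrow> 'u) \<Rightarrow> ('u \<Rightarrow> 'u) \<Rightarrow> ('u \<Rightarrow> 'u) \<Rightarrow> bool" where
  "exact_seq M A B C j d p \<longleftrightarrow>
     inj_on j (carrier M) \<and> j ` carrier M = kernel_of A B d \<and>
     d ` carrier A = kernel_of B C p \<and> p ` carrier B = carrier C"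

record ('k, 'u) alg = "('k, 'u) vect" +
  amult :: "'u \<Rightarrow> 'u \<Rightarrow> 'u"

definition assoc_algebra :: "('k::field, 'u) alg \<Rightarrow> bool" where
  "assoc_algebra A \<longleftrightarrow> vspace A \<and> bilinear_op A A A (amult A) \<and>
     (\<forall>x\<in>carrier A. \<forall>y\<in>carrier A. \<forall>z\<in>carrier A.
        amult A (amult A x y) z = amult A x (amult A y z))"

definition algebra_maps :: "('k::field, 'u) alg \<Rightarrow> ('k, 'u) alg \<Rightarrow> ('u \<Rightarrow> 'u) set" where
  "algebra_maps A B = {f \<in> linear_maps A B.
     \<forall>x\<in>carrier A. \<forall>y\<in>carrier A. f (amult A x y) = amult B (f x) (f y)}"

definition is_unit_of :: "('k, 'u) alg \<Rightarrow> 'u \<Rightarrow> bool" where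
  "is_unit_of A e \<longleftrightarrow> e \<in> carrier A \<and> (\<forall>x\<in>carrier A. amult A e x = x \<and> amult A x e = x)"

text \<open>Units are unique, so unitality is a property and \<open>AssAlg1\<close> is literally contained in \<open>AssAlg\<close>.\<close>

definition unital_algebra :: "('k::field, 'u) alg \<Rightarrow> bool" where
  "unital_algebra A \<longleftrightarrow> assoc_algebra A \<and> (\<exists>e. is_unit_of A e)"

definition unit_of :: "('k, 'u) alg \<Rightarrow> 'u" where
  "unit_of A = (THE e. is_unit_of A e)"

definition unital_maps :: "('k::field, 'u) alg \<Rightarrow> ('k, 'u) alg \<Rightarrow> ('u \<Rightarrow> 'u) set" where
  "unital_maps A B = {f \<in> algebra_maps A B. f (unit_of A) = unit_of B}"

type_synonym ('k, 'u) alg_arrow = "(('k, 'u) alg, 'u \<Rightarrow> 'u) arrow"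

definition AssAlg :: "(('k::field, 'u) alg, ('k, 'u) alg_arrow) cat" where
  "AssAlg = concrete_cat {A. assoc_algebra A} algebra_maps id_map (\<lambda>A g f. compose (carrier A) g f)"

definition AssAlg1 :: "(('k::field, 'u) alg, ('k, 'u) alg_arrow) cat" where
  "AssAlg1 = concrete_cat {A. unital_algebra A} unital_maps id_map (\<lambda>A g f. compose (carrier A) g f)"

definition incl_AssAlg1 :: "(('k, 'u) alg, ('k, 'u) alg_arrow, ('k, 'u) alg, ('k, 'u) alg_arrow) fctr" where
  "incl_AssAlg1 = concrete_functor id id"


section \<open>Actions and modules over associative algebras\<close>

text \<open>An algebra \<open>acted\<close> with an action of the algebra \<open>acting\<close>:
  \<open>lact b a\<close> is \<open>b * a\<close> and \<open>ract a b\<close> is \<open>a * b\<close>.\<close>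

record ('k, 'u) action =
  acting :: "('k, 'u) alg"
  acted :: "('k, 'u) alg"
  lact :: "'u \<Rightarrow> 'u \<Rightarrow> 'u"
  ract :: "'u \<Rightarrow> 'u \<Rightarrow> 'u"

definition is_action :: "('k::field, 'u) action \<Rightarrow> bool" where
  "is_action T \<longleftrightarrow> (let A = acted T; B = acting T; l = lact T; r = ract T in
     assoc_algebra B \<and> assoc_algebra A \<and> bilinear_op B A A l \<and> bilinear_op A B A r \<and>
     (\<forall>a\<in>carrier A. \<forall>a'\<in>carrier A. \<forall>b\<in>carrier B.
        r (amult A a a') b = amult A a (r a' b) \<and>
        l b (amult A a a') = amult A (l b a) a' \<and>
        amult A a (l b a') = amult A (r a b) a') \<and>
     (\<forall>a\<in>carrier A. \<forall>b\<in>carrier B. \<forall>b'\<in>carrier B.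
        r a (amult B b b') = r (r a b) b' \<and>
        l (amult B b b') a = l b (l b' a) \<and>
        r (l b a) b' = l b (r a b')))"

definition action_compatible ::
  "('k, 'u) action \<Rightarrow> ('k, 'u) action \<Rightarrow> ('u \<Rightarrow> 'u) \<Rightarrow> ('u \<Rightarrow> 'u) \<Rightarrow> bool" where
  "action_compatible S T \<beta> \<alpha> \<longleftrightarrow> (\<forall>b\<in>carrier (acting S). \<forall>a\<in>carrier (acted S).
     \<alpha> (lact S b a) = lact T (\<beta> b) (\<alpha> a) \<and> \<alpha> (ract S a b) = ract T (\<alpha> a) (\<beta> b))"

definition is_crossed_module :: "('k::field, 'u) action \<Rightarrow> ('u \<Rightarrow> 'u) \<Rightarrow> bool" where
  "is_crossed_module T d \<longleftrightarrow> (let A = acted T; B = acting T; l = lact T; r = ract T in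
     is_action T \<and> d \<in> algebra_maps A B \<and>
     (\<forall>a1\<in>carrier A. \<forall>a2\<in>carrier A. l (d a1) a2 = amult A a1 a2 \<and> amult A a1 a2 = r a1 (d a2)) \<and>
     (\<forall>a\<in>carrier A. \<forall>b\<in>carrier B.
        d (l b a) = amult B b (d a) \<and> d (r a b) = amult B (d a) b))"

definition is_module :: "('k::field, 'u) action \<Rightarrow> bool" where
  "is_module T \<longleftrightarrow> is_action T \<and>
     (\<forall>x\<in>carrier (acted T). \<forall>y\<in>carrier (acted T). amult (acted T) x y = vzero (acted T))"

definition module_maps :: "('k::field, 'u) action \<Rightarrow> ('k, 'u) action \<Rightarrow> (('u \<Rightarrow> 'u) \<times> ('u \<Rightarrow> 'u)) set" where
  "module_maps S T = {(\<gamma>, \<mu>).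
     \<gamma> \<in> algebra_maps (acting S) (acting T) \<and> \<mu> \<in> algebra_maps (acted S) (acted T) \<and>
     action_compatible S T \<gamma> \<mu>}"

type_synonym ('k, 'u) module_arrow = "(('k, 'u) action, ('u \<Rightarrow> 'u) \<times> ('u \<Rightarrow> 'u)) arrow"

definition ModAssAlg :: "(('k::field, 'u) action, ('k, 'u) module_arrow) cat" where
  "ModAssAlg = concrete_cat {T. is_module T} module_maps
     (\<lambda>T. (id_map (acting T), id_map (acted T)))
     (\<lambda>T (\<gamma>', \<mu>') (\<gamma>, \<mu>). (compose (carrier (acting T)) \<gamma>' \<gamma>, compose (carrier (acted T)) \<mu>' \<mu>))"

definition base_Mod :: "(('k, 'u) action, ('k, 'u) module_arrow, ('k, 'u) alg, ('k, 'u) alg_arrow) fctr" where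
  "base_Mod = concrete_functor acting fst"


section \<open>Crossed extensions\<close>

text \<open>An exact sequence \<open>0 \<rightarrow> M \<rightarrow> A \<rightarrow> B \<rightarrow> C \<rightarrow> 0\<close>, where \<open>A\<close> and \<open>B\<close> are the two
  algebras of the action \<open>xe_act\<close>.\<close>

record ('k, 'u) xext =
  xe_M :: "('k, 'u) alg"
  xe_act :: "('k, 'u) action"
  xe_C :: "('k, 'u) alg"
  xe_j :: "'u \<Rightarrow> 'u"
  xe_d :: "'u \<Rightarrow> 'u"
  xe_p :: "'u \<Rightarrow> 'u"

abbreviation xe_A :: "('k, 'u) xext \<Rightarrow> ('k, 'u) alg" where "xe_A E \<equiv> acted (xe_act E)"
abbreviation xe_B :: "('k, 'u) xext \<Rightarrow> ('k, 'u) alg" where "xe_B E \<equiv> acting (xe_act E)"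

definition is_xext :: "('k::field, 'u) xext \<Rightarrow> bool" where
  "is_xext E \<longleftrightarrow>
     assoc_algebra (xe_M E) \<and> assoc_algebra (xe_C E) \<and> is_crossed_module (xe_act E) (xe_d E) \<and>
     xe_j E \<in> algebra_maps (xe_M E) (xe_A E) \<and> xe_p E \<in> algebra_maps (xe_B E) (xe_C E) \<and>
     exact_seq (xe_M E) (xe_A E) (xe_B E) (xe_C E) (xe_j E) (xe_d E) (xe_p E)"

text \<open>A morphism of exact sequences is written \<open>(\<gamma>, \<beta>, \<alpha>, \<mu>)\<close>, from right to left.\<close>

type_synonym 'u maps4 = "('u \<Rightarrow> 'u) \<times> ('u \<Rightarrow> 'u) \<times> ('u \<Rightarrow> 'u) \<times> ('u \<Rightarrow> 'u)"

definition xext_maps :: "('k::field, 'u) xext \<Rightarrow> ('k, 'u) xext \<Rightarrow> 'u maps4 set" where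
  "xext_maps E E' = {(\<gamma>, \<beta>, \<alpha>, \<mu>).
     \<gamma> \<in> algebra_maps (xe_C E) (xe_C E') \<and> \<beta> \<in> algebra_maps (xe_B E) (xe_B E') \<and>
     \<alpha> \<in> algebra_maps (xe_A E) (xe_A E') \<and> \<mu> \<in> algebra_maps (xe_M E) (xe_M E') \<and>
     (\<forall>m\<in>carrier (xe_M E). \<alpha> (xe_j E m) = xe_j E' (\<mu> m)) \<and>
     (\<forall>a\<in>carrier (xe_A E). \<beta> (xe_d E a) = xe_d E' (\<alpha> a)) \<and>
     (\<forall>b\<in>carrier (xe_B E). \<gamma> (xe_p E b) = xe_p E' (\<beta> b)) \<and>
     action_compatible (xe_act E) (xe_act E') \<beta> \<alpha>}"

type_synonym ('k, 'u) xext_arrow = "(('k, 'u) xext, 'u maps4) arrow"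

definition XExt :: "(('k::field, 'u) xext, ('k, 'u) xext_arrow) cat" where
  "XExt = concrete_cat {E. is_xext E} xext_maps
     (\<lambda>E. (id_map (xe_C E), id_map (xe_B E), id_map (xe_A E), id_map (xe_M E)))
     (\<lambda>E (\<gamma>', \<beta>', \<alpha>', \<mu>') (\<gamma>, \<beta>, \<alpha>, \<mu>).
        (compose (carrier (xe_C E)) \<gamma>' \<gamma>, compose (carrier (xe_B E)) \<beta>' \<beta>,
         compose (carrier (xe_A E)) \<alpha>' \<alpha>, compose (carrier (xe_M E)) \<mu>' \<mu>))"

text \<open>The action of \<open>C\<close> on \<open>M\<close> is determined by
  \<open>j (p b * m) = b * j m\<close> and \<open>j (m * p b) = j m * b\<close>.\<close>

definition induced_module :: "('k, 'u) xext \<Rightarrow> ('k, 'u) action" where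
  "induced_module E =
     \<lparr>acting = xe_C E, acted = xe_M E,
      lact = (\<lambda>c m. if c \<in> carrier (xe_C E) \<and> m \<in> carrier (xe_M E)
        then THE n. n \<in> carrier (xe_M E) \<and>
          (\<forall>b\<in>carrier (xe_B E). xe_p E b = c \<longrightarrow> xe_j E n = lact (xe_act E) b (xe_j E m))
        else undefined),
      ract = (\<lambda>m c. if m \<in> carrier (xe_M E) \<and> c \<in> carrier (xe_C E)
        then THE n. n \<in> carrier (xe_M E) \<and>
          (\<forall>b\<in>carrier (xe_B E). xe_p E b = c \<longrightarrow> xe_j E n = ract (xe_act E) (xe_j E m) b)
        else undefined)\<rparr>"

definition Pi_XExt :: "(('k, 'u) xext, ('k, 'u) xext_arrow, ('k, 'u) action, ('k, 'u) module_arrow) fctr" where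
  "Pi_XExt = concrete_functor induced_module (\<lambda>(\<gamma>, \<beta>, \<alpha>, \<mu>). (\<gamma>, \<mu>))"

definition Pi0_XExt :: "(('k, 'u) xext, ('k, 'u) xext_arrow, ('k, 'u) alg, ('k, 'u) alg_arrow) fctr" where
  "Pi0_XExt = base_Mod \<cdot>\<^sub>F Pi_XExt"


section \<open>Bimodules over unital algebras\<close>

record ('k, 'u) bimod =
  bm_alg :: "('k, 'u) alg"
  bm_space :: "('k, 'u) vect"
  bm_l :: "'u \<Rightarrow> 'u \<Rightarrow> 'u"
  bm_r :: "'u \<Rightarrow> 'u \<Rightarrow> 'u"

definition is_bimodule :: "('k::field, 'u) bimod \<Rightarrow> bool" where
  "is_bimodule X \<longleftrightarrow> (let C = bm_alg X; M = bm_space X; l = bm_l X; r = bm_r X in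
     unital_algebra C \<and> vspace M \<and> bilinear_op C M M l \<and> bilinear_op M C M r \<and>
     (\<forall>m\<in>carrier M. l (unit_of C) m = m \<and> r m (unit_of C) = m) \<and>
     (\<forall>c\<in>carrier C. \<forall>c'\<in>carrier C. \<forall>m\<in>carrier M.
        l (amult C c c') m = l c (l c' m) \<and>
        r m (amult C c c') = r (r m c) c' \<and>
        r (l c m) c' = l c (r m c')))"

definition bimod_compatible ::
  "('k, 'u) bimod \<Rightarrow> ('k, 'u) bimod \<Rightarrow> ('u \<Rightarrow> 'u) \<Rightarrow> ('u \<Rightarrow> 'u) \<Rightarrow> bool" where
  "bimod_compatible X Y \<gamma> \<mu> \<longleftrightarrow> (\<forall>c\<in>carrier (bm_alg X). \<forall>m\<in>carrier (bm_space X).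
     \<mu> (bm_l X c m) = bm_l Y (\<gamma> c) (\<mu> m) \<and> \<mu> (bm_r X m c) = bm_r Y (\<mu> m) (\<gamma> c))"

definition bimod_maps :: "('k::field, 'u) bimod \<Rightarrow> ('k, 'u) bimod \<Rightarrow> (('u \<Rightarrow> 'u) \<times> ('u \<Rightarrow> 'u)) set" where
  "bimod_maps X Y = {(\<gamma>, \<mu>).
     \<gamma> \<in> unital_maps (bm_alg X) (bm_alg Y) \<and> \<mu> \<in> linear_maps (bm_space X) (bm_space Y) \<and>
     bimod_compatible X Y \<gamma> \<mu>}"

type_synonym ('k, 'u) bimod_arrow = "(('k, 'u) bimod, ('u \<Rightarrow> 'u) \<times> ('u \<Rightarrow> 'u)) arrow"

definition Bimod :: "(('k::field, 'u) bimod, ('k, 'u) bimod_arrow) cat" where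
  "Bimod = concrete_cat {X. is_bimodule X} bimod_maps
     (\<lambda>X. (id_map (bm_alg X), id_map (bm_space X)))
     (\<lambda>X (\<gamma>', \<mu>') (\<gamma>, \<mu>). (compose (carrier (bm_alg X)) \<gamma>' \<gamma>, compose (carrier (bm_space X)) \<mu>' \<mu>))"

definition base_Bimod :: "(('k, 'u) bimod, ('k, 'u) bimod_arrow, ('k, 'u) alg, ('k, 'u) alg_arrow) fctr" where
  "base_Bimod = concrete_functor bm_alg fst"

definition with_mult :: "('k, 'u) vect \<Rightarrow> ('u \<Rightarrow> 'u \<Rightarrow> 'u) \<Rightarrow> ('k, 'u) alg" where
  "with_mult V f = vect.extend V
     (alg.fields (\<lambda>x y. if x \<in> carrier V \<and> y \<in> carrier V then f x y else undefined))"

definition zero_mult :: "('k, 'u) vect \<Rightarrow> ('k, 'u) alg" where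
  "zero_mult V = with_mult V (\<lambda>x y. vzero V)"

definition bimod_to_module :: "('k, 'u) bimod \<Rightarrow> ('k, 'u) action" where
  "bimod_to_module X =
     \<lparr>acting = bm_alg X, acted = zero_mult (bm_space X), lact = bm_l X, ract = bm_r X\<rparr>"

definition incl_Bimod :: "(('k, 'u) bimod, ('k, 'u) bimod_arrow, ('k, 'u) action, ('k, 'u) module_arrow) fctr" where
  "incl_Bimod = concrete_functor bimod_to_module id"


section \<open>Crossed biextensions\<close>

text \<open>The bimodule \<open>X\<close> is \<open>A\<close> over \<open>B\<close>, and \<open>d\<close> maps \<open>A\<close> to \<open>B\<close>.\<close>

definition is_crossed_bimodule :: "('k::field, 'u) bimod \<Rightarrow> ('u \<Rightarrow> 'u) \<Rightarrow> bool" where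
  "is_crossed_bimodule X d \<longleftrightarrow> (let A = bm_space X; B = bm_alg X; l = bm_l X; r = bm_r X in
     is_bimodule X \<and> d \<in> linear_maps A B \<and>
     (\<forall>a\<in>carrier A. \<forall>b\<in>carrier B.
        d (l b a) = amult B b (d a) \<and> d (r a b) = amult B (d a) b) \<and>
     (\<forall>a\<in>carrier A. \<forall>a'\<in>carrier A. l (d a) a' = r a (d a')))"

text \<open>In \<open>0 \<rightarrow> M \<rightarrow> A \<rightarrow> B \<rightarrow> C \<rightarrow> 0\<close>, \<open>xb_CM\<close> is the given \<open>C\<close>-bimodule \<open>M\<close> and
  \<open>xb_BA\<close> is the \<open>B\<close>-bimodule \<open>A\<close>.\<close>

record ('k, 'u) xbiext =
  xb_CM :: "('k, 'u) bimod"
  xb_BA :: "('k, 'u) bimod"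
  xb_j :: "'u \<Rightarrow> 'u"
  xb_d :: "'u \<Rightarrow> 'u"
  xb_p :: "'u \<Rightarrow> 'u"

abbreviation xb_M :: "('k, 'u) xbiext \<Rightarrow> ('k, 'u) vect" where "xb_M E \<equiv> bm_space (xb_CM E)"
abbreviation xb_A :: "('k, 'u) xbiext \<Rightarrow> ('k, 'u) vect" where "xb_A E \<equiv> bm_space (xb_BA E)"
abbreviation xb_B :: "('k, 'u) xbiext \<Rightarrow> ('k, 'u) alg" where "xb_B E \<equiv> bm_alg (xb_BA E)"
abbreviation xb_C :: "('k, 'u) xbiext \<Rightarrow> ('k, 'u) alg" where "xb_C E \<equiv> bm_alg (xb_CM E)"

definition is_xbiext :: "('k::field, 'u) xbiext \<Rightarrow> bool" where
  "is_xbiext E \<longleftrightarrow>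
     is_bimodule (xb_CM E) \<and> is_crossed_bimodule (xb_BA E) (xb_d E) \<and>
     xb_j E \<in> linear_maps (xb_M E) (xb_A E) \<and> xb_p E \<in> unital_maps (xb_B E) (xb_C E) \<and>
     exact_seq (xb_M E) (xb_A E) (xb_B E) (xb_C E) (xb_j E) (xb_d E) (xb_p E) \<and>
     (\<forall>b\<in>carrier (xb_B E). \<forall>m\<in>carrier (xb_M E).
        xb_j E (bm_l (xb_CM E) (xb_p E b) m) = bm_l (xb_BA E) b (xb_j E m) \<and>
        xb_j E (bm_r (xb_CM E) m (xb_p E b)) = bm_r (xb_BA E) (xb_j E m) b)"

definition xbiext_maps :: "('k::field, 'u) xbiext \<Rightarrow> ('k, 'u) xbiext \<Rightarrow> 'u maps4 set" where
  "xbiext_maps E E' = {(\<gamma>, \<beta>, \<alpha>, \<mu>).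
     \<gamma> \<in> unital_maps (xb_C E) (xb_C E') \<and> \<beta> \<in> unital_maps (xb_B E) (xb_B E') \<and>
     \<alpha> \<in> linear_maps (xb_A E) (xb_A E') \<and> \<mu> \<in> linear_maps (xb_M E) (xb_M E') \<and>
     (\<forall>m\<in>carrier (xb_M E). \<alpha> (xb_j E m) = xb_j E' (\<mu> m)) \<and>
     (\<forall>a\<in>carrier (xb_A E). \<beta> (xb_d E a) = xb_d E' (\<alpha> a)) \<and>
     (\<forall>b\<in>carrier (xb_B E). \<gamma> (xb_p E b) = xb_p E' (\<beta> b)) \<and>
     bimod_compatible (xb_BA E) (xb_BA E') \<beta> \<alpha>}"

type_synonym ('k, 'u) xbiext_arrow = "(('k, 'u) xbiext, 'u maps4) arrow"

definition XBiext :: "(('k::field, 'u) xbiext, ('k, 'u) xbiext_arrow) cat" where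
  "XBiext = concrete_cat {E. is_xbiext E} xbiext_maps
     (\<lambda>E. (id_map (xb_C E), id_map (xb_B E), id_map (xb_A E), id_map (xb_M E)))
     (\<lambda>E (\<gamma>', \<beta>', \<alpha>', \<mu>') (\<gamma>, \<beta>, \<alpha>, \<mu>).
        (compose (carrier (xb_C E)) \<gamma>' \<gamma>, compose (carrier (xb_B E)) \<beta>' \<beta>,
         compose (carrier (xb_A E)) \<alpha>' \<alpha>, compose (carrier (xb_M E)) \<mu>' \<mu>))"

definition Pi_XBiext :: "(('k, 'u) xbiext, ('k, 'u) xbiext_arrow, ('k, 'u) bimod, ('k, 'u) bimod_arrow) fctr" where
  "Pi_XBiext = concrete_functor xb_CM (\<lambda>(\<gamma>, \<beta>, \<alpha>, \<mu>). (\<gamma>, \<mu>))"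

definition Pi0_XBiext :: "(('k, 'u) xbiext, ('k, 'u) xbiext_arrow, ('k, 'u) alg, ('k, 'u) alg_arrow) fctr" where
  "Pi0_XBiext = base_Bimod \<cdot>\<^sub>F Pi_XBiext"

text \<open>\<open>A\<close> receives the product \<open>a1 * a2 = d a1 * a2\<close> and \<open>M\<close> the zero product. The action of
  \<open>C\<close> on \<open>M\<close> is dropped, as a crossed extension carries it implicitly.\<close>

definition xbiext_to_xext :: "('k, 'u) xbiext \<Rightarrow> ('k, 'u) xext" where
  "xbiext_to_xext E =
     \<lparr>xe_M = zero_mult (xb_M E),
      xe_act = \<lparr>acting = xb_B E,
                acted = with_mult (xb_A E) (\<lambda>a1 a2. bm_l (xb_BA E) (xb_d E a1) a2),
                lact = bm_l (xb_BA E), ract = bm_r (xb_BA E)\<rparr>,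
      xe_C = xb_C E, xe_j = xb_j E, xe_d = xb_d E, xe_p = xb_p E\<rparr>"

definition incl_XBiext :: "(('k, 'u) xbiext, ('k, 'u) xbiext_arrow, ('k, 'u) xext, ('k, 'u) xext_arrow) fctr" where
  "incl_XBiext = concrete_functor xbiext_to_xext id"

end

theory Submission
  imports Defs
begin

text \<open>
  The two lifting properties come from a pullback and a pushout of exact sequences.

  \<^emph>\<open>Cartesian lifts.\<close> Let \<open>0 \<rightarrow> M \<rightarrow> A \<rightarrow> B \<rightarrow> C \<rightarrow> 0\<close> be a crossed extension and \<open>u : D \<rightarrow> C\<close> an algebra
  morphism. Replacing \<open>B\<close> by the fibre product \<open>B \<times>\<^sub>C D\<close>, which acts on \<open>A\<close> through \<open>B\<close>, yields a crossed extension
  \<open>0 \<rightarrow> M \<rightarrow> A \<rightarrow> B \<times>\<^sub>C D \<rightarrow> D \<rightarrow> 0\<close>. Its projection to the given one is cartesian over \<open>u\<close>, since a map into a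
  fibre product is a compatible pair of maps (\<open>cartesian_pullback_map\<close>). On modules this lift is the identity
  of \<open>M\<close> over \<open>u\<close>, which is cartesian as well (\<open>cartesian_hom_module\<close>). As any two cartesian lifts of \<open>u\<close> with the same target differ by an
  isomorphism in a fibre, all cartesian arrows are preserved (\<open>cartesian_preserved\<close>).

  \<^emph>\<open>Opcartesian lifts in fibres.\<close> A map \<open>\<mu> : M \<rightarrow> N\<close> of \<open>C\<close>-modules is lifted by the pushout \<open>Q\<close> of \<open>M \<rightarrow> A\<close> along
  \<open>\<mu>\<close>, the quotient of \<open>A \<oplus> N\<close> by all \<open>(j n, - \<mu> n)\<close>. The algebra \<open>B\<close> acts on \<open>N\<close> through \<open>C\<close>, hence on \<open>Q\<close>, and
  \<open>0 \<rightarrow> N \<rightarrow> Q \<rightarrow> B \<rightarrow> C \<rightarrow> 0\<close> is again a crossed extension. The universal property of the pushout makes the map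
  to it opcartesian (\<open>opcartesian_pushout_map\<close>). In both constructions the product on the crossed module needs
  no separate treatment, as it is given by \<open>a * a' = d a * a'\<close> (\<open>is_crossed_module_iff\<close>).

  The new carriers must again be subsets of the universe. Pairs are coded by an injection of the square of the
  universe into it, which exists because the universe is infinite (\<open>exists_pairing\<close>).

  \<^emph>\<open>Unital case.\<close> Crossed biextensions are exactly the crossed extensions in which \<open>B\<close>, \<open>C\<close>, \<open>p\<close> and the action are
  unital, and their morphisms are those with \<open>\<gamma>\<close> and \<open>\<beta>\<close> unital (\<open>is_xbiext_xext_to_xbiext\<close>,
  \<open>xbiext_maps_iff\<close>). The pullback along a unital map and the pushout along a map of bimodules preserve this class,
  and the comparison maps that arise between its objects are unital. Hence the lifts restrict to the
  subcategories (\<open>cartesian_hom_subcategory\<close>, \<open>vertical_opcartesian_hom_subcategory\<close>). The inclusions are not full,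
  as the zero map from the zero algebra to the ground field is not unital.
\<close>

section \<open>Cartesian arrows and fiberwise opfibrations\<close>

lemma categoryD:
  assumes "category X"
  shows "f \<in> arr X \<Longrightarrow> src X f \<in> obj X" "f \<in> arr X \<Longrightarrow> tgt X f \<in> obj X"
    "x \<in> obj X \<Longrightarrow> ident X x \<in> arr X" "x \<in> obj X \<Longrightarrow> src X (ident X x) = x"
    "x \<in> obj X \<Longrightarrow> tgt X (ident X x) = x"
    "\<lbrakk>f \<in> arr X; g \<in> arr X; tgt X f = src X g\<rbrakk> \<Longrightarrow> cmp X g f \<in> arr X"
    "\<lbrakk>f \<in> arr X; g \<in> arr X; tgt X f = src X g\<rbrakk> \<Longrightarrow> src X (cmp X g f) = src X f"
    "\<lbrakk>f \<in> arr X; g \<in> arr X; tgt X f = src X g\<rbrakk> \<Longrightarrow> tgt X (cmp X g f) = tgt X g"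
    "f \<in> arr X \<Longrightarrow> cmp X f (ident X (src X f)) = f"
    "f \<in> arr X \<Longrightarrow> cmp X (ident X (tgt X f)) f = f"
    "\<lbrakk>f \<in> arr X; g \<in> arr X; h \<in> arr X; tgt X f = src X g; tgt X g = src X h\<rbrakk> \<Longrightarrow>
      cmp X h (cmp X g f) = cmp X (cmp X h g) f"
  using assms unfolding category_def by blast+

lemma functorD:
  assumes "is_functor X Y F"
  shows "category X" "category Y" "x \<in> obj X \<Longrightarrow> on_obj F x \<in> obj Y"
    "f \<in> arr X \<Longrightarrow> on_arr F f \<in> arr Y"
    "f \<in> arr X \<Longrightarrow> src Y (on_arr F f) = on_obj F (src X f)"
    "f \<in> arr X \<Longrightarrow> tgt Y (on_arr F f) = on_obj F (tgt X f)"
    "x \<in> obj X \<Longrightarrow> on_arr F (ident X x) = ident Y (on_obj F x)"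
    "\<lbrakk>f \<in> arr X; g \<in> arr X; tgt X f = src X g\<rbrakk> \<Longrightarrow>
      on_arr F (cmp X g f) = cmp Y (on_arr F g) (on_arr F f)"
  using assms unfolding is_functor_def by blast+

lemma is_functor_fcomp:
  assumes P: "is_functor X Y P" and G: "is_functor Y Z G"
  shows "is_functor X Z (G \<cdot>\<^sub>F P)"
  unfolding is_functor_def fcomp_def
  by (simp add: functorD[OF P] functorD[OF G])

lemma category_opposite: "category X \<Longrightarrow> category (opposite X)"
  by (simp add: category_def opposite_def)

lemma is_functor_opposite:
  "is_functor X Y F \<Longrightarrow> is_functor (opposite X) (opposite Y) F"
  by (simp add: is_functor_def category_opposite) (simp add: opposite_def)

lemma category_fibre:
  assumes F: "is_functor X A F" and a: "a \<in> obj A"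
  shows "category (fibre X A F a)"
proof -
  have ends: "on_obj F (src X f) = a" "on_obj F (tgt X f) = a"
    if "f \<in> arr X" "on_arr F f = ident A a" for f
    using functorD(5,6)[OF F that(1)] that(2) categoryD(4,5)[OF functorD(2)[OF F] a] by simp_all
  have idid: "cmp A (ident A a) (ident A a) = ident A a"
    using categoryD(9)[OF functorD(2)[OF F] categoryD(3)[OF functorD(2)[OF F] a]]
      categoryD(4)[OF functorD(2)[OF F] a] by simp
  show ?thesis
    unfolding category_def fibre_def
    by (simp add: ends categoryD[OF functorD(1)[OF F]] functorD[OF F] idid)
qed

lemma is_functor_fibre:
  assumes P: "is_functor X M P" and F: "is_functor X A F" and G: "is_functor M A G"
    and eq: "functor_eq X (G \<cdot>\<^sub>F P) F" and a: "a \<in> obj A"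
  shows "is_functor (fibre X A F a) (fibre M A G a) P"
proof -
  have "on_obj G (on_obj P x) = on_obj F x" if "x \<in> obj X" for x
    using eq that by (simp add: functor_eq_def fcomp_def)
  moreover have "on_arr G (on_arr P f) = on_arr F f" if "f \<in> arr X" for f
    using eq that by (simp add: functor_eq_def fcomp_def)
  ultimately show ?thesis
    unfolding is_functor_def using category_fibre[OF F a] category_fibre[OF G a]
    by (simp add: fibre_def functorD[OF P])
qed

lemma ex1_eq: "\<lbrakk>\<exists>!x. Q x; Q a; Q b\<rbrakk> \<Longrightarrow> a = b"
  by blast

lemma cartesian_factor:
  assumes "cartesian X A F f" "h \<in> arr X" "u \<in> arr A" "tgt X h = tgt X f"
    "src A u = on_obj F (src X h)" "tgt A u = on_obj F (src X f)"
    "cmp A (on_arr F f) u = on_arr F h"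
  shows "\<exists>!g. g \<in> arr X \<and> src X g = src X h \<and> tgt X g = src X f \<and> on_arr F g = u \<and> cmp X f g = h"
  using assms unfolding cartesian_def by blast

text \<open>Factoring each of two cartesian arrows over the same arrow through the other one gives two comparison
  arrows. They are inverse to each other, because their composites and the identities solve the same
  factorization problem.\<close>

lemma cartesian_vertical_iso:
  assumes F: "is_functor X A F" and f: "cartesian X A F f" and f0: "cartesian X A F f0"
    and t: "tgt X f = tgt X f0" and u: "on_arr F f = on_arr F f0"
  obtains g k where "g \<in> arr X" "k \<in> arr X" "src X g = src X f" "tgt X g = src X f0"
    "src X k = src X f0" "tgt X k = src X f" "cmp X f0 g = f" "cmp X f k = f0"
    "on_arr F g = ident A (on_obj F (src X f))" "on_arr F k = ident A (on_obj F (src X f))"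
    "on_obj F (src X f) = on_obj F (src X f0)"
    "cmp X g k = ident X (src X f0)" "cmp X k g = ident X (src X f)"
proof -
  note FD = functorD[OF F] and XD = categoryD[OF functorD(1)[OF F]] and AD = categoryD[OF functorD(2)[OF F]]
  have fa: "f \<in> arr X" and f0a: "f0 \<in> arr X" using f f0 by (auto simp: cartesian_def)
  have s: "on_obj F (src X f) = on_obj F (src X f0)" using FD(5)[OF fa] FD(5)[OF f0a] u by simp
  let ?i = "ident A (on_obj F (src X f))"
  have ia: "?i \<in> arr A" "src A ?i = on_obj F (src X f)" "tgt A ?i = on_obj F (src X f)"
    using AD(3,4,5) FD(3) XD(1)[OF fa] by auto
  have ci: "cmp A (on_arr F f) ?i = on_arr F f" "cmp A ?i ?i = ?i"
    using AD(9)[of "on_arr F f"] AD(9)[OF ia(1)] FD(4,5) fa ia(2) by auto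
  obtain g where g: "g \<in> arr X" "src X g = src X f" "tgt X g = src X f0" "on_arr F g = ?i" "cmp X f0 g = f"
    using cartesian_factor[OF f0 fa ia(1) t] ia ci s u by auto
  obtain k where k: "k \<in> arr X" "src X k = src X f0" "tgt X k = src X f" "on_arr F k = ?i" "cmp X f k = f0"
    using cartesian_factor[OF f f0a ia(1) t[symmetric]] ia ci s u by auto
  \<comment> \<open>an endomorphism over the identity that is absorbed by a cartesian arrow is an identity\<close>
  have *: "x = ident X (src X e)"
    if e: "cartesian X A F e" and eu: "on_arr F e = on_arr F f" and es: "on_obj F (src X e) = on_obj F (src X f)"
      and x: "x \<in> arr X" "src X x = src X e" "tgt X x = src X e" "on_arr F x = ?i" "cmp X e x = e" for e x
  proof -
    have ea: "e \<in> arr X" using e by (simp add: cartesian_def)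
    have y: "ident X (src X e) \<in> arr X" "src X (ident X (src X e)) = src X e"
      "tgt X (ident X (src X e)) = src X e" "cmp X e (ident X (src X e)) = e"
      "on_arr F (ident X (src X e)) = ?i"
      using XD(1,3,4,5,9) FD(7) ea es by auto
    show ?thesis
      using cartesian_factor[OF e ea ia(1)] ia ci eu es x y by (metis (no_types, lifting))
  qed
  have "cmp X g k = ident X (src X f0)"
    by (rule *[OF f0]) (use g k s u ci XD(6,7,8,11) FD(8) f0a in auto)
  moreover have "cmp X k g = ident X (src X f)"
    by (rule *[OF f]) (use g k s u ci XD(6,7,8,11) FD(8) fa in auto)
  ultimately show ?thesis using that g k s by blast
qed

text \<open>It suffices that one cartesian lift over each arrow is preserved: another lift \<open>f\<close> differs from \<open>f0\<close>
  by an isomorphism in the fibre, which \<open>P\<close> sends to an isomorphism in a fibre, and being cartesian is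
  invariant under composition with such isomorphisms.\<close>

lemma cartesian_preserved:
  assumes P: "is_functor X M P" and F: "is_functor X A F" and G: "is_functor M A G"
    and eq: "functor_eq X (G \<cdot>\<^sub>F P) F"
    and f: "cartesian X A F f" and f0: "cartesian X A F f0"
    and t: "tgt X f = tgt X f0" and u: "on_arr F f = on_arr F f0"
    and Pf0: "cartesian M A G (on_arr P f0)"
  shows "cartesian M A G (on_arr P f)"
proof -
  have eqo: "on_obj G (on_obj P x) = on_obj F x" if "x \<in> obj X" for x
    using eq that by (simp add: functor_eq_def fcomp_def)
  have eqa: "on_arr G (on_arr P f) = on_arr F f" if "f \<in> arr X" for f
    using eq that by (simp add: functor_eq_def fcomp_def)
  note PD = functorD[OF P] and FD = functorD[OF F] and GD = functorD[OF G]
    and XD = categoryD[OF functorD(1)[OF F]] and AD = categoryD[OF functorD(2)[OF F]]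
    and MD = categoryD[OF functorD(1)[OF G]]
  have fa: "f \<in> arr X" and f0a: "f0 \<in> arr X" using f f0 by (auto simp: cartesian_def)
  obtain g k where gk: "g \<in> arr X" "k \<in> arr X" "src X g = src X f" "tgt X g = src X f0"
    "src X k = src X f0" "tgt X k = src X f" "cmp X f0 g = f" "cmp X f k = f0"
    "on_arr F g = ident A (on_obj F (src X f))" "on_arr F k = ident A (on_obj F (src X f))"
    "on_obj F (src X f) = on_obj F (src X f0)"
    "cmp X g k = ident X (src X f0)" "cmp X k g = ident X (src X f)"
    by (rule cartesian_vertical_iso[OF F f f0 t u]) blast
  let ?p = "on_arr P f" and ?pz = "on_arr P f0" and ?g = "on_arr P g" and ?k = "on_arr P k"
  have pa: "?p \<in> arr M" "?pz \<in> arr M" "?g \<in> arr M" "?k \<in> arr M"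
    using PD(4) fa f0a gk by auto
  have ps: "src M ?p = on_obj P (src X f)" "src M ?pz = on_obj P (src X f0)"
    "src M ?g = on_obj P (src X f)" "src M ?k = on_obj P (src X f0)"
    "tgt M ?g = on_obj P (src X f0)" "tgt M ?k = on_obj P (src X f)"
    "tgt M ?p = on_obj P (tgt X f)" "tgt M ?pz = on_obj P (tgt X f)"
    using PD(5,6)[OF fa] PD(5,6)[OF f0a] PD(5,6)[OF gk(1)] PD(5,6)[OF gk(2)] gk(3-6) t by simp_all
  have pc: "cmp M ?pz ?g = ?p" "cmp M ?p ?k = ?pz" "cmp M ?k ?g = ident M (on_obj P (src X f))"
    "cmp M ?g ?k = ident M (on_obj P (src X f0))"
    using PD(8)[OF gk(1) f0a] PD(8)[OF gk(2) fa] PD(8)[OF gk(1,2)] PD(8)[OF gk(2,1)] gk(3-8,12,13)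
      PD(7)[OF XD(1)[OF fa]] PD(7)[OF XD(1)[OF f0a]] by simp_all
  have pi: "on_arr G ?g = ident A (on_obj F (src X f))" "on_arr G ?k = ident A (on_obj F (src X f))"
    using eqa gk by auto
  have po: "on_obj G (on_obj P (src X f)) = on_obj F (src X f)"
    "on_obj G (on_obj P (src X f0)) = on_obj F (src X f)"
    using eqo gk(11) XD(1) fa f0a by auto
  show ?thesis
    unfolding cartesian_def
  proof (intro conjI ballI impI, rule pa(1))
    fix h v assume h: "h \<in> arr M" and v: "v \<in> arr A" and
      hv: "tgt M h = tgt M ?p \<and> src A v = on_obj G (src M h) \<and>
        tgt A v = on_obj G (src M ?p) \<and> cmp A (on_arr G ?p) v = on_arr G h"
    have uu: "on_arr G ?pz = on_arr G ?p" using eqa fa f0a u by simp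
    have ex: "\<exists>!n. n \<in> arr M \<and> src M n = src M h \<and> tgt M n = src M ?pz \<and> on_arr G n = v \<and> cmp M ?pz n = h"
      by (rule cartesian_factor[OF Pf0 h v]) (use hv ps po uu in auto)
    then obtain n where n: "n \<in> arr M" "src M n = src M h" "tgt M n = src M ?pz"
      "on_arr G n = v" "cmp M ?pz n = h" by blast
    have vid: "cmp A (ident A (on_obj F (src X f))) v = v"
      using AD(10)[OF v] hv ps po by simp
    show "\<exists>!q. q \<in> arr M \<and> src M q = src M h \<and> tgt M q = src M ?p \<and> on_arr G q = v \<and> cmp M ?p q = h"
    proof (intro ex1I conjI; (elim conjE)?)
      let ?q = "cmp M ?k n"
      have nk: "tgt M n = src M ?k" using n ps by simp
      show "?q \<in> arr M" "src M ?q = src M h" "tgt M ?q = src M ?p"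
        using MD(6,7,8)[OF n(1) pa(4) nk] n ps by auto
      show "on_arr G ?q = v" using GD(8)[OF n(1) pa(4) nk] n pi vid by simp
      show "cmp M ?p ?q = h" using MD(11)[OF n(1) pa(4,1) nk] ps pc n by simp
      fix q assume q: "q \<in> arr M" "src M q = src M h" "tgt M q = src M ?p" "on_arr G q = v" "cmp M ?p q = h"
      have qg: "tgt M q = src M ?g" using q ps by simp
      have "cmp M ?g q = n"
        by (rule ex1_eq[OF ex])
           (use n MD(6,7,8)[OF q(1) pa(3) qg] MD(11)[OF q(1) pa(3,2) qg] GD(8)[OF q(1) pa(3) qg] q ps pc pi vid in auto)
      then have "?q = cmp M (cmp M ?k ?g) q" using MD(11)[OF q(1) pa(3,4) qg] ps by simp
      also have "\<dots> = q" using pc ps q MD(10)[OF q(1)] by simp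
      finally show "q = ?q" by simp
    qed
  qed
qed

text \<open>The proof obligations that remain when lifts are constructed by hand. Preservation of cartesian arrows
  is only asked of one lift for each arrow of the base.\<close>

lemma fiberwise_opfibrationI:
  assumes P: "is_functor X M P" and F: "is_functor X A F" and G: "is_functor M A G"
    and eq: "functor_eq X (G \<cdot>\<^sub>F P) F"
    and lift_X: "\<And>x u. \<lbrakk>x \<in> obj X; u \<in> arr A; tgt A u = on_obj F x\<rbrakk> \<Longrightarrow>
      \<exists>f. cartesian X A F f \<and> tgt X f = x \<and> on_arr F f = u \<and> cartesian M A G (on_arr P f)"
    and lift_M: "\<And>m u. \<lbrakk>m \<in> obj M; u \<in> arr A; tgt A u = on_obj G m\<rbrakk> \<Longrightarrow>
      \<exists>f. cartesian M A G f \<and> tgt M f = m \<and> on_arr G f = u"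
    and oplift: "\<And>a x v. \<lbrakk>a \<in> obj A; x \<in> obj X; on_obj F x = a; v \<in> arr M; src M v = on_obj P x;
        on_arr G v = ident A a\<rbrakk> \<Longrightarrow>
      \<exists>f. cartesian (opposite (fibre X A F a)) (opposite (fibre M A G a)) P f \<and> src X f = x \<and> on_arr P f = v"
  shows "fiberwise_opfibration A X F M G P"
proof -
  have fX: "fibration X A F" unfolding fibration_def using F lift_X by blast
  have fM: "fibration M A G" unfolding fibration_def using G lift_M by blast
  have pres: "cartesian M A G (on_arr P f)" if f: "cartesian X A F f" for f
  proof -
    have fa: "f \<in> arr X" using f by (simp add: cartesian_def)
    obtain f0 where "cartesian X A F f0" "tgt X f0 = tgt X f" "on_arr F f0 = on_arr F f"
      "cartesian M A G (on_arr P f0)"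
      using lift_X[of "tgt X f" "on_arr F f"] functorD(4,6)[OF F fa] categoryD(2)[OF functorD(1)[OF F] fa] by auto
    then show ?thesis using cartesian_preserved[OF P F G eq f, of f0] by simp
  qed
  have "opfibration (fibre X A F a) (fibre M A G a) P" if a: "a \<in> obj A" for a
    unfolding opfibration_def fibration_def
  proof (intro conjI ballI impI)
    show "is_functor (opposite (fibre X A F a)) (opposite (fibre M A G a)) P"
      by (rule is_functor_opposite[OF is_functor_fibre[OF P F G eq a]])
    fix x v assume "x \<in> obj (opposite (fibre X A F a))" "v \<in> arr (opposite (fibre M A G a))"
      "tgt (opposite (fibre M A G a)) v = on_obj P x"
    then show "\<exists>f. cartesian (opposite (fibre X A F a)) (opposite (fibre M A G a)) P f \<and>
        tgt (opposite (fibre X A F a)) f = x \<and> on_arr P f = v"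
      using oplift[OF a, of x v] by (simp add: opposite_def fibre_def)
  qed
  then show ?thesis
    unfolding fiberwise_opfibration_def fib_morphism_def using fX fM P eq pres by blast
qed

section \<open>Concrete categories\<close>

lemma concrete_cat_simps [simp]:
  "obj (concrete_cat Ob H i c) = Ob"
  "src (concrete_cat Ob H i c) = arrow_src" "tgt (concrete_cat Ob H i c) = arrow_tgt"
  "ident (concrete_cat Ob H i c) x = Arrow x x (i x)"
  "cmp (concrete_cat Ob H i c) g f =
     Arrow (arrow_src f) (arrow_tgt g) (c (arrow_src f) (arrow_map g) (arrow_map f))"
  "Arrow x y m \<in> arr (concrete_cat Ob H i c) \<longleftrightarrow> x \<in> Ob \<and> y \<in> Ob \<and> m \<in> H x y"
  by (auto simp: concrete_cat_def)

lemma concrete_functor_simps [simp]: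
  "on_obj (concrete_functor F \<phi>) = F"
  "on_arr (concrete_functor F \<phi>) (Arrow x y f) = Arrow (F x) (F y) (\<phi> f)"
  by (simp_all add: concrete_functor_def)

lemma ball_arr_concrete [simp]:
  "(\<forall>f\<in>arr (concrete_cat Ob H i c). Q f) \<longleftrightarrow> (\<forall>x\<in>Ob. \<forall>y\<in>Ob. \<forall>f\<in>H x y. Q (Arrow x y f))"
  by (auto simp: concrete_cat_def)

lemma fcomp_concrete:
  "concrete_functor G \<psi> \<cdot>\<^sub>F concrete_functor F \<phi> = concrete_functor (G \<circ> F) (\<psi> \<circ> \<phi>)"
  by (auto simp: fcomp_def concrete_functor_def fun_eq_iff arrow.map_comp)

lemma category_concrete:
  "category (concrete_cat Ob H i c) \<longleftrightarrow>
     (\<forall>x\<in>Ob. i x \<in> H x x) \<and>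
     (\<forall>x\<in>Ob. \<forall>y\<in>Ob. \<forall>z\<in>Ob. \<forall>f\<in>H x y. \<forall>g\<in>H y z. c x g f \<in> H x z) \<and>
     (\<forall>x\<in>Ob. \<forall>y\<in>Ob. \<forall>f\<in>H x y. c x f (i x) = f \<and> c x (i y) f = f) \<and>
     (\<forall>x\<in>Ob. \<forall>y\<in>Ob. \<forall>z\<in>Ob. \<forall>w\<in>Ob. \<forall>f\<in>H x y. \<forall>g\<in>H y z. \<forall>h\<in>H z w. c x h (c x g f) = c x (c y h g) f)"
  unfolding category_def by simp blast

lemma category_concreteD:
  assumes "category (concrete_cat Ob H i c)"
  shows "x \<in> Ob \<Longrightarrow> i x \<in> H x x"
    "\<lbrakk>x \<in> Ob; y \<in> Ob; z \<in> Ob; f \<in> H x y; g \<in> H y z\<rbrakk> \<Longrightarrow> c x g f \<in> H x z"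
    "\<lbrakk>x \<in> Ob; y \<in> Ob; f \<in> H x y\<rbrakk> \<Longrightarrow> c x f (i x) = f"
    "\<lbrakk>x \<in> Ob; y \<in> Ob; f \<in> H x y\<rbrakk> \<Longrightarrow> c x (i y) f = f"
    "\<lbrakk>x \<in> Ob; y \<in> Ob; z \<in> Ob; w \<in> Ob; f \<in> H x y; g \<in> H y z; h \<in> H z w\<rbrakk> \<Longrightarrow>
       c x h (c x g f) = c x (c y h g) f"
  using assms unfolding category_concrete by blast+

lemma is_functor_concrete:
  assumes "category (concrete_cat Ob H i c)" "category (concrete_cat Ob' H' i' c')"
    "\<And>x. x \<in> Ob \<Longrightarrow> F x \<in> Ob'"
    "\<And>x y f. \<lbrakk>x \<in> Ob; y \<in> Ob; f \<in> H x y\<rbrakk> \<Longrightarrow> \<phi> f \<in> H' (F x) (F y)"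
    "\<And>x. x \<in> Ob \<Longrightarrow> \<phi> (i x) = i' (F x)"
    "\<And>x y z f g. \<lbrakk>x \<in> Ob; y \<in> Ob; z \<in> Ob; f \<in> H x y; g \<in> H y z\<rbrakk> \<Longrightarrow>
       \<phi> (c x g f) = c' (F x) (\<phi> g) (\<phi> f)"
  shows "is_functor (concrete_cat Ob H i c) (concrete_cat Ob' H' i' c') (concrete_functor F \<phi>)"
  unfolding is_functor_def using assms by auto

text \<open>A subcategory of a concrete category whose objects are presented by other data: \<open>\<iota>\<close> sends a
  presentation to the object that it presents, and the arrows are sets of the same underlying maps. The
  category laws are inherited.\<close>

lemma concrete_subcategory:
  assumes cat: "category (concrete_cat Ob H i c)"
    and inj: "inj_on \<iota> Ob1" and ob: "\<And>x. x \<in> Ob1 \<Longrightarrow> \<iota> x \<in> Ob"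
    and hom: "\<And>x y. \<lbrakk>x \<in> Ob1; y \<in> Ob1\<rbrakk> \<Longrightarrow> H1 x y \<subseteq> H (\<iota> x) (\<iota> y)"
    and i: "\<And>x. x \<in> Ob1 \<Longrightarrow> i1 x = i (\<iota> x)" "\<And>x. x \<in> Ob1 \<Longrightarrow> i1 x \<in> H1 x x"
    and c: "\<And>x. x \<in> Ob1 \<Longrightarrow> c1 x = c (\<iota> x)"
      "\<And>x y z f g. \<lbrakk>x \<in> Ob1; y \<in> Ob1; z \<in> Ob1; f \<in> H1 x y; g \<in> H1 y z\<rbrakk> \<Longrightarrow> c (\<iota> x) g f \<in> H1 x z"
  shows "embedding (concrete_cat Ob1 H1 i1 c1) (concrete_cat Ob H i c) (concrete_functor \<iota> id)"
proof -
  note C = category_concreteD[OF cat]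
  have cat1: "category (concrete_cat Ob1 H1 i1 c1)"
    unfolding category_concrete
  proof (intro conjI ballI)
    show "i1 x \<in> H1 x x" if "x \<in> Ob1" for x using i that by simp
    show "c1 x g f \<in> H1 x z" if "x \<in> Ob1" "y \<in> Ob1" "z \<in> Ob1" "f \<in> H1 x y" "g \<in> H1 y z" for x y z f g
      using c that by simp
    show "c1 x f (i1 x) = f" "c1 x (i1 y) f = f" if "x \<in> Ob1" "y \<in> Ob1" "f \<in> H1 x y" for x y f
    proof -
      have "f \<in> H (\<iota> x) (\<iota> y)" using that hom by auto
      then show "c1 x f (i1 x) = f" "c1 x (i1 y) f = f"
        using C(3,4)[OF ob ob] c(1) i(1) that by simp_all
    qed
    show "c1 x h (c1 x g f) = c1 x (c1 y h g) f"
      if "x \<in> Ob1" "y \<in> Ob1" "z \<in> Ob1" "w \<in> Ob1" "f \<in> H1 x y" "g \<in> H1 y z" "h \<in> H1 z w" for x y z w f g h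
    proof -
      have "f \<in> H (\<iota> x) (\<iota> y)" "g \<in> H (\<iota> y) (\<iota> z)" "h \<in> H (\<iota> z) (\<iota> w)" using that hom by auto
      then show ?thesis using C(5)[OF ob ob ob ob] c(1) that by simp
    qed
  qed
  have "is_functor (concrete_cat Ob1 H1 i1 c1) (concrete_cat Ob H i c) (concrete_functor \<iota> id)"
    by (rule is_functor_concrete[OF cat1 cat]) (use ob hom i c in auto)
  moreover have "inj_on (on_arr (concrete_functor \<iota> id)) (arr (concrete_cat Ob1 H1 i1 c1))"
    using inj by (auto simp: inj_on_def concrete_cat_def)
  ultimately show "embedding (concrete_cat Ob1 H1 i1 c1) (concrete_cat Ob H i c) (concrete_functor \<iota> id)"
    unfolding embedding_def using inj by simp
qed

lemma embedding_category: "embedding X Y I \<Longrightarrow> category X"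
  by (simp add: embedding_def is_functor_def)

text \<open>Unique existence of an arrow with prescribed ends is unique existence of its underlying map.\<close>

lemma Ex1_Arrow:
  assumes "\<And>g. Q g \<Longrightarrow> arrow_src g = w \<and> arrow_tgt g = x"
  shows "(\<exists>!g. Q g) \<longleftrightarrow> (\<exists>!m. Q (Arrow w x m))"
proof -
  have *: "g = Arrow w x (arrow_map g)" if "Q g" for g
    using assms[OF that] by (cases g) simp
  show ?thesis
  proof
    assume "\<exists>!g. Q g"
    then obtain g where g: "Q g" "\<And>g'. Q g' \<Longrightarrow> g' = g" by (elim ex1E) blast
    show "\<exists>!m. Q (Arrow w x m)"
    proof (rule ex1I[of _ "arrow_map g"])
      show "Q (Arrow w x (arrow_map g))" using *[OF g(1)] g(1) by simp
      show "m = arrow_map g" if "Q (Arrow w x m)" for m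
        using g(2)[OF that] by (metis arrow.sel(3))
    qed
  next
    assume "\<exists>!m. Q (Arrow w x m)"
    then obtain m where m: "Q (Arrow w x m)" "\<And>m'. Q (Arrow w x m') \<Longrightarrow> m' = m" by (elim ex1E) blast
    show "\<exists>!g. Q g"
    proof (rule ex1I[of _ "Arrow w x m"], rule m(1))
      show "g = Arrow w x m" if "Q g" for g
        using *[OF that] m(2)[of "arrow_map g"] that by simp
    qed
  qed
qed

text \<open>Being cartesian, stated for underlying maps, which do not carry their source and target. The
  composition \<open>c\<close> therefore takes the source as an argument.\<close>

definition cartesian_hom where
  "cartesian_hom Ob H c F \<phi> HA cA x y f \<longleftrightarrow>
     (\<forall>w\<in>Ob. \<forall>h\<in>H w y. \<forall>u\<in>HA (F w) (F x). cA (F w) (\<phi> f) u = \<phi> h \<longrightarrow>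
        (\<exists>!g. g \<in> H w x \<and> \<phi> g = u \<and> c w f g = h))"

lemma cartesian_homD:
  "\<lbrakk>cartesian_hom Ob H c F \<phi> HA cA x y f; w \<in> Ob; h \<in> H w y; u \<in> HA (F w) (F x);
    cA (F w) (\<phi> f) u = \<phi> h\<rbrakk> \<Longrightarrow> \<exists>!g. g \<in> H w x \<and> \<phi> g = u \<and> c w f g = h"
  unfolding cartesian_hom_def by metis

lemma cartesian_concrete:
  assumes "\<And>x. x \<in> Ob \<Longrightarrow> F x \<in> ObA"
  shows "cartesian (concrete_cat Ob H i c) (concrete_cat ObA HA iA cA) (concrete_functor F \<phi>) (Arrow x y f) \<longleftrightarrow>
     x \<in> Ob \<and> y \<in> Ob \<and> f \<in> H x y \<and> cartesian_hom Ob H c F \<phi> HA cA x y f"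
  (is "cartesian ?X ?A ?F _ \<longleftrightarrow> _")
  unfolding cartesian_hom_def
proof -
  let ?L = "cartesian ?X ?A ?F (Arrow x y f)"
  let ?R = "x \<in> Ob \<and> y \<in> Ob \<and> f \<in> H x y \<and>
     (\<forall>w\<in>Ob. \<forall>h\<in>H w y. \<forall>u\<in>HA (F w) (F x). cA (F w) (\<phi> f) u = \<phi> h \<longrightarrow>
        (\<exists>!g. g \<in> H w x \<and> \<phi> g = u \<and> c w f g = h))"
  have ex1: "(\<exists>!g. g \<in> arr ?X \<and> src ?X g = w \<and>
        tgt ?X g = x \<and> on_arr ?F g = Arrow (F w) (F x) u \<and>
        cmp ?X (Arrow x y f) g = Arrow w y h)
      \<longleftrightarrow> (\<exists>!g. g \<in> H w x \<and> \<phi> g = u \<and> c w f g = h)"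
    if "w \<in> Ob" "x \<in> Ob" for w h u
    by (subst Ex1_Arrow[where w = w and x = x]) (use that in auto)
  show "?L \<longleftrightarrow> ?R"
  proof
    assume L: ?L
    have xy: "x \<in> Ob" "y \<in> Ob" "f \<in> H x y" using L by (auto simp: cartesian_def)
    show ?R
    proof (intro conjI ballI impI xy)
      fix w h u assume w: "w \<in> Ob" and "h \<in> H w y" "u \<in> HA (F w) (F x)" "cA (F w) (\<phi> f) u = \<phi> h"
      then show "\<exists>!g. g \<in> H w x \<and> \<phi> g = u \<and> c w f g = h"
        using cartesian_factor[OF L, of "Arrow w y h" "Arrow (F w) (F x) u"] xy assms
          ex1[OF w xy(1), of u h]
        by simp
    qed
  next
    assume R: ?R
    show ?L
      unfolding cartesian_def ball_arr_concrete
    proof (intro conjI ballI impI)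
      show "Arrow x y f \<in> arr ?X" using R by simp
      fix w y' h a b u
      assume w: "w \<in> Ob" and h: "h \<in> H w y'" and u: "u \<in> HA a b"
        and eqs: "tgt ?X (Arrow w y' h) = tgt ?X (Arrow x y f) \<and>
         src ?A (Arrow a b u) =
         on_obj ?F (src ?X (Arrow w y' h)) \<and>
         tgt ?A (Arrow a b u) =
         on_obj ?F (src ?X (Arrow x y f)) \<and>
         cmp ?A (on_arr ?F (Arrow x y f)) (Arrow a b u) =
         on_arr ?F (Arrow w y' h)"
      have e: "y' = y" "a = F w" "b = F x" "cA (F w) (\<phi> f) u = \<phi> h" using eqs by auto
      have "\<exists>!g. g \<in> H w x \<and> \<phi> g = u \<and> c w f g = h"
        using R[THEN conjunct2, THEN conjunct2, THEN conjunct2, rule_format, OF w] h u e by simp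
      then show "\<exists>!g. g \<in> arr ?X \<and>
          src ?X g = src ?X (Arrow w y' h) \<and>
          tgt ?X g = src ?X (Arrow x y f) \<and>
          on_arr ?F g = Arrow a b u \<and>
          cmp ?X (Arrow x y f) g = Arrow w y' h"
        using ex1[OF w, of u h] R e by simp
    qed
  qed
qed

text \<open>Being opcartesian for the restriction of \<open>P\<close> to a fibre, stated for underlying maps. The
  comparison map \<open>g\<close> lies in the fibre because its image \<open>w\<close> does.\<close>

definition vertical_opcartesian_hom where
  "vertical_opcartesian_hom Ob H c F \<phi> iA HM cM P \<pi> \<psi> x y f \<longleftrightarrow>
     (\<forall>z\<in>Ob. \<forall>h\<in>H x z. \<forall>w\<in>HM (P y) (P z). F z = F x \<longrightarrow> \<phi> h = iA (F x) \<longrightarrow> \<psi> w = iA (F x) \<longrightarrow>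
        cM (P x) w (\<pi> f) = \<pi> h \<longrightarrow> (\<exists>!g. g \<in> H y z \<and> \<pi> g = w \<and> c x g f = h))"

lemma vertical_opcartesian_homD:
  "\<lbrakk>vertical_opcartesian_hom Ob H c F \<phi> iA HM cM P \<pi> \<psi> x y f; z \<in> Ob; h \<in> H x z;
    w \<in> HM (P y) (P z); F z = F x; \<phi> h = iA (F x); \<psi> w = iA (F x); cM (P x) w (\<pi> f) = \<pi> h\<rbrakk> \<Longrightarrow>
    \<exists>!g. g \<in> H y z \<and> \<pi> g = w \<and> c x g f = h"
  unfolding vertical_opcartesian_hom_def by metis

lemma opcartesian_fibre_concrete:
  assumes x: "x \<in> Ob" and y: "y \<in> Ob" and f: "f \<in> H x y" and a: "F x = a" "F y = a" "\<phi> f = iA a"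
    and univ: "vertical_opcartesian_hom Ob H c F \<phi> iA HM cM P \<pi> \<psi> x y f"
    and F: "\<And>x. x \<in> Ob \<Longrightarrow> F x = G (P x)" "\<And>x y f. \<lbrakk>x \<in> Ob; y \<in> Ob; f \<in> H x y\<rbrakk> \<Longrightarrow> \<phi> f = \<psi> (\<pi> f)"
  shows "cartesian (opposite (fibre (concrete_cat Ob H i c) (concrete_cat ObA HA iA cA) (concrete_functor F \<phi>) a))
     (opposite (fibre (concrete_cat ObM HM iM cM) (concrete_cat ObA HA iA cA) (concrete_functor G \<psi>) a))
     (concrete_functor P \<pi>) (Arrow x y f)"
  (is "cartesian (opposite ?X) (opposite ?M) ?P _")
proof -
  have arrX: "Arrow w z g \<in> arr (opposite ?X) \<longleftrightarrow>
      w \<in> Ob \<and> z \<in> Ob \<and> g \<in> H w z \<and> F w = a \<and> F z = a \<and> \<phi> g = iA a" for w z g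
    by (auto simp: opposite_def fibre_def)
  have arrM: "Arrow w z g \<in> arr (opposite ?M) \<longleftrightarrow>
      w \<in> ObM \<and> z \<in> ObM \<and> g \<in> HM w z \<and> G w = a \<and> G z = a \<and> \<psi> g = iA a" for w z g
    by (auto simp: opposite_def fibre_def)
  have st: "src (opposite ?X) = arrow_tgt" "tgt (opposite ?X) = arrow_src"
    "src (opposite ?M) = arrow_tgt" "tgt (opposite ?M) = arrow_src"
    by (auto simp: opposite_def fibre_def)
  have cmps: "cmp (opposite ?X) h g = cmp (concrete_cat Ob H i c) g h"
    "cmp (opposite ?M) h' g' = cmp (concrete_cat ObM HM iM cM) g' h'" for h g h' g'
    by (auto simp: opposite_def fibre_def)
  show ?thesis
    unfolding cartesian_def
  proof (intro conjI ballI impI)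
    show "Arrow x y f \<in> arr (opposite ?X)" using x y f a by (simp add: arrX)
    fix h0 w0 assume h0: "h0 \<in> arr (opposite ?X)" and w0: "w0 \<in> arr (opposite ?M)"
      and eqs: "tgt (opposite ?X) h0 = tgt (opposite ?X) (Arrow x y f) \<and>
        src (opposite ?M) w0 = on_obj ?P (src (opposite ?X) h0) \<and>
        tgt (opposite ?M) w0 = on_obj ?P (src (opposite ?X) (Arrow x y f)) \<and>
        cmp (opposite ?M) (on_arr ?P (Arrow x y f)) w0 = on_arr ?P h0"
    obtain x' z h where h0_eq: "h0 = Arrow x' z h" by (cases h0)
    obtain m n w where w0_eq: "w0 = Arrow m n w" by (cases w0)
    have e: "x' = x" "m = P y" "n = P z" "cM (P x) w (\<pi> f) = \<pi> h"
      using eqs[unfolded h0_eq w0_eq, unfolded st cmps,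
        unfolded concrete_cat_simps concrete_functor_simps arrow.sel arrow.inject] by blast+
    have h: "z \<in> Ob" "F z = a" "h \<in> H x z" "\<phi> h = iA a" using h0 e by (auto simp: h0_eq arrX)
    have w: "w \<in> HM (P y) (P z)" "\<psi> w = iA a" using w0 e by (auto simp: w0_eq arrM)
    have "\<exists>!g. g \<in> H y z \<and> \<pi> g = w \<and> c x g f = h" 
      by (rule vertical_opcartesian_homD[OF univ h(1,3) w(1)]) (use h w e a in simp_all)
    moreover have "\<phi> g = iA a" if "g \<in> H y z" "\<pi> g = w" for g
      using F(2)[OF y h(1) that(1)] that w by simp
    then have "(\<lambda>g. g \<in> H y z \<and> \<phi> g = iA a \<and> \<pi> g = w \<and> c x g f = h) =
        (\<lambda>g. g \<in> H y z \<and> \<pi> g = w \<and> c x g f = h)" by blast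
    ultimately have ex1: "\<exists>!g. g \<in> H y z \<and> \<phi> g = iA a \<and> \<pi> g = w \<and> c x g f = h" by (simp only:)
    have xa: "F y = a" "F z = a" "y \<in> Ob" "z \<in> Ob" using y h a by auto
    show "\<exists>!g. g \<in> arr (opposite ?X) \<and> src (opposite ?X) g = src (opposite ?X) h0 \<and>
        tgt (opposite ?X) g = src (opposite ?X) (Arrow x y f) \<and> on_arr ?P g = w0 \<and>
        cmp (opposite ?X) (Arrow x y f) g = h0"
      unfolding st cmps h0_eq w0_eq e
      by (subst Ex1_Arrow[where w = y and x = z]) (simp_all add: arrX xa ex1)
  qed
qed

lemma fiberwise_opfibration_concrete:
  assumes P: "is_functor (concrete_cat Ob H i c) (concrete_cat ObM HM iM cM) (concrete_functor P \<pi>)"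
    and G: "is_functor (concrete_cat ObM HM iM cM) (concrete_cat ObA HA iA cA) (concrete_functor G \<psi>)"
    and lift: "\<And>y b u. \<lbrakk>y \<in> Ob; b \<in> ObA; u \<in> HA b (G (P y))\<rbrakk> \<Longrightarrow>
      \<exists>x f. x \<in> Ob \<and> G (P x) = b \<and> f \<in> H x y \<and> \<psi> (\<pi> f) = u \<and>
        cartesian_hom Ob H c (G \<circ> P) (\<psi> \<circ> \<pi>) HA cA x y f \<and>
        cartesian_hom ObM HM cM G \<psi> HA cA (P x) (P y) (\<pi> f)"
    and lift_M: "\<And>n b u. \<lbrakk>n \<in> ObM; b \<in> ObA; u \<in> HA b (G n)\<rbrakk> \<Longrightarrow>
      \<exists>m f. m \<in> ObM \<and> G m = b \<and> f \<in> HM m n \<and> \<psi> f = u \<and> cartesian_hom ObM HM cM G \<psi> HA cA m n f"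
    and oplift: "\<And>x m v. \<lbrakk>x \<in> Ob; m \<in> ObM; v \<in> HM (P x) m; G m = G (P x); \<psi> v = iA (G m)\<rbrakk> \<Longrightarrow>
      \<exists>y f. y \<in> Ob \<and> P y = m \<and> f \<in> H x y \<and> \<pi> f = v \<and>
        vertical_opcartesian_hom Ob H c (G \<circ> P) (\<psi> \<circ> \<pi>) iA HM cM P \<pi> \<psi> x y f"
  shows "fiberwise_opfibration (concrete_cat ObA HA iA cA) (concrete_cat Ob H i c)
     (concrete_functor G \<psi> \<cdot>\<^sub>F concrete_functor P \<pi>) (concrete_cat ObM HM iM cM)
     (concrete_functor G \<psi>) (concrete_functor P \<pi>)"
  (is "fiberwise_opfibration ?A ?X ?F ?M ?G ?P")
proof (rule fiberwise_opfibrationI[OF P is_functor_fcomp[OF P G] G])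
  have PO: "P x \<in> ObM" if "x \<in> Ob" for x using functorD(3)[OF P] that by simp
  have GO: "G x \<in> ObA" if "x \<in> ObM" for x using functorD(3)[OF G] that by simp
  have FO: "(G \<circ> P) x \<in> ObA" if "x \<in> Ob" for x using GO PO that by simp
  have Ph: "\<pi> f \<in> HM (P x) (P y)" if "x \<in> Ob" "y \<in> Ob" "f \<in> H x y" for x y f
    using functorD(4)[OF P, of "Arrow x y f"] that by simp
  show "functor_eq ?X ?F
     ?F" by (simp add: functor_eq_def)
  fix x u0 assume x: "x \<in> obj ?X" and u0: "u0 \<in> arr ?A"
    "tgt ?A u0 = on_obj ?F x"
  obtain b b' u where u: "u0 = Arrow b b' u" by (cases u0)
  have u1: "b' = G (P x)" "b \<in> ObA" "u \<in> HA b (G (P x))"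
    using u0 unfolding u by (simp_all add: fcomp_concrete)
  obtain w f where wf: "w \<in> Ob" "G (P w) = b" "f \<in> H w x" "\<psi> (\<pi> f) = u"
    "cartesian_hom Ob H c (G \<circ> P) (\<psi> \<circ> \<pi>) HA cA w x f"
    "cartesian_hom ObM HM cM G \<psi> HA cA (P w) (P x) (\<pi> f)"
    using lift[OF _ u1(2,3)] x by auto
  show "\<exists>f. cartesian ?X ?A
        ?F f \<and> tgt ?X f = x \<and>
        on_arr ?F f = u0 \<and>
        cartesian ?M ?A ?G
          (on_arr ?P f)"
    unfolding fcomp_concrete
    by (rule exI[of _ "Arrow w x f"])
       (use wf x PO Ph u u1 in \<open>simp add: cartesian_concrete FO GO\<close>)
next
  have GO: "G x \<in> ObA" if "x \<in> ObM" for x using functorD(3)[OF G] that by simp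
  fix n u0 assume x: "n \<in> obj ?M" and u0: "u0 \<in> arr ?A"
    "tgt ?A u0 = on_obj ?G n"
  obtain b b' u where u: "u0 = Arrow b b' u" by (cases u0)
  have u1: "b' = G n" "b \<in> ObA" "u \<in> HA b (G n)"
    using u0 unfolding u by simp_all
  obtain m f where "m \<in> ObM" "G m = b" "f \<in> HM m n" "\<psi> f = u" "cartesian_hom ObM HM cM G \<psi> HA cA m n f"
    using lift_M[OF _ u1(2,3)] x by auto
  then show "\<exists>f. cartesian ?M ?A ?G f \<and>
        tgt ?M f = n \<and> on_arr ?G f = u0"
    by (intro exI[of _ "Arrow m n f"]) (use x u u1 in \<open>simp add: cartesian_concrete GO\<close>)
next
  fix a x v0 assume a: "a \<in> obj ?A" and x: "x \<in> obj ?X"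
    "on_obj ?F x = a"
    and v0: "v0 \<in> arr ?M"
    "src ?M v0 = on_obj ?P x"
    "on_arr ?G v0 = ident ?A a"
  obtain m' m v where v: "v0 = Arrow m' m v" by (cases v0)
  have v1: "m' = P x" "m \<in> ObM" "v \<in> HM (P x) m" "G m = G (P x)" "\<psi> v = iA (G m)"
    using v0 x unfolding v by (simp_all add: fcomp_concrete)
  obtain y f where yf: "y \<in> Ob" "P y = m" "f \<in> H x y" "\<pi> f = v"
        "vertical_opcartesian_hom Ob H c (G \<circ> P) (\<psi> \<circ> \<pi>) iA HM cM P \<pi> \<psi> x y f"
    using oplift[OF _ v1(2-5)] x by auto
  have "cartesian (opposite (fibre ?X ?A
            ?F a))
          (opposite (fibre ?M ?A ?G a))
          ?P (Arrow x y f)"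
    unfolding fcomp_concrete
    by (rule opcartesian_fibre_concrete[OF _ yf(1,3) _ _ _ yf(5)])
       (use x v1 yf in \<open>simp_all add: fcomp_concrete\<close>)
  then show "\<exists>f. cartesian (opposite (fibre ?X ?A
            ?F a))
          (opposite (fibre ?M ?A ?G a))
          ?P f \<and> src ?X f = x \<and> on_arr ?P f = v0"
    by (rule exI[of _ "Arrow x y f", OF conjI]) (use yf v v1 in simp)
qed

text \<open>A cartesian arrow of the ambient category whose ends and underlying map belong to the subcategory has
  the same comparison maps there, provided that these belong to the subcategory. This is what
  \<open>reflect\<close> demands.\<close>

lemma cartesian_hom_subcategory:
  assumes cart: "cartesian_hom Ob H c F \<phi> HA cA (\<iota> x) (\<iota> y) f"
    and x: "x \<in> Ob1" and y: "y \<in> Ob1"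
    and ob: "\<And>w. w \<in> Ob1 \<Longrightarrow> \<iota> w \<in> Ob"
    and hom: "\<And>w z. \<lbrakk>w \<in> Ob1; z \<in> Ob1\<rbrakk> \<Longrightarrow> H1 w z \<subseteq> H (\<iota> w) (\<iota> z)"
    and homA: "\<And>w z. \<lbrakk>w \<in> Ob1; z \<in> Ob1\<rbrakk> \<Longrightarrow> HA1 (F1 w) (F1 z) \<subseteq> HA (F (\<iota> w)) (F (\<iota> z))"
    and comp: "\<And>w. w \<in> Ob1 \<Longrightarrow> c1 w = c (\<iota> w)"
      "\<And>w. w \<in> Ob1 \<Longrightarrow> cA1 (F1 w) = cA (F (\<iota> w))"
    and reflect: "\<And>w g. \<lbrakk>w \<in> Ob1; g \<in> H (\<iota> w) (\<iota> x); \<phi> g \<in> HA1 (F1 w) (F1 x); c (\<iota> w) f g \<in> H1 w y\<rbrakk> \<Longrightarrow>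
      g \<in> H1 w x"
  shows "cartesian_hom Ob1 H1 c1 F1 \<phi> HA1 cA1 x y f"
  unfolding cartesian_hom_def
proof (intro ballI impI)
  fix w h u assume w: "w \<in> Ob1" and h: "h \<in> H1 w y" and u: "u \<in> HA1 (F1 w) (F1 x)"
    and uh: "cA1 (F1 w) (\<phi> f) u = \<phi> h"
  have ex: "\<exists>!g. g \<in> H (\<iota> w) (\<iota> x) \<and> \<phi> g = u \<and> c (\<iota> w) f g = h"
    by (rule cartesian_homD[OF cart ob[OF w]]) (use hom[OF w y] h homA[OF w x] u uh comp(2)[OF w] in auto)
  have "(\<lambda>g. g \<in> H1 w x \<and> \<phi> g = u \<and> c1 w f g = h) = (\<lambda>g. g \<in> H (\<iota> w) (\<iota> x) \<and> \<phi> g = u \<and> c (\<iota> w) f g = h)"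
    using reflect[OF w] hom[OF w x] h u comp(1)[OF w] by (auto simp: fun_eq_iff)
  with ex show "\<exists>!g. g \<in> H1 w x \<and> \<phi> g = u \<and> c1 w f g = h" by simp
qed

lemma vertical_opcartesian_hom_subcategory:
  assumes opcart: "vertical_opcartesian_hom Ob H c F \<phi> iA HM cM P \<pi> \<psi> (\<iota> x) (\<iota> y) f"
    and x: "x \<in> Ob1" and y: "y \<in> Ob1"
    and ob: "\<And>w. w \<in> Ob1 \<Longrightarrow> \<iota> w \<in> Ob"
    and hom: "\<And>w z. \<lbrakk>w \<in> Ob1; z \<in> Ob1\<rbrakk> \<Longrightarrow> H1 w z \<subseteq> H (\<iota> w) (\<iota> z)"
    and homM: "\<And>w z. \<lbrakk>w \<in> Ob1; z \<in> Ob1\<rbrakk> \<Longrightarrow> HM1 (P1 w) (P1 z) \<subseteq> HM (P (\<iota> w)) (P (\<iota> z))"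
    and comp: "\<And>w. w \<in> Ob1 \<Longrightarrow> c1 w = c (\<iota> w)"
      "\<And>w. w \<in> Ob1 \<Longrightarrow> cM1 (P1 w) = cM (P (\<iota> w))"
    and F: "\<And>w. w \<in> Ob1 \<Longrightarrow> F (\<iota> w) = F1 w" "iA1 (F1 x) = iA (F (\<iota> x))"
    and reflect: "\<And>z g. \<lbrakk>z \<in> Ob1; g \<in> H (\<iota> y) (\<iota> z); \<pi> g \<in> HM1 (P1 y) (P1 z); c (\<iota> x) g f \<in> H1 x z\<rbrakk> \<Longrightarrow>
      g \<in> H1 y z"
  shows "vertical_opcartesian_hom Ob1 H1 c1 F1 \<phi> iA1 HM1 cM1 P1 \<pi> \<psi> x y f"
  unfolding vertical_opcartesian_hom_def
proof (intro ballI impI)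
  fix z h w assume z: "z \<in> Ob1" and h: "h \<in> H1 x z" and w: "w \<in> HM1 (P1 y) (P1 z)"
    and eqs: "F1 z = F1 x" "\<phi> h = iA1 (F1 x)" "\<psi> w = iA1 (F1 x)" "cM1 (P1 x) w (\<pi> f) = \<pi> h"
  have ex: "\<exists>!g. g \<in> H (\<iota> y) (\<iota> z) \<and> \<pi> g = w \<and> c (\<iota> x) g f = h"
    by (rule vertical_opcartesian_homD[OF opcart ob[OF z]])
       (use hom[OF x z] h homM[OF y z] w eqs comp(2)[OF x] F(1)[OF x] F(1)[OF z] F(2) in auto)
  have "(\<lambda>g. g \<in> H1 y z \<and> \<pi> g = w \<and> c1 x g f = h) = (\<lambda>g. g \<in> H (\<iota> y) (\<iota> z) \<and> \<pi> g = w \<and> c (\<iota> x) g f = h)"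
    using reflect[OF z] hom[OF y z] h w comp(1)[OF x] by (auto simp: fun_eq_iff)
  with ex show "\<exists>!g. g \<in> H1 y z \<and> \<pi> g = w \<and> c1 x g f = h" by simp
qed

section \<open>Vector spaces and bilinear operations\<close>

lemma extensional_pair_iff:
  "(\<lambda>(x, y). f x y) \<in> extensional (A \<times> B) \<longleftrightarrow> (\<forall>x y. x \<notin> A \<or> y \<notin> B \<longrightarrow> f x y = undefined)"
  by (auto simp: extensional_def)

text \<open>Inverses are expressed as multiplication with \<open>-1\<close>, so that all computations below are phrased with
  addition and scalar multiplication alone.\<close>

lemma vspaceD:
  assumes "vspace V"
  shows "\<lbrakk>x \<in> carrier V; y \<in> carrier V\<rbrakk> \<Longrightarrow> vadd V x y \<in> carrier V"
    "\<lbrakk>x \<in> carrier V; y \<in> carrier V; z \<in> carrier V\<rbrakk> \<Longrightarrow> vadd V (vadd V x y) z = vadd V x (vadd V y z)"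
    "\<lbrakk>x \<in> carrier V; y \<in> carrier V\<rbrakk> \<Longrightarrow> vadd V x y = vadd V y x"
    "vzero V \<in> carrier V"
    "x \<in> carrier V \<Longrightarrow> vadd V (vzero V) x = x"
    "x \<in> carrier V \<Longrightarrow> vscale V r x \<in> carrier V"
    "\<lbrakk>x \<in> carrier V; y \<in> carrier V\<rbrakk> \<Longrightarrow> vscale V r (vadd V x y) = vadd V (vscale V r x) (vscale V r y)"
    "x \<in> carrier V \<Longrightarrow> vscale V (r + s) x = vadd V (vscale V r x) (vscale V s x)"
    "x \<in> carrier V \<Longrightarrow> vscale V (r * s) x = vscale V r (vscale V s x)"
    "x \<in> carrier V \<Longrightarrow> vscale V 1 x = x"
    "\<lbrakk>x \<in> carrier V; y \<in> carrier V; z \<in> carrier V\<rbrakk> \<Longrightarrow> vadd V x (vadd V y z) = vadd V y (vadd V x z)"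
    "x \<in> carrier V \<Longrightarrow> vadd V x (vzero V) = x"
    "\<lbrakk>x \<in> carrier V; y \<in> carrier V; z \<in> carrier V; vadd V x y = vadd V x z\<rbrakk> \<Longrightarrow> y = z"
    "x \<in> carrier V \<Longrightarrow> vscale V 0 x = vzero V"
    "x \<in> carrier V \<Longrightarrow> vadd V x (vscale V (-1) x) = vzero V"
    "\<lbrakk>x \<in> carrier V; y \<in> carrier V\<rbrakk> \<Longrightarrow> vadd V x (vadd V (vscale V (-1) x) y) = y"
    "vscale V r (vzero V) = vzero V"
    "\<lbrakk>x \<notin> carrier V \<or> y \<notin> carrier V\<rbrakk> \<Longrightarrow> vadd V x y = undefined"
    "x \<notin> carrier V \<Longrightarrow> vscale V r x = undefined"
proof -
  let ?G = "\<lparr>carrier = carrier V, monoid.mult = vadd V, one = vzero V\<rparr>"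
  note a = assms[unfolded vspace_def extensional_pair_iff]
  interpret comm_group ?G using a by blast
  show cl: "\<lbrakk>x \<in> carrier V; y \<in> carrier V\<rbrakk> \<Longrightarrow> vadd V x y \<in> carrier V" for x y using m_closed[of x y] by simp
  show as: "\<lbrakk>x \<in> carrier V; y \<in> carrier V; z \<in> carrier V\<rbrakk> \<Longrightarrow> vadd V (vadd V x y) z = vadd V x (vadd V y z)"
    for x y z using m_assoc[of x y z] by simp
  show "\<lbrakk>x \<in> carrier V; y \<in> carrier V\<rbrakk> \<Longrightarrow> vadd V x y = vadd V y x" using m_comm[of x y] by simp
  show "\<lbrakk>x \<in> carrier V; y \<in> carrier V; z \<in> carrier V\<rbrakk> \<Longrightarrow> vadd V x (vadd V y z) = vadd V y (vadd V x z)"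
    using m_lcomm[of x y z] by simp
  show z: "vzero V \<in> carrier V" using one_closed by simp
  show lz: "x \<in> carrier V \<Longrightarrow> vadd V (vzero V) x = x" for x using l_one[of x] by simp
  show rz: "x \<in> carrier V \<Longrightarrow> vadd V x (vzero V) = x" for x using r_one[of x] by simp
  show can: "\<lbrakk>x \<in> carrier V; y \<in> carrier V; z \<in> carrier V; vadd V x y = vadd V x z\<rbrakk> \<Longrightarrow> y = z" for x y z
    using Units_l_cancel[of x y z] by (simp add: Units_eq)
  show sc: "x \<in> carrier V \<Longrightarrow> vscale V r x \<in> carrier V" for r x using a by (auto simp: PiE_def Pi_def)
  show sa: "\<lbrakk>x \<in> carrier V; y \<in> carrier V\<rbrakk> \<Longrightarrow> vscale V r (vadd V x y) = vadd V (vscale V r x) (vscale V r y)"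
    for r x y using a by blast
  show as: "x \<in> carrier V \<Longrightarrow> vscale V (r + s) x = vadd V (vscale V r x) (vscale V s x)" for r s x using a by blast
  show "x \<in> carrier V \<Longrightarrow> vscale V (r * s) x = vscale V r (vscale V s x)" using a by blast
  show s1: "x \<in> carrier V \<Longrightarrow> vscale V 1 x = x" for x using a by blast
  show s0: "vscale V 0 x = vzero V" if "x \<in> carrier V" for x
  proof -
    have "vadd V (vscale V 0 x) (vscale V 0 x) = vadd V (vscale V 0 x) (vzero V)"
      using as[OF that, of 0 0] sc[OF that] rz by simp
    then show ?thesis using can sc[OF that] z by blast
  qed
  show neg: "vadd V x (vscale V (-1) x) = vzero V" if "x \<in> carrier V" for x
    using as[OF that, of 1 "-1"] s0[OF that] s1[OF that] by simp
  show "vadd V x (vadd V (vscale V (-1) x) y) = y" if "x \<in> carrier V" "y \<in> carrier V"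
    using m_assoc[of x "vscale V (-1) x" y] neg[OF that(1)] sc that lz by simp
  show "vscale V r (vzero V) = vzero V"
  proof -
    have "vadd V (vscale V r (vzero V)) (vscale V r (vzero V)) = vadd V (vscale V r (vzero V)) (vzero V)"
      using sa[OF z z, of r] sc[OF z] lz rz z by simp
    then show ?thesis using can sc z by blast
  qed
  show "x \<notin> carrier V \<or> y \<notin> carrier V \<Longrightarrow> vadd V x y = undefined" using a by blast
  show "x \<notin> carrier V \<Longrightarrow> vscale V r x = undefined" using a by (auto simp: PiE_def extensional_def)
qed

lemmas vspace_simps = vspaceD(1-12,14-17)

text \<open>The assumption on multiplication with \<open>0\<close> replaces the existence of inverses.\<close>

lemma vspaceI:
  assumes "\<And>x y. \<lbrakk>x \<in> carrier V; y \<in> carrier V\<rbrakk> \<Longrightarrow> vadd V x y \<in> carrier V"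
    "\<And>x y z. \<lbrakk>x \<in> carrier V; y \<in> carrier V; z \<in> carrier V\<rbrakk> \<Longrightarrow> vadd V (vadd V x y) z = vadd V x (vadd V y z)"
    "\<And>x y. \<lbrakk>x \<in> carrier V; y \<in> carrier V\<rbrakk> \<Longrightarrow> vadd V x y = vadd V y x"
    "vzero V \<in> carrier V"
    "\<And>x. x \<in> carrier V \<Longrightarrow> vadd V (vzero V) x = x"
    "\<And>r x. x \<in> carrier V \<Longrightarrow> vscale V r x \<in> carrier V"
    "\<And>r x y. \<lbrakk>x \<in> carrier V; y \<in> carrier V\<rbrakk> \<Longrightarrow> vscale V r (vadd V x y) = vadd V (vscale V r x) (vscale V r y)"
    "\<And>r s x. x \<in> carrier V \<Longrightarrow> vscale V (r + s) x = vadd V (vscale V r x) (vscale V s x)"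
    "\<And>r s x. x \<in> carrier V \<Longrightarrow> vscale V (r * s) x = vscale V r (vscale V s x)"
    "\<And>x. x \<in> carrier V \<Longrightarrow> vscale V 1 x = x"
    "\<And>x. x \<in> carrier V \<Longrightarrow> vscale V 0 x = vzero V"
    "\<And>x y. \<lbrakk>x \<notin> carrier V \<or> y \<notin> carrier V\<rbrakk> \<Longrightarrow> vadd V x y = undefined"
    "\<And>r x. x \<notin> carrier V \<Longrightarrow> vscale V r x = undefined"
  shows "vspace V"
proof -
  let ?G = "\<lparr>carrier = carrier V, monoid.mult = vadd V, one = vzero V\<rparr>"
  have neg: "vadd V (vscale V (-1) x) x = vzero V" if "x \<in> carrier V" for x
    using assms(8)[OF that, of "-1" 1] assms(10,11)[OF that] by simp
  have "comm_group ?G"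
  proof (rule comm_groupI)
    fix x assume "x \<in> carrier ?G"
    then show "\<exists>y\<in>carrier ?G. y \<otimes>\<^bsub>?G\<^esub> x = \<one>\<^bsub>?G\<^esub>"
      by (intro bexI[of _ "vscale V (-1) x"]) (simp_all add: neg assms(6))
  qed (use assms(1-5) in auto)
  then show ?thesis
    unfolding vspace_def extensional_pair_iff using assms by (auto simp: PiE_def Pi_def extensional_def)
qed

lemma linear_mapsD:
  assumes "f \<in> linear_maps V W"
  shows "x \<in> carrier V \<Longrightarrow> f x \<in> carrier W"
    "\<lbrakk>x \<in> carrier V; y \<in> carrier V\<rbrakk> \<Longrightarrow> f (vadd V x y) = vadd W (f x) (f y)"
    "x \<in> carrier V \<Longrightarrow> f (vscale V r x) = vscale W r (f x)"
    "f \<in> extensional (carrier V)"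
  using assms by (auto simp: linear_maps_def PiE_def Pi_def)

lemma linear_maps_zero:
  "\<lbrakk>f \<in> linear_maps V W; vspace V; vspace W\<rbrakk> \<Longrightarrow> f (vzero V) = vzero W"
  using linear_mapsD(3)[where f = f and V = V and W = W and x = "vzero V" and r = 0] linear_mapsD(1)[where f = f and V = V and W = W and x = "vzero V"] by (simp add: vspace_simps)

lemma linear_mapsI:
  assumes "\<And>x. x \<in> carrier V \<Longrightarrow> f x \<in> carrier W"
    "\<And>x y. \<lbrakk>x \<in> carrier V; y \<in> carrier V\<rbrakk> \<Longrightarrow> f (vadd V x y) = vadd W (f x) (f y)"
    "\<And>r x. x \<in> carrier V \<Longrightarrow> f (vscale V r x) = vscale W r (f x)"
    "\<And>x. x \<notin> carrier V \<Longrightarrow> f x = undefined"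
  shows "f \<in> linear_maps V W"
  using assms by (auto simp: linear_maps_def PiE_def Pi_def extensional_def)

lemma bilinear_opD:
  assumes "bilinear_op U V W f"
  shows "\<lbrakk>x \<in> carrier U; y \<in> carrier V\<rbrakk> \<Longrightarrow> f x y \<in> carrier W"
    "\<lbrakk>x \<in> carrier U; y \<in> carrier V; y' \<in> carrier V; vadd V y y' \<in> carrier V\<rbrakk> \<Longrightarrow> f x (vadd V y y') = vadd W (f x y) (f x y')"
    "\<lbrakk>x \<in> carrier U; y \<in> carrier V; vscale V k y \<in> carrier V\<rbrakk> \<Longrightarrow> f x (vscale V k y) = vscale W k (f x y)"
    "\<lbrakk>x \<in> carrier U; x' \<in> carrier U; y \<in> carrier V; vadd U x x' \<in> carrier U\<rbrakk> \<Longrightarrow> f (vadd U x x') y = vadd W (f x y) (f x' y)"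
    "\<lbrakk>x \<in> carrier U; y \<in> carrier V; vscale U k x \<in> carrier U\<rbrakk> \<Longrightarrow> f (vscale U k x) y = vscale W k (f x y)"
    "x \<notin> carrier U \<or> y \<notin> carrier V \<Longrightarrow> f x y = undefined"
proof -
  note b = assms[unfolded bilinear_op_def]
  show "\<lbrakk>x \<in> carrier U; y \<in> carrier V\<rbrakk> \<Longrightarrow> f x y \<in> carrier W" using b by (auto simp: PiE_def Pi_def)
  show "x \<notin> carrier U \<or> y \<notin> carrier V \<Longrightarrow> f x y = undefined" using b by (auto simp: PiE_def extensional_def)
  show "f x (vadd V y y') = vadd W (f x y) (f x y')"
    if "x \<in> carrier U" "y \<in> carrier V" "y' \<in> carrier V" "vadd V y y' \<in> carrier V"
    using b[THEN conjunct2, THEN conjunct1, rule_format, OF that(1), THEN linear_mapsD(2), OF that(2,3)] that by simp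
  show "f x (vscale V k y) = vscale W k (f x y)"
    if "x \<in> carrier U" "y \<in> carrier V" "vscale V k y \<in> carrier V"
    using b[THEN conjunct2, THEN conjunct1, rule_format, OF that(1), THEN linear_mapsD(3), OF that(2), of k] that by simp
  show "f (vadd U x x') y = vadd W (f x y) (f x' y)"
    if "x \<in> carrier U" "x' \<in> carrier U" "y \<in> carrier V" "vadd U x x' \<in> carrier U"
    using b[THEN conjunct2, THEN conjunct2, rule_format, OF that(3), THEN linear_mapsD(2), OF that(1,2)] that by simp
  show "f (vscale U k x) y = vscale W k (f x y)"
    if "x \<in> carrier U" "y \<in> carrier V" "vscale U k x \<in> carrier U"
    using b[THEN conjunct2, THEN conjunct2, rule_format, OF that(2), THEN linear_mapsD(3), OF that(1), of k] that by simp
qed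

lemma bilinear_opI:
  assumes "\<And>x y. \<lbrakk>x \<in> carrier U; y \<in> carrier V\<rbrakk> \<Longrightarrow> f x y \<in> carrier W"
    "\<And>x y y'. \<lbrakk>x \<in> carrier U; y \<in> carrier V; y' \<in> carrier V\<rbrakk> \<Longrightarrow> f x (vadd V y y') = vadd W (f x y) (f x y')"
    "\<And>k x y. \<lbrakk>x \<in> carrier U; y \<in> carrier V\<rbrakk> \<Longrightarrow> f x (vscale V k y) = vscale W k (f x y)"
    "\<And>x x' y. \<lbrakk>x \<in> carrier U; x' \<in> carrier U; y \<in> carrier V\<rbrakk> \<Longrightarrow> f (vadd U x x') y = vadd W (f x y) (f x' y)"
    "\<And>k x y. \<lbrakk>x \<in> carrier U; y \<in> carrier V\<rbrakk> \<Longrightarrow> f (vscale U k x) y = vscale W k (f x y)"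
    "\<And>x y. x \<notin> carrier U \<or> y \<notin> carrier V \<Longrightarrow> f x y = undefined"
    and U: "vspace U" and V: "vspace V"
  shows "bilinear_op U V W f"
  unfolding bilinear_op_def
  by (auto simp: linear_maps_def PiE_def Pi_def extensional_def assms vspaceD(1,6)[OF U] vspaceD(1,6)[OF V])

lemma bilinear_op_zero:
  assumes f: "bilinear_op U V W f" and U: "vspace U" and V: "vspace V" and W: "vspace W"
  shows "x \<in> carrier U \<Longrightarrow> f x (vzero V) = vzero W" "y \<in> carrier V \<Longrightarrow> f (vzero U) y = vzero W"
proof -
  show "f x (vzero V) = vzero W" if "x \<in> carrier U"
    using bilinear_opD(3)[OF f that, of "vzero V" 0] bilinear_opD(1)[OF f that, of "vzero V"] V W
    by (simp add: vspace_simps)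
  show "f (vzero U) y = vzero W" if "y \<in> carrier V"
    using bilinear_opD(5)[OF f _ that, of "vzero U" 0] bilinear_opD(1)[OF f _ that, of "vzero U"] U W
    by (simp add: vspace_simps)
qed

section \<open>Actions, crossed modules and modules\<close>

text \<open>An action of \<open>B\<close> on the vector space underlying \<open>A\<close>, that is a bimodule without unit condition.\<close>

definition biaction ::
  "('k::field, 'u) alg \<Rightarrow> ('k, 'u, 'z) vect_scheme \<Rightarrow> ('u \<Rightarrow> 'u \<Rightarrow> 'u) \<Rightarrow> ('u \<Rightarrow> 'u \<Rightarrow> 'u) \<Rightarrow> bool" where
  "biaction B A l r \<longleftrightarrow> assoc_algebra B \<and> vspace A \<and> bilinear_op B A A l \<and> bilinear_op A B A r \<and>
     (\<forall>a\<in>carrier A. \<forall>b\<in>carrier B. \<forall>b'\<in>carrier B.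
        r a (amult B b b') = r (r a b) b' \<and> l (amult B b b') a = l b (l b' a) \<and> r (l b a) b' = l b (r a b'))"

text \<open>A crossed bimodule over an algebra that may lack a unit. The product of \<open>A\<close> is not part of the data,
  as the crossed module axioms force it to be \<open>d a * a'\<close>.\<close>

definition precrossed ::
  "('k::field, 'u) alg \<Rightarrow> ('k, 'u, 'z) vect_scheme \<Rightarrow> ('u \<Rightarrow> 'u \<Rightarrow> 'u) \<Rightarrow> ('u \<Rightarrow> 'u \<Rightarrow> 'u) \<Rightarrow> ('u \<Rightarrow> 'u) \<Rightarrow> bool" where
  "precrossed B A l r d \<longleftrightarrow> biaction B A l r \<and> d \<in> linear_maps A B \<and>
     (\<forall>a\<in>carrier A. \<forall>b\<in>carrier B. d (l b a) = amult B b (d a) \<and> d (r a b) = amult B (d a) b) \<and>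
     (\<forall>a\<in>carrier A. \<forall>a'\<in>carrier A. l (d a) a' = r a (d a'))"

lemma assoc_algebraD:
  assumes "assoc_algebra A"
  shows "vspace A" "bilinear_op A A A (amult A)"
    "\<lbrakk>x \<in> carrier A; y \<in> carrier A; z \<in> carrier A\<rbrakk> \<Longrightarrow> amult A (amult A x y) z = amult A x (amult A y z)"
    "\<lbrakk>x \<in> carrier A; y \<in> carrier A\<rbrakk> \<Longrightarrow> amult A x y \<in> carrier A"
  using assms bilinear_opD(1)[of A A A "amult A" x y] by (auto simp: assoc_algebra_def)

lemma biactionD:
  assumes "biaction B A l r"
  shows "assoc_algebra B" "vspace A" "bilinear_op B A A l" "bilinear_op A B A r" "vspace B"
    "\<lbrakk>a \<in> carrier A; b \<in> carrier B; b' \<in> carrier B\<rbrakk> \<Longrightarrow> r a (amult B b b') = r (r a b) b'"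
    "\<lbrakk>a \<in> carrier A; b \<in> carrier B; b' \<in> carrier B\<rbrakk> \<Longrightarrow> l (amult B b b') a = l b (l b' a)"
    "\<lbrakk>a \<in> carrier A; b \<in> carrier B; b' \<in> carrier B\<rbrakk> \<Longrightarrow> r (l b a) b' = l b (r a b')"
    "\<lbrakk>a \<in> carrier A; b \<in> carrier B\<rbrakk> \<Longrightarrow> l b a \<in> carrier A"
    "\<lbrakk>a \<in> carrier A; b \<in> carrier B\<rbrakk> \<Longrightarrow> r a b \<in> carrier A"
proof -
  show *: "assoc_algebra B" "vspace A" "bilinear_op B A A l" "bilinear_op A B A r"
    using assms by (auto simp: biaction_def)
  show "vspace B" using assoc_algebraD(1)[OF *(1)] .
  show "\<lbrakk>a \<in> carrier A; b \<in> carrier B\<rbrakk> \<Longrightarrow> l b a \<in> carrier A" using bilinear_opD(1)[OF *(3)] .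
  show "\<lbrakk>a \<in> carrier A; b \<in> carrier B\<rbrakk> \<Longrightarrow> r a b \<in> carrier A" using bilinear_opD(1)[OF *(4)] .
qed (use assms in \<open>auto simp: biaction_def\<close>)

lemma precrossedD:
  assumes "precrossed B A l r d"
  shows "biaction B A l r" "d \<in> linear_maps A B"
    "\<lbrakk>a \<in> carrier A; b \<in> carrier B\<rbrakk> \<Longrightarrow> d (l b a) = amult B b (d a)"
    "\<lbrakk>a \<in> carrier A; b \<in> carrier B\<rbrakk> \<Longrightarrow> d (r a b) = amult B (d a) b"
    "\<lbrakk>a \<in> carrier A; a' \<in> carrier A\<rbrakk> \<Longrightarrow> l (d a) a' = r a (d a')"
    "a \<in> carrier A \<Longrightarrow> d a \<in> carrier B"
  using assms linear_mapsD(1)[of d A B a] by (auto simp: precrossed_def)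

lemma with_mult_simps [simp]:
  "carrier (with_mult V f) = carrier V" "vadd (with_mult V f) = vadd V"
  "vzero (with_mult V f) = vzero V" "vscale (with_mult V f) = vscale V"
  "vect.truncate (with_mult V f) = V"
  "amult (with_mult V f) = (\<lambda>x y. if x \<in> carrier V \<and> y \<in> carrier V then f x y else undefined)"
  by (simp_all add: with_mult_def vect.defs alg.defs)

lemma truncate_simps [simp]:
  "carrier (vect.truncate V) = carrier V" "vadd (vect.truncate V) = vadd V"
  "vzero (vect.truncate V) = vzero V" "vscale (vect.truncate V) = vscale V"
  by (simp_all add: vect.defs)

text \<open>Unlike the equation \<open>A = with_mult (vect.truncate A) f\<close>, which it expresses, this formula can be used for
  rewriting: the equation has its left-hand side inside its right-hand side.\<close>

definition has_mult :: "('k, 'u) alg \<Rightarrow> ('u \<Rightarrow> 'u \<Rightarrow> 'u) \<Rightarrow> bool" where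
  "has_mult A f \<longleftrightarrow>
     (\<forall>x y. amult A x y = (if x \<in> carrier A \<and> y \<in> carrier A then f x y else undefined))"

lemma has_mult_iff_with_mult: "has_mult A f \<longleftrightarrow> A = with_mult (vect.truncate A) f"
  by (cases A) (auto simp: has_mult_def with_mult_def vect.defs alg.defs fun_eq_iff)

abbreviation has_zero_mult :: "('k, 'u) alg \<Rightarrow> bool" where
  "has_zero_mult A \<equiv> has_mult A (\<lambda>_ _. vzero A)"

lemma vspace_with_mult [simp]: "vspace (with_mult V f) = vspace V" by (simp add: vspace_def)
lemma vspace_truncate [simp]: "vspace (vect.truncate V) = vspace V" by (simp add: vspace_def)

lemma linear_maps_with_mult [simp]:
  "linear_maps (with_mult V f) W = linear_maps V W" "linear_maps W (with_mult V f) = linear_maps W V"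
  "linear_maps (vect.truncate U) W = linear_maps U W" "linear_maps W (vect.truncate U) = linear_maps W U"
  by (simp_all add: linear_maps_def)

lemma bilinear_op_with_mult [simp]:
  "bilinear_op B (with_mult V f) (with_mult V f) l = bilinear_op B V V l"
  "bilinear_op (with_mult V f) B (with_mult V f) l = bilinear_op V B V l"
  "bilinear_op (with_mult V f) (with_mult V f) (with_mult V f) l = bilinear_op V V V l"
  "bilinear_op B (vect.truncate U) (vect.truncate U) l = bilinear_op B U U l"
  "bilinear_op (vect.truncate U) B (vect.truncate U) l = bilinear_op U B U l"
  by (simp_all add: bilinear_op_def)

lemma biaction_with_mult [simp]:
  "biaction B (with_mult V f) l r = biaction B V l r" "biaction B (vect.truncate U) l r = biaction B U l r"
  by (simp_all add: biaction_def)

lemma precrossed_with_mult [simp]: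
  "precrossed B (with_mult V f) l r d = precrossed B V l r d"
  "precrossed B (vect.truncate U) l r d = precrossed B U l r d"
  by (simp_all add: precrossed_def)

lemma exact_seq_with_mult [simp]:
  "exact_seq (with_mult M f) (with_mult A g) B C j d p = exact_seq M A B C j d p"
  "exact_seq (vect.truncate U) (vect.truncate W) B C j d p = exact_seq U W B C j d p"
  by (simp_all add: exact_seq_def kernel_of_def)

text \<open>Associativity of the product \<open>d a * a'\<close> and its compatibility with the action follow from the bimodule
  laws and equivariance of \<open>d\<close>, and the Peiffer identity says that it is also \<open>a * d a'\<close>. Hence the action, the linear structure of \<open>A\<close> and \<open>d\<close>
  determine the crossed module, and constructions need not deal with the product at all.\<close>

lemma is_crossed_module_iff:
  "is_crossed_module T d \<longleftrightarrow> precrossed (acting T) (acted T) (lact T) (ract T) d \<and>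
     has_mult (acted T) (\<lambda>a a'. lact T (d a) a')"
  (is "?L \<longleftrightarrow> ?R")
proof
  assume L: ?L
  then have act: "is_action T" by (simp add: is_crossed_module_def Let_def)
  have "biaction (acting T) (acted T) (lact T) (ract T)"
    using act unfolding biaction_def is_action_def assoc_algebra_def Let_def by blast
  moreover have "bilinear_op (acted T) (acted T) (acted T) (amult (acted T))"
    using act by (simp add: is_action_def assoc_algebra_def Let_def)
  note bilinear_opD(6)[OF this]
  moreover have "d \<in> linear_maps (acted T) (acting T)"
    using L by (simp add: is_crossed_module_def Let_def algebra_maps_def)
  ultimately show ?R
    using L unfolding has_mult_def precrossed_def by (simp add: is_crossed_module_def Let_def)
next
  assume R: ?R
  let ?A = "acted T" and ?B = "acting T" and ?l = "lact T" and ?r = "ract T"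
  note X = precrossedD[OF conjunct1[OF R]]
  note Y = biactionD[OF X(1)]
  note B = assoc_algebraD[OF Y(1)]
  have m: "amult ?A a a' = ?l (d a) a'" if "a \<in> carrier ?A" "a' \<in> carrier ?A" for a a'
    using R that unfolding has_mult_def by simp
  have mu: "amult ?A a a' = undefined" if "a \<notin> carrier ?A \<or> a' \<notin> carrier ?A" for a a'
    using R that unfolding has_mult_def by auto
  have bil: "bilinear_op ?A ?A ?A (amult ?A)"
    by (rule bilinear_opI)
      (use m mu X(2,6) Y B bilinear_opD[OF Y(3)] linear_mapsD[OF X(2)] in
        \<open>simp_all add: vspace_simps\<close>)
  have alg: "assoc_algebra ?A"
    unfolding assoc_algebra_def using bil m X Y B by simp
  have act: "is_action T"
    unfolding is_action_def Let_def using alg m X(3,4,6) Y B by simp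
  show ?L
    unfolding is_crossed_module_def Let_def algebra_maps_def using act X Y m by simp
qed

text \<open>With zero product, every axiom that involves the product of the module holds because both sides vanish.\<close>

lemma is_module_iff:
  "is_module T \<longleftrightarrow> biaction (acting T) (acted T) (lact T) (ract T) \<and>
     has_zero_mult (acted T)"
  (is "?L \<longleftrightarrow> ?R")
proof
  assume L: ?L
  then have act: "is_action T" by (simp add: is_module_def)
  have "biaction (acting T) (acted T) (lact T) (ract T)"
    using act unfolding biaction_def is_action_def assoc_algebra_def Let_def by blast
  moreover have "bilinear_op (acted T) (acted T) (acted T) (amult (acted T))"
    using act by (simp add: is_action_def assoc_algebra_def Let_def)
  note bilinear_opD(6)[OF this]
  ultimately show ?R
    using L unfolding has_mult_def by (simp add: is_module_def)
next
  assume R: ?R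
  let ?A = "acted T" and ?B = "acting T" and ?l = "lact T" and ?r = "ract T"
  note Y = biactionD[OF conjunct1[OF R]]
  have m: "amult ?A a a' = vzero ?A" if "a \<in> carrier ?A" "a' \<in> carrier ?A" for a a'
    using R that unfolding has_mult_def by simp
  have mu: "amult ?A a a' = undefined" if "a \<notin> carrier ?A \<or> a' \<notin> carrier ?A" for a a'
    using R that unfolding has_mult_def by auto
  have bil: "bilinear_op ?A ?A ?A (amult ?A)"
    by (rule bilinear_opI) (use m mu Y(2) in \<open>simp_all add: vspace_simps\<close>)
  have alg: "assoc_algebra ?A"
    unfolding assoc_algebra_def using bil m Y(2) by (simp add: vspace_simps)
  show ?L
    unfolding is_module_def is_action_def Let_def
    using alg m Y bilinear_op_zero[OF Y(3) Y(5,2,2)] bilinear_op_zero[OF Y(4) Y(2,5,2)] by simp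
qed

section \<open>The categories of algebras and modules\<close>

lemma algebra_mapsD:
  assumes "f \<in> algebra_maps A B"
  shows "f \<in> linear_maps A B" "x \<in> carrier A \<Longrightarrow> f x \<in> carrier B"
    "\<lbrakk>x \<in> carrier A; y \<in> carrier A\<rbrakk> \<Longrightarrow> f (vadd A x y) = vadd B (f x) (f y)"
    "x \<in> carrier A \<Longrightarrow> f (vscale A s x) = vscale B s (f x)"
    "\<lbrakk>x \<in> carrier A; y \<in> carrier A\<rbrakk> \<Longrightarrow> f (amult A x y) = amult B (f x) (f y)"
    "f \<in> extensional (carrier A)"
proof -
  show *: "f \<in> linear_maps A B" using assms by (simp add: algebra_maps_def)
qed (use assms linear_mapsD[of f A B] in \<open>auto simp: algebra_maps_def\<close>)

lemma linear_maps_compose: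
  "\<lbrakk>f \<in> linear_maps U V; g \<in> linear_maps V W; vspace U\<rbrakk> \<Longrightarrow> compose (carrier U) g f \<in> linear_maps U W"
  by (rule linear_mapsI) (auto simp: compose_def linear_mapsD vspace_simps)

lemma algebra_maps_compose:
  "\<lbrakk>f \<in> algebra_maps U V; g \<in> algebra_maps V W; assoc_algebra U\<rbrakk> \<Longrightarrow>
    compose (carrier U) g f \<in> algebra_maps U W"
  using linear_maps_compose[of f U V g W] linear_mapsD(1)[of f U V]
  by (simp add: algebra_maps_def linear_maps_compose assoc_algebraD linear_mapsD compose_def)

lemma id_map_linear: "vspace V \<Longrightarrow> id_map V \<in> linear_maps V V"
  by (rule linear_mapsI) (auto simp: id_map_def vspace_simps)

lemma id_map_algebra: "assoc_algebra A \<Longrightarrow> id_map A \<in> algebra_maps A A"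
  by (simp add: algebra_maps_def id_map_linear assoc_algebraD) (simp add: id_map_def assoc_algebraD)

lemma id_map_apply [simp]: "x \<in> carrier V \<Longrightarrow> id_map V x = x"
  by (simp add: id_map_def)

lemma compose_apply [simp]: "x \<in> V \<Longrightarrow> compose V g f x = g (f x)"
  by (simp add: compose_def)

lemma compose_eqD: "\<lbrakk>compose V g f = h; x \<in> V\<rbrakk> \<Longrightarrow> g (f x) = h x"
  by auto

lemma linear_maps_compose_id:
  "f \<in> linear_maps V W \<Longrightarrow> compose (carrier V) f (id_map V) = f"
  "f \<in> linear_maps V W \<Longrightarrow> compose (carrier V) (id_map W) f = f"
  using linear_mapsD(1,4)[of f V W] by (auto simp: fun_eq_iff compose_def id_map_def extensional_def)

lemma linear_maps_compose_assoc:
  "f \<in> linear_maps U V \<Longrightarrow>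
    compose (carrier U) h (compose (carrier U) g f) = compose (carrier U) (compose (carrier V) h g) f"
  using linear_mapsD(1)[of f U V] by (auto simp: fun_eq_iff compose_def)

lemma linear_maps_eqI:
  "\<lbrakk>f \<in> linear_maps V W; g \<in> linear_maps V W'; \<And>x. x \<in> carrier V \<Longrightarrow> f x = g x\<rbrakk> \<Longrightarrow> f = g"
  by (rule extensionalityI[of f "carrier V"]) (auto dest: linear_mapsD(4))

lemma category_AssAlg: "category AssAlg"
  unfolding AssAlg_def category_concrete
  by (simp add: id_map_algebra algebra_maps_compose linear_maps_compose_id[OF algebra_mapsD(1)]
      linear_maps_compose_assoc[OF algebra_mapsD(1)])

lemma zero_mult_simps [simp]:
  "carrier (zero_mult V) = carrier V" "vadd (zero_mult V) = vadd V"
  "vzero (zero_mult V) = vzero V" "vscale (zero_mult V) = vscale V"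
  "vect.truncate (zero_mult V) = V"
  "vspace (zero_mult V) = vspace V"
  "linear_maps (zero_mult V) W = linear_maps V W" "linear_maps W' (zero_mult V) = linear_maps W' V"
  "biaction B (zero_mult V) l r = biaction B V l r"
  by (simp_all add: zero_mult_def)

lemma zero_mult_amult:
  "has_zero_mult A \<Longrightarrow> x \<in> carrier A \<Longrightarrow> y \<in> carrier A \<Longrightarrow> amult A x y = vzero A"
  by (simp add: has_mult_def)

lemma assoc_algebra_zero_mult:
  "has_zero_mult A \<Longrightarrow> vspace A \<Longrightarrow> assoc_algebra A"
  unfolding assoc_algebra_def
  by (auto intro!: bilinear_opI simp: has_mult_def vspace_simps)

text \<open>Thus morphisms of modules over associative algebras have the same second component as morphisms of bimodules.\<close>

lemma algebra_maps_zero_mult: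
  assumes "has_zero_mult A" "has_zero_mult B" "vspace A" "vspace B"
  shows "algebra_maps A B = linear_maps A B"
  using zero_mult_amult[OF assms(1)] zero_mult_amult[OF assms(2)] assms(3,4)
  by (auto simp: algebra_maps_def linear_maps_zero linear_mapsD)

lemma is_moduleD:
  assumes "is_module T"
  shows "biaction (acting T) (acted T) (lact T) (ract T)" "has_zero_mult (acted T)"
    "assoc_algebra (acting T)" "assoc_algebra (acted T)" "vspace (acting T)" "vspace (acted T)"
proof -
  show *: "biaction (acting T) (acted T) (lact T) (ract T)" "has_zero_mult (acted T)"
    using assms unfolding is_module_iff by auto
  show "assoc_algebra (acting T)" "vspace (acting T)" "vspace (acted T)" "assoc_algebra (acted T)"
    using biactionD(1,5,2)[OF *(1)] assoc_algebra_zero_mult[OF *(2)] by auto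
qed

lemma module_maps_iff:
  "\<lbrakk>is_module S; is_module T\<rbrakk> \<Longrightarrow> (\<gamma>, \<mu>) \<in> module_maps S T \<longleftrightarrow>
     \<gamma> \<in> algebra_maps (acting S) (acting T) \<and> \<mu> \<in> linear_maps (acted S) (acted T) \<and>
     action_compatible S T \<gamma> \<mu>"
  by (simp add: module_maps_def algebra_maps_zero_mult is_moduleD(2,6))

lemma category_ModAssAlg: "category ModAssAlg"
  unfolding ModAssAlg_def category_concrete
  by (auto simp: module_maps_def action_compatible_def is_moduleD id_map_algebra algebra_maps_compose
      linear_maps_compose_id[OF algebra_mapsD(1)] linear_maps_compose_assoc[OF algebra_mapsD(1)]
      algebra_mapsD biactionD(9,10)[OF is_moduleD(1)])

lemma is_functor_base_Mod: "is_functor ModAssAlg AssAlg base_Mod"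
  unfolding ModAssAlg_def AssAlg_def base_Mod_def
  by (rule is_functor_concrete[OF category_ModAssAlg[unfolded ModAssAlg_def] category_AssAlg[unfolded AssAlg_def]])
     (auto simp: is_moduleD module_maps_def)

abbreviation algebra_compose where
  "algebra_compose \<equiv> (\<lambda>A g f. compose (carrier A) g f)"

abbreviation module_compose where
  "module_compose \<equiv> (\<lambda>T (\<gamma>', \<mu>') (\<gamma>, \<mu>). (compose (carrier (acting T)) \<gamma>' \<gamma>, compose (carrier (acted T)) \<mu>' \<mu>))"

text \<open>A map of modules that is the identity on the underlying space is cartesian: a comparison map must have
  the prescribed base map as first and the given linear map as second component, and this pair is
  equivariant since the action on the source is the restricted one.\<close>

lemma cartesian_hom_module:
  assumes S: "is_module S" and T: "is_module T" and eq: "acted S = acted T"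
    and f: "(\<gamma>, id_map (acted T)) \<in> module_maps S T"
  shows "cartesian_hom {T. is_module T} module_maps module_compose acting fst algebra_maps
     algebra_compose S T (\<gamma>, id_map (acted T))"
  unfolding cartesian_hom_def
proof (intro ballI impI)
  fix W h v assume W0: "W \<in> {T. is_module T}" and h0: "h \<in> module_maps W T"
    and v: "v \<in> algebra_maps (acting W) (acting S)"
    and e: "compose (carrier (acting W)) (fst (\<gamma>, id_map (acted T))) v = fst h"
  have W: "is_module W" using W0 by simp
  obtain \<gamma>' \<mu>' where h: "h = (\<gamma>', \<mu>')" by (cases h)
  have h1: "\<mu>' \<in> linear_maps (acted W) (acted T)" "action_compatible W T \<gamma>' \<mu>'"
    using h0 W T unfolding h by (auto simp: module_maps_iff)
  have f1: "action_compatible S T \<gamma> (id_map (acted T))" using f S T by (simp add: module_maps_iff)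
  have "action_compatible W S v \<mu>'"
    unfolding action_compatible_def
  proof (intro ballI)
    fix c m assume c: "c \<in> carrier (acting W)" and m: "m \<in> carrier (acted W)"
    have vc: "v c \<in> carrier (acting S)" and mm: "\<mu>' m \<in> carrier (acted S)"
      using algebra_mapsD(2)[OF v c] linear_mapsD(1)[OF h1(1) m] eq by simp_all
    have g: "\<gamma> (v c) = \<gamma>' c" using compose_eqD[OF _ c, of \<gamma> v \<gamma>'] e h by simp
    have cl: "lact S (v c) (\<mu>' m) \<in> carrier (acted T)" "ract S (\<mu>' m) (v c) \<in> carrier (acted T)"
      using biactionD(9,10)[OF is_moduleD(1)[OF S] mm vc] eq by simp_all
    have "lact S (v c) (\<mu>' m) = lact T (\<gamma>' c) (\<mu>' m)" "ract S (\<mu>' m) (v c) = ract T (\<mu>' m) (\<gamma>' c)"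
      using f1[unfolded action_compatible_def, rule_format, OF vc mm] cl mm eq g by simp_all
    then show "\<mu>' (lact W c m) = lact S (v c) (\<mu>' m) \<and> \<mu>' (ract W m c) = ract S (\<mu>' m) (v c)"
      using h1(2)[unfolded action_compatible_def, rule_format, OF c m] by simp
  qed
  then have "(v, \<mu>') \<in> module_maps W S" using h1 v W S eq by (simp add: module_maps_iff)
  moreover have id: "compose (carrier (acted W)) (id_map (acted T)) \<mu> = \<mu>" if "(v, \<mu>) \<in> module_maps W S" for \<mu>
    using that W S eq linear_maps_compose_id(2)[of \<mu> "acted W" "acted T"] by (simp add: module_maps_iff)
  moreover have c: "compose (carrier (acting W)) \<gamma> v = \<gamma>'" using e h by simp
  ultimately show "\<exists>!g. g \<in> module_maps W S \<and> fst g = v \<and> module_compose W (\<gamma>, id_map (acted T)) g = h"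
  proof (intro ex1I[of _ "(v, \<mu>')"])
    fix g assume g: "g \<in> module_maps W S \<and> fst g = v \<and> module_compose W (\<gamma>, id_map (acted T)) g = h"
    obtain \<mu> where gm: "g = (v, \<mu>)" using g by (cases g) simp
    show "g = (v, \<mu>')" using g id[of \<mu>] unfolding gm h by simp
  qed (simp add: h)
qed

definition pullback_module :: "('k, 'u) alg \<Rightarrow> ('u \<Rightarrow> 'u) \<Rightarrow> ('k, 'u) action \<Rightarrow> ('k, 'u) action" where
  "pullback_module D u T = \<lparr>acting = D, acted = acted T,
     lact = (\<lambda>c m. if c \<in> carrier D \<and> m \<in> carrier (acted T) then lact T (u c) m else undefined),
     ract = (\<lambda>m c. if m \<in> carrier (acted T) \<and> c \<in> carrier D then ract T m (u c) else undefined)\<rparr>"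

lemma biaction_restrict:
  assumes T: "biaction B A l r" and D: "assoc_algebra D" and u: "u \<in> algebra_maps D B"
  shows "biaction D A (\<lambda>c m. if c \<in> carrier D \<and> m \<in> carrier A then l (u c) m else undefined)
     (\<lambda>m c. if m \<in> carrier A \<and> c \<in> carrier D then r m (u c) else undefined)"
proof -
  note Y = biactionD[OF T]
  note b = bilinear_opD[OF Y(3)] bilinear_opD[OF Y(4)]
  show ?thesis
    unfolding biaction_def
    by (intro conjI D Y(2) bilinear_opI ballI)
       (auto simp: Y b algebra_mapsD[OF u] assoc_algebraD[OF D] vspaceD(1,6)[OF Y(2)] vspaceD(1,6)[OF Y(5)]
         vspaceD(1,6)[OF assoc_algebraD(1)[OF D]])
qed

lemma is_module_pullback:
  assumes T: "is_module T" and D: "assoc_algebra D" and u: "u \<in> algebra_maps D (acting T)"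
  shows "is_module (pullback_module D u T)"
  using biaction_restrict[OF is_moduleD(1)[OF T] D u] is_moduleD(2)[OF T]
  unfolding is_module_iff by (simp add: pullback_module_def)

lemma pullback_module_map:
  assumes T: "is_module T" and D: "assoc_algebra D" and u: "u \<in> algebra_maps D (acting T)"
  shows "(u, id_map (acted T)) \<in> module_maps (pullback_module D u T) T"
  using T u is_module_pullback[OF assms] id_map_linear[OF is_moduleD(6)[OF T]]
    biactionD(9,10)[OF is_moduleD(1)[OF T]] algebra_mapsD(2)[OF u]
  by (simp add: module_maps_iff) (simp add: pullback_module_def action_compatible_def)

section \<open>Crossed sequences and the induced module\<close>

text \<open>The data common to crossed extensions and crossed biextensions. Both kinds of objects store them in
  different records, and the product on \<open>A\<close> and \<open>M\<close> is left out. The facts \<open>M\<close>, \<open>A\<close>, \<open>B\<close>, \<open>C\<close>, \<open>j\<close>, \<open>d\<close>, \<open>p\<close>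
  state what kind of structure the object of that name is.\<close>

locale crossed_sequence =
  fixes M :: "('k::field, 'u, 'y) vect_scheme" and A :: "('k, 'u, 'z) vect_scheme"
    and B C :: "('k, 'u) alg" and l r :: "'u \<Rightarrow> 'u \<Rightarrow> 'u" and j d p :: "'u \<Rightarrow> 'u"
  assumes M: "vspace M" and C: "assoc_algebra C" and precrossed: "precrossed B A l r d"
    and j: "j \<in> linear_maps M A" and p: "p \<in> algebra_maps B C" and exact: "exact_seq M A B C j d p"
begin

lemmas act = precrossedD(1)[OF precrossed]
lemmas d = precrossedD(2)[OF precrossed]
lemmas B = biactionD(1)[OF act]
lemmas A = biactionD(2)[OF act]
lemmas VB = biactionD(5)[OF act]
lemmas VC = assoc_algebraD(1)[OF C]
lemmas l = bilinear_opD[OF biactionD(3)[OF act]]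
lemmas r = bilinear_opD[OF biactionD(4)[OF act]]
lemmas l_zero = bilinear_op_zero[OF biactionD(3)[OF act] VB A A]
lemmas r_zero = bilinear_op_zero[OF biactionD(4)[OF act] A VB A]
lemmas actions = biactionD(6,7,8)[OF act]
lemmas j_simps = linear_mapsD(1-3)[OF j] linear_maps_zero[OF j M A]
lemmas d_simps = linear_mapsD(1-3)[OF d] linear_maps_zero[OF d A VB] precrossedD(3,4)[OF precrossed]
lemmas p_simps = algebra_mapsD(2-5)[OF p] linear_maps_zero[OF algebra_mapsD(1)[OF p] VB VC]
lemmas peiffer = precrossedD(5)[OF precrossed]
lemmas closed = vspaceD(1,4,6)[OF M] vspaceD(1,4,6)[OF A] vspaceD(1,4,6)[OF VB] vspaceD(1,4,6)[OF VC]
  assoc_algebraD(4)[OF B] assoc_algebraD(4)[OF C]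

lemma j_eq: "\<lbrakk>m \<in> carrier M; n \<in> carrier M\<rbrakk> \<Longrightarrow> j m = j n \<longleftrightarrow> m = n"
  using exact by (auto simp: exact_seq_def inj_on_def)

lemma d_j: "m \<in> carrier M \<Longrightarrow> d (j m) = vzero B"
  using exact by (auto simp: exact_seq_def kernel_of_def)

lemma ker_d: "\<lbrakk>a \<in> carrier A; d a = vzero B\<rbrakk> \<Longrightarrow> \<exists>m\<in>carrier M. a = j m"
  using exact unfolding exact_seq_def kernel_of_def by blast

lemma p_d: "a \<in> carrier A \<Longrightarrow> p (d a) = vzero C"
  using exact by (auto simp: exact_seq_def kernel_of_def)

lemma ker_p: "\<lbrakk>b \<in> carrier B; p b = vzero C\<rbrakk> \<Longrightarrow> \<exists>a\<in>carrier A. b = d a"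
  using exact unfolding exact_seq_def kernel_of_def by blast

lemma p_surj: "c \<in> carrier C \<Longrightarrow> \<exists>b\<in>carrier B. c = p b"
  using exact unfolding exact_seq_def by blast

lemma l_j: "\<lbrakk>b \<in> carrier B; m \<in> carrier M\<rbrakk> \<Longrightarrow> \<exists>n\<in>carrier M. l b (j m) = j n"
  by (rule ker_d) (simp_all add: l d_simps j_simps d_j bilinear_op_zero[OF assoc_algebraD(2)[OF B] VB VB VB])

lemma r_j: "\<lbrakk>b \<in> carrier B; m \<in> carrier M\<rbrakk> \<Longrightarrow> \<exists>n\<in>carrier M. r (j m) b = j n"
  by (rule ker_d) (simp_all add: r d_simps j_simps d_j bilinear_op_zero[OF assoc_algebraD(2)[OF B] VB VB VB])

text \<open>By the Peiffer identity, \<open>d a * j m = a * d (j m)\<close>, which is zero. This is why the action of \<open>B\<close> on \<open>M\<close>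
  descends to the cokernel \<open>C\<close> of \<open>d\<close>.\<close>

lemma d_act_j:
  "\<lbrakk>a \<in> carrier A; m \<in> carrier M\<rbrakk> \<Longrightarrow> l (d a) (j m) = vzero A"
  "\<lbrakk>a \<in> carrier A; m \<in> carrier M\<rbrakk> \<Longrightarrow> r (j m) (d a) = vzero A"
  using peiffer[of a "j m"] peiffer[of "j m" a] by (simp_all add: j_simps d_j r_zero l_zero)

lemma p_eq: 
  assumes "b \<in> carrier B" "b' \<in> carrier B" "p b = p b'"
  obtains a where "a \<in> carrier A" "b = vadd B b' (d a)"
proof -
  let ?x = "vadd B (vscale B (-1) b') b"
  have x: "?x \<in> carrier B" using assms closed by simp
  have "p ?x = vzero C"
    using assms vspaceD(15)[OF VC, of "p b'"] vspaceD(3)[OF VC, of "vscale C (-1) (p b')" "p b'"] closed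
    by (simp add: p_simps)
  then obtain a where a: "a \<in> carrier A" "?x = d a" using ker_p[OF x] by blast
  then have "b = vadd B b' (d a)" using vspaceD(16)[OF VB assms(2,1)] by simp
  with a that show thesis by blast
qed

lemma act_j_cong:
  assumes "b \<in> carrier B" "b' \<in> carrier B" "p b = p b'" "m \<in> carrier M"
  shows "l b (j m) = l b' (j m)" "r (j m) b = r (j m) b'"
proof -
  obtain a where "a \<in> carrier A" "b = vadd B b' (d a)" by (rule p_eq[OF assms(1-3)])
  then show "l b (j m) = l b' (j m)" "r (j m) b = r (j m) b'"
    using assms by (simp_all add: l r d_act_j j_simps d_simps closed vspaceD(12)[OF A])
qed

text \<open>The equations \<open>j (p b * m) = b * j m\<close> and \<open>j (m * p b) = j m * b\<close>, together with extensionality.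
  They determine the pair of operations.\<close>

definition induced :: "('u \<Rightarrow> 'u \<Rightarrow> 'u) \<Rightarrow> ('u \<Rightarrow> 'u \<Rightarrow> 'u) \<Rightarrow> bool" where
  "induced lC rC \<longleftrightarrow>
     (\<forall>b\<in>carrier B. \<forall>m\<in>carrier M. lC (p b) m \<in> carrier M \<and> j (lC (p b) m) = l b (j m) \<and>
        rC m (p b) \<in> carrier M \<and> j (rC m (p b)) = r (j m) b) \<and>
     (\<forall>c m. c \<notin> carrier C \<or> m \<notin> carrier M \<longrightarrow> lC c m = undefined \<and> rC m c = undefined)"

lemma induced_unique: "\<lbrakk>induced lC rC; induced lC' rC'\<rbrakk> \<Longrightarrow> lC = lC' \<and> rC = rC'"
proof (intro conjI ext)
  assume i: "induced lC rC" "induced lC' rC'"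
  show "lC c m = lC' c m" for c m
    using i p_surj[of c] j_eq[of "lC c m" "lC' c m"] unfolding induced_def by metis
  show "rC m c = rC' m c" for c m
    using i p_surj[of c] j_eq[of "rC m c" "rC' m c"] unfolding induced_def by metis
qed

text \<open>Each law is checked after applying the injection \<open>j\<close> and writing elements of \<open>C\<close> as images under the
  surjection \<open>p\<close>. It then becomes the corresponding law for the action of \<open>B\<close> on \<open>A\<close>.\<close>

lemma induced_biaction:
  assumes i: "induced lC rC"
  shows "biaction C M lC rC"
proof -
  have cl: "lC (p b) m \<in> carrier M" "rC m (p b) \<in> carrier M" "j (lC (p b) m) = l b (j m)"
    "j (rC m (p b)) = r (j m) b" if "b \<in> carrier B" "m \<in> carrier M" for b m
    using i that by (auto simp: induced_def)
  have und: "lC c m = undefined" "rC m c = undefined" if "c \<notin> carrier C \<or> m \<notin> carrier M" for c m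
    using i that by (auto simp: induced_def)
  have cl2: "lC c m \<in> carrier M" "rC m c \<in> carrier M" if "c \<in> carrier C" "m \<in> carrier M" for c m
    using that p_surj[of c] cl by auto
  have padd: "vadd C (p b) (p b') = p (vadd B b b')" "vscale C s (p b) = p (vscale B s b)"
     "amult C (p b) (p b') = p (amult B b b')" if "b \<in> carrier B" "b' \<in> carrier B" for b b' s
    using that by (simp_all add: p_simps)
  note S = cl padd l r j_simps closed actions
  have sl: "bilinear_op C M M lC"
  proof (rule bilinear_opI[OF _ _ _ _ _ _ VC M])
    fix x y y' k assume x: "x \<in> carrier C" and y: "y \<in> carrier M" "y' \<in> carrier M"
    obtain b where b: "b \<in> carrier B" "x = p b" using p_surj[OF x] by blast
    show "lC x (vadd M y y') = vadd M (lC x y) (lC x y')"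
      using b y by (subst j_eq[symmetric]) (simp_all add: S)
  next
    fix x y k assume x: "x \<in> carrier C" and y: "y \<in> carrier M"
    obtain b where b: "b \<in> carrier B" "x = p b" using p_surj[OF x] by blast
    show "lC x (vscale M k y) = vscale M k (lC x y)"
      using b y by (subst j_eq[symmetric]) (simp_all add: S)
    show "lC (vscale C k x) y = vscale M k (lC x y)"
      using b y by (subst j_eq[symmetric]) (simp_all add: S)
  next
    fix x x' y assume x: "x \<in> carrier C" "x' \<in> carrier C" and y: "y \<in> carrier M"
    obtain b b' where b: "b \<in> carrier B" "x = p b" "b' \<in> carrier B" "x' = p b'" using p_surj x by metis
    show "lC (vadd C x x') y = vadd M (lC x y) (lC x' y)"
      using b y by (subst j_eq[symmetric]) (simp_all add: S)
  qed (auto simp: cl2 und)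
  have sr: "bilinear_op M C M rC"
  proof (rule bilinear_opI[OF _ _ _ _ _ _ M VC])
    fix x y y' k assume x: "x \<in> carrier C" and y: "y \<in> carrier M" "y' \<in> carrier M"
    obtain b where b: "b \<in> carrier B" "x = p b" using p_surj[OF x] by blast
    show "rC (vadd M y y') x = vadd M (rC y x) (rC y' x)"
      using b y by (subst j_eq[symmetric]) (simp_all add: S)
  next
    fix x y k assume x: "x \<in> carrier C" and y: "y \<in> carrier M"
    obtain b where b: "b \<in> carrier B" "x = p b" using p_surj[OF x] by blast
    show "rC (vscale M k y) x = vscale M k (rC y x)"
      using b y by (subst j_eq[symmetric]) (simp_all add: S)
    show "rC y (vscale C k x) = vscale M k (rC y x)"
      using b y by (subst j_eq[symmetric]) (simp_all add: S)
  next
    fix x x' y assume x: "x \<in> carrier C" "x' \<in> carrier C" and y: "y \<in> carrier M"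
    obtain b b' where b: "b \<in> carrier B" "x = p b" "b' \<in> carrier B" "x' = p b'" using p_surj x by metis
    show "rC y (vadd C x x') = vadd M (rC y x) (rC y x')"
      using b y by (subst j_eq[symmetric]) (simp_all add: S)
  qed (auto simp: cl2 und)
  show ?thesis
    unfolding biaction_def
  proof (intro conjI ballI C M sl sr)
    fix m x x' assume m: "m \<in> carrier M" and x: "x \<in> carrier C" "x' \<in> carrier C"
    obtain b b' where b: "b \<in> carrier B" "x = p b" "b' \<in> carrier B" "x' = p b'" using p_surj x by metis
    show "rC m (amult C x x') = rC (rC m x) x'" using b m by (subst j_eq[symmetric]) (simp_all add: S)
    show "lC (amult C x x') m = lC x (lC x' m)" using b m by (subst j_eq[symmetric]) (simp_all add: S)
    show "rC (lC x m) x' = lC x (rC m x')" using b m by (subst j_eq[symmetric]) (simp_all add: S)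
  qed
qed

end

section \<open>The category of crossed extensions\<close>

abbreviation xe_l where "xe_l E \<equiv> lact (xe_act E)"
abbreviation xe_r where "xe_r E \<equiv> ract (xe_act E)"

abbreviation xext_sequence where
  "xext_sequence E \<equiv> crossed_sequence (xe_M E) (xe_A E) (xe_B E) (xe_C E) (xe_l E) (xe_r E) (xe_j E) (xe_d E) (xe_p E)"

text \<open>A crossed extension is a crossed sequence in which both products have the only value that they can have:
  \<open>a * a' = d a * a'\<close> on \<open>A\<close>, and consequently \<open>j (m * m') = d (j m) * j m' = 0\<close> on \<open>M\<close>.\<close>

lemma is_xext_iff:
  "is_xext E \<longleftrightarrow> xext_sequence E \<and>
     has_mult (xe_A E) (\<lambda>a a'. xe_l E (xe_d E a) a') \<and>
     has_zero_mult (xe_M E)"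
  (is "?L \<longleftrightarrow> ?R")
proof
  assume L: ?L
  have seq: "xext_sequence E"
    using L unfolding is_xext_def crossed_sequence_def is_crossed_module_iff
    by (blast intro: assoc_algebraD(1) algebra_mapsD(1))
  interpret crossed_sequence "xe_M E" "xe_A E" "xe_B E" "xe_C E" "xe_l E" "xe_r E" "xe_j E" "xe_d E" "xe_p E"
    by (rule seq)
  have AE: "has_mult (xe_A E) (\<lambda>a a'. xe_l E (xe_d E a) a')"
    using L unfolding is_xext_def is_crossed_module_iff by simp
  have jm: "xe_j E \<in> algebra_maps (xe_M E) (xe_A E)" and Ma: "assoc_algebra (xe_M E)"
    using L unfolding is_xext_def by simp_all
  have "amult (xe_M E) x y = vzero (xe_M E)" if "x \<in> carrier (xe_M E)" "y \<in> carrier (xe_M E)" for x y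
  proof -
    have "xe_j E (amult (xe_M E) x y) = xe_j E (vzero (xe_M E))"
      using AE[unfolded has_mult_def, rule_format, of "xe_j E x" "xe_j E y"] that algebra_mapsD(5)[OF jm that]
      by (simp add: j_simps d_j l_zero)
    then show ?thesis using that by (simp add: j_eq assoc_algebraD(4)[OF Ma] closed)
  qed
  then have "has_zero_mult (xe_M E)"
    unfolding has_mult_def using bilinear_opD(6)[OF assoc_algebraD(2)[OF Ma]] by simp
  then show ?R using seq AE by simp
next
  assume R: ?R
  then interpret crossed_sequence "xe_M E" "xe_A E" "xe_B E" "xe_C E" "xe_l E" "xe_r E" "xe_j E" "xe_d E" "xe_p E"
    by blast
  have "xe_j E \<in> algebra_maps (xe_M E) (xe_A E)"
  proof -
    have "xe_j E (amult (xe_M E) x y) = amult (xe_A E) (xe_j E x) (xe_j E y)"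
      if xy: "x \<in> carrier (xe_M E)" "y \<in> carrier (xe_M E)" for x y
      using R[THEN conjunct2, THEN conjunct1, unfolded has_mult_def, rule_format, of "xe_j E x" "xe_j E y"]
        R[THEN conjunct2, THEN conjunct2, unfolded has_mult_def, rule_format, of x y] xy
      by (simp add: j_simps d_j l_zero)
    then show ?thesis using j by (simp add: algebra_maps_def)
  qed
  moreover have "assoc_algebra (xe_M E)" using R M by (simp add: assoc_algebra_zero_mult)
  ultimately show ?L
    unfolding is_xext_def is_crossed_module_iff using R C precrossed p exact by simp
qed

lemma is_xextD:
  assumes "is_xext E"
  shows "xext_sequence E" "has_mult (xe_A E) (\<lambda>a a'. xe_l E (xe_d E a) a')"
    "has_zero_mult (xe_M E)"
    "assoc_algebra (xe_A E)" "assoc_algebra (xe_M E)"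
    "\<lbrakk>a \<in> carrier (xe_A E); a' \<in> carrier (xe_A E)\<rbrakk> \<Longrightarrow> amult (xe_A E) a a' = xe_l E (xe_d E a) a'"
proof -
  show "xext_sequence E" and A: "has_mult (xe_A E) (\<lambda>a a'. xe_l E (xe_d E a) a')"
    "has_zero_mult (xe_M E)" using assms unfolding is_xext_iff by auto
  show "assoc_algebra (xe_A E)" "assoc_algebra (xe_M E)"
    using assms by (auto simp: is_xext_def is_crossed_module_def is_action_def Let_def)
  show "\<lbrakk>a \<in> carrier (xe_A E); a' \<in> carrier (xe_A E)\<rbrakk> \<Longrightarrow> amult (xe_A E) a a' = xe_l E (xe_d E a) a'"
    using A unfolding has_mult_def by simp
qed

text \<open>Multiplicativity of \<open>\<alpha>\<close> and \<open>\<mu>\<close> is automatic: \<open>\<alpha> (d a * a') = \<beta> (d a) * \<alpha> a' = d (\<alpha> a) * \<alpha> a'\<close>.\<close>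

lemma xext_maps_iff:
  assumes E: "is_xext E" and E': "is_xext E'"
  shows "(\<gamma>, \<beta>, \<alpha>, \<mu>) \<in> xext_maps E E' \<longleftrightarrow>
     \<gamma> \<in> algebra_maps (xe_C E) (xe_C E') \<and> \<beta> \<in> algebra_maps (xe_B E) (xe_B E') \<and>
     \<alpha> \<in> linear_maps (xe_A E) (xe_A E') \<and> \<mu> \<in> linear_maps (xe_M E) (xe_M E') \<and>
     (\<forall>m\<in>carrier (xe_M E). \<alpha> (xe_j E m) = xe_j E' (\<mu> m)) \<and>
     (\<forall>a\<in>carrier (xe_A E). \<beta> (xe_d E a) = xe_d E' (\<alpha> a)) \<and>
     (\<forall>b\<in>carrier (xe_B E). \<gamma> (xe_p E b) = xe_p E' (\<beta> b)) \<and>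
     action_compatible (xe_act E) (xe_act E') \<beta> \<alpha>"
proof -
  interpret E: crossed_sequence "xe_M E" "xe_A E" "xe_B E" "xe_C E" "xe_l E" "xe_r E" "xe_j E" "xe_d E" "xe_p E"
    by (rule is_xextD(1)[OF E])
  interpret E': crossed_sequence "xe_M E'" "xe_A E'" "xe_B E'" "xe_C E'" "xe_l E'" "xe_r E'" "xe_j E'" "xe_d E'" "xe_p E'"
    by (rule is_xextD(1)[OF E'])
  have "\<alpha> \<in> algebra_maps (xe_A E) (xe_A E')"
    if lin: "\<alpha> \<in> linear_maps (xe_A E) (xe_A E')" and b: "\<forall>a\<in>carrier (xe_A E). \<beta> (xe_d E a) = xe_d E' (\<alpha> a)"
      and c: "action_compatible (xe_act E) (xe_act E') \<beta> \<alpha>"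
  proof -
    have "\<alpha> (amult (xe_A E) x y) = amult (xe_A E') (\<alpha> x) (\<alpha> y)"
      if "x \<in> carrier (xe_A E)" "y \<in> carrier (xe_A E)" for x y
      using that is_xextD(6)[OF E that] is_xextD(6)[OF E' linear_mapsD(1)[OF lin that(1)] linear_mapsD(1)[OF lin that(2)]]
        c[unfolded action_compatible_def, rule_format, OF E.d_simps(1)[OF that(1)] that(2)] b by simp
    then show ?thesis using lin by (simp add: algebra_maps_def)
  qed
  then show ?thesis
    unfolding xext_maps_def algebra_maps_zero_mult[OF is_xextD(3)[OF E] is_xextD(3)[OF E'] E.M E'.M]
    using algebra_mapsD(1)[of \<alpha> "xe_A E" "xe_A E'"] by blast
qed

lemma category_XExt: "category XExt"
proof -
  have a: "assoc_algebra (xe_A E)" "assoc_algebra (xe_B E)" "assoc_algebra (xe_C E)" "assoc_algebra (xe_M E)"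
    if "is_xext E" for E :: "('k::field, 'u) xext"
    by (fact is_xextD(4,5)[OF that] crossed_sequence.B[OF is_xextD(1)[OF that]]
      crossed_sequence.C[OF is_xextD(1)[OF that]])+
  have s: "xe_d E a \<in> carrier (xe_B E)" if "is_xext E" "a \<in> carrier (xe_A E)" for E :: "('k::field, 'u) xext" and a
    by (rule crossed_sequence.d_simps(1)[OF is_xextD(1)[OF that(1)] that(2)])
  have t: "xe_p E a \<in> carrier (xe_C E)" if "is_xext E" "a \<in> carrier (xe_B E)" for E :: "('k::field, 'u) xext" and a
    by (rule crossed_sequence.p_simps(1)[OF is_xextD(1)[OF that(1)] that(2)])
  have u: "xe_j E a \<in> carrier (xe_A E)" if "is_xext E" "a \<in> carrier (xe_M E)" for E :: "('k::field, 'u) xext" and a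
    by (rule crossed_sequence.j_simps(1)[OF is_xextD(1)[OF that(1)] that(2)])
  have v: "xe_l E b a \<in> carrier (xe_A E)" "xe_r E a b \<in> carrier (xe_A E)"
    if "is_xext E" "a \<in> carrier (xe_A E)" "b \<in> carrier (xe_B E)" for E :: "('k::field, 'u) xext" and a b
    by (rule crossed_sequence.l(1)[OF is_xextD(1)[OF that(1)] that(3,2)] crossed_sequence.r(1)[OF is_xextD(1)[OF that(1)] that(2,3)])+
  show ?thesis
    unfolding XExt_def category_concrete
  proof (intro conjI ballI, goal_cases)
    case (1 E)
    then show ?case by (simp add: xext_maps_def action_compatible_def a s t u v id_map_algebra)
  next
    case (2 E E' E'' f g)
    then have E: "is_xext E" "is_xext E'" "is_xext E''" by simp_all
    obtain \<gamma> \<beta> \<alpha> \<mu> \<gamma>' \<beta>' \<alpha>' \<mu>' where fg: "f = (\<gamma>, \<beta>, \<alpha>, \<mu>)" "g = (\<gamma>', \<beta>', \<alpha>', \<mu>')" by (cases f, cases g)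
    have f: "\<gamma> \<in> algebra_maps (xe_C E) (xe_C E')" "\<beta> \<in> algebra_maps (xe_B E) (xe_B E')"
      "\<alpha> \<in> algebra_maps (xe_A E) (xe_A E')" "\<mu> \<in> algebra_maps (xe_M E) (xe_M E')"
      using 2(4) unfolding fg xext_maps_def by simp_all
    have g: "\<gamma>' \<in> algebra_maps (xe_C E') (xe_C E'')" "\<beta>' \<in> algebra_maps (xe_B E') (xe_B E'')"
      "\<alpha>' \<in> algebra_maps (xe_A E') (xe_A E'')" "\<mu>' \<in> algebra_maps (xe_M E') (xe_M E'')"
      using 2(5) unfolding fg xext_maps_def by simp_all
    show ?case
      using 2(4,5) algebra_mapsD(2)[OF f(1)] algebra_mapsD(2)[OF f(2)] algebra_mapsD(2)[OF f(3)] algebra_mapsD(2)[OF f(4)]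
      unfolding fg xext_maps_def
      by (simp add: action_compatible_def a[OF E(1)] s[OF E(1)] t[OF E(1)] u[OF E(1)] v[OF E(1)]
          algebra_maps_compose[OF f(1) g(1)] algebra_maps_compose[OF f(2) g(2)]
          algebra_maps_compose[OF f(3) g(3)] algebra_maps_compose[OF f(4) g(4)])
  next
    case (3 E E' f)
    then show ?case
      by (auto simp: xext_maps_def dest!: algebra_mapsD(1) simp: linear_maps_compose_id(1))
  next
    case (4 E E' f)
    then show ?case
      by (auto simp: xext_maps_def dest!: algebra_mapsD(1) simp: linear_maps_compose_id(2))
  next
    case (5 E E' E'' E3 f g h)
    obtain \<gamma> \<beta> \<alpha> \<mu> where f: "f = (\<gamma>, \<beta>, \<alpha>, \<mu>)" by (cases f)
    have F: "\<gamma> \<in> linear_maps (xe_C E) (xe_C E')" "\<beta> \<in> linear_maps (xe_B E) (xe_B E')"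
      "\<alpha> \<in> linear_maps (xe_A E) (xe_A E')" "\<mu> \<in> linear_maps (xe_M E) (xe_M E')"
      using 5(5) unfolding f xext_maps_def by (simp_all add: algebra_mapsD(1))
    show ?case
      unfolding f
      by (cases g, cases h) (simp add: linear_maps_compose_assoc[OF F(1)] linear_maps_compose_assoc[OF F(2)]
          linear_maps_compose_assoc[OF F(3)] linear_maps_compose_assoc[OF F(4)])
  qed
qed

lemma induced_module_simps [simp]:
  "acting (induced_module E) = xe_C E" "acted (induced_module E) = xe_M E"
  by (simp_all add: induced_module_def)

lemma induced_module_induced:
  assumes "xext_sequence E"
  shows "crossed_sequence.induced (xe_M E) (xe_B E) (xe_C E) (xe_l E) (xe_r E) (xe_j E) (xe_p E)
     (lact (induced_module E)) (ract (induced_module E))"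
proof -
  interpret crossed_sequence "xe_M E" "xe_A E" "xe_B E" "xe_C E" "xe_l E" "xe_r E" "xe_j E" "xe_d E" "xe_p E"
    by (rule assms)
  have L: "lact (induced_module E) (xe_p E b) m = n"
    if "b \<in> carrier (xe_B E)" "m \<in> carrier (xe_M E)" "n \<in> carrier (xe_M E)" "xe_l E b (xe_j E m) = xe_j E n" for b m n
    unfolding induced_module_def
  proof (simp add: that(1,2) p_simps(1), rule the_equality)
    show "n \<in> carrier (xe_M E) \<and>
        (\<forall>b'\<in>carrier (xe_B E). xe_p E b' = xe_p E b \<longrightarrow> xe_j E n = xe_l E b' (xe_j E m))"
      using that(3) that(4)[symmetric] act_j_cong(1)[OF that(1) _ _ that(2)] by metis
    show "n' = n" if "n' \<in> carrier (xe_M E) \<and>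
        (\<forall>b'\<in>carrier (xe_B E). xe_p E b' = xe_p E b \<longrightarrow> xe_j E n' = xe_l E b' (xe_j E m))" for n'
      using that \<open>b \<in> carrier (xe_B E)\<close> \<open>xe_l E b (xe_j E m) = xe_j E n\<close> \<open>n \<in> carrier (xe_M E)\<close> j_eq by metis
  qed
  have R: "ract (induced_module E) m (xe_p E b) = n"
    if "b \<in> carrier (xe_B E)" "m \<in> carrier (xe_M E)" "n \<in> carrier (xe_M E)" "xe_r E (xe_j E m) b = xe_j E n" for b m n
    unfolding induced_module_def
  proof (simp add: that(1,2) p_simps(1), rule the_equality)
    show "n \<in> carrier (xe_M E) \<and>
        (\<forall>b'\<in>carrier (xe_B E). xe_p E b' = xe_p E b \<longrightarrow> xe_j E n = xe_r E (xe_j E m) b')"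
      using that(3) that(4)[symmetric] act_j_cong(2)[OF that(1) _ _ that(2)] by metis
    show "n' = n" if "n' \<in> carrier (xe_M E) \<and>
        (\<forall>b'\<in>carrier (xe_B E). xe_p E b' = xe_p E b \<longrightarrow> xe_j E n' = xe_r E (xe_j E m) b')" for n'
      using that \<open>b \<in> carrier (xe_B E)\<close> \<open>xe_r E (xe_j E m) b = xe_j E n\<close> \<open>n \<in> carrier (xe_M E)\<close> j_eq by metis
  qed
  show ?thesis
    unfolding induced_def
  proof (intro conjI ballI allI impI)
    fix b m assume bm: "b \<in> carrier (xe_B E)" "m \<in> carrier (xe_M E)"
    obtain n where n: "n \<in> carrier (xe_M E)" "xe_l E b (xe_j E m) = xe_j E n" using l_j[OF bm] by blast
    show "lact (induced_module E) (xe_p E b) m \<in> carrier (xe_M E)"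
      "xe_j E (lact (induced_module E) (xe_p E b) m) = xe_l E b (xe_j E m)"
      using L[OF bm n] n by simp_all
    obtain n where n: "n \<in> carrier (xe_M E)" "xe_r E (xe_j E m) b = xe_j E n" using r_j[OF bm] by blast
    show "ract (induced_module E) m (xe_p E b) \<in> carrier (xe_M E)"
      "xe_j E (ract (induced_module E) m (xe_p E b)) = xe_r E (xe_j E m) b"
      using R[OF bm n] n by simp_all
  qed (auto simp: induced_module_def)
qed

lemma induced_moduleD:
  assumes "xext_sequence E" "b \<in> carrier (xe_B E)" "m \<in> carrier (xe_M E)"
  shows "lact (induced_module E) (xe_p E b) m \<in> carrier (xe_M E)"
    "xe_j E (lact (induced_module E) (xe_p E b) m) = xe_l E b (xe_j E m)"
    "ract (induced_module E) m (xe_p E b) \<in> carrier (xe_M E)"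
    "xe_j E (ract (induced_module E) m (xe_p E b)) = xe_r E (xe_j E m) b"
  using induced_module_induced[OF assms(1)] assms(2,3)
  unfolding crossed_sequence.induced_def[OF assms(1)] by auto

text \<open>Identifies the induced module without unfolding the definite descriptions in its definition.\<close>

lemma induced_module_eqI:
  assumes "xext_sequence E" "acting T = xe_C E" "acted T = xe_M E"
    "crossed_sequence.induced (xe_M E) (xe_B E) (xe_C E) (xe_l E) (xe_r E) (xe_j E) (xe_p E) (lact T) (ract T)"
  shows "induced_module E = T"
  using crossed_sequence.induced_unique[OF assms(1) induced_module_induced[OF assms(1)] assms(4)] assms(2,3)
  by (intro action.equality) simp_all

lemma is_module_induced:
  assumes E: "is_xext E"
  shows "is_module (induced_module E)"
  unfolding is_module_iff
  using crossed_sequence.induced_biaction[OF is_xextD(1)[OF E] induced_module_induced[OF is_xextD(1)[OF E]]]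
    is_xextD(3)[OF E] by simp

text \<open>With \<open>c = p b\<close>, both sides of the equivariance of \<open>\<mu>\<close> are mapped by \<open>j\<close> to \<open>\<beta> b * \<alpha> (j m)\<close>.\<close>

lemma Pi_map:
  assumes E: "is_xext E" and E': "is_xext E'" and f: "(\<gamma>, \<beta>, \<alpha>, \<mu>) \<in> xext_maps E E'"
  shows "(\<gamma>, \<mu>) \<in> module_maps (induced_module E) (induced_module E')"
proof -
  interpret E: crossed_sequence "xe_M E" "xe_A E" "xe_B E" "xe_C E" "xe_l E" "xe_r E" "xe_j E" "xe_d E" "xe_p E"
    by (rule is_xextD(1)[OF E])
  interpret E': crossed_sequence "xe_M E'" "xe_A E'" "xe_B E'" "xe_C E'" "xe_l E'" "xe_r E'" "xe_j E'" "xe_d E'" "xe_p E'"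
    by (rule is_xextD(1)[OF E'])
  have F: "\<gamma> \<in> algebra_maps (xe_C E) (xe_C E')" "\<beta> \<in> algebra_maps (xe_B E) (xe_B E')"
    "\<mu> \<in> linear_maps (xe_M E) (xe_M E')"
    "\<forall>m\<in>carrier (xe_M E). \<alpha> (xe_j E m) = xe_j E' (\<mu> m)"
    "\<forall>b\<in>carrier (xe_B E). \<gamma> (xe_p E b) = xe_p E' (\<beta> b)"
    "action_compatible (xe_act E) (xe_act E') \<beta> \<alpha>"
    using f unfolding xext_maps_iff[OF E E'] by simp_all
  note i = induced_moduleD[OF is_xextD(1)[OF E]] and i' = induced_moduleD[OF is_xextD(1)[OF E']]
  have cl: "\<beta> b \<in> carrier (xe_B E')" if "b \<in> carrier (xe_B E)" for b by (rule algebra_mapsD(2)[OF F(2) that])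
  have cl2: "\<mu> b \<in> carrier (xe_M E')" if "b \<in> carrier (xe_M E)" for b by (rule linear_mapsD(1)[OF F(3) that])
  have sq: "\<alpha> (xe_j E m) = xe_j E' (\<mu> m)" if "m \<in> carrier (xe_M E)" for m using F(4) that by simp
  have "\<mu> (lact (induced_module E) c m) = lact (induced_module E') (\<gamma> c) (\<mu> m) \<and>
     \<mu> (ract (induced_module E) m c) = ract (induced_module E') (\<mu> m) (\<gamma> c)"
    if c: "c \<in> carrier (xe_C E)" and m: "m \<in> carrier (xe_M E)" for c m
  proof -
    obtain b where b: "b \<in> carrier (xe_B E)" "c = xe_p E b" using E.p_surj[OF c] by blast
    have g: "\<gamma> c = xe_p E' (\<beta> b)" using F(5) b(1) unfolding b(2) by simp
    have ac: "\<alpha> (xe_l E b (xe_j E m)) = xe_l E' (\<beta> b) (xe_j E' (\<mu> m))"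
      "\<alpha> (xe_r E (xe_j E m) b) = xe_r E' (xe_j E' (\<mu> m)) (\<beta> b)"
      using F(6)[unfolded action_compatible_def, rule_format, OF b(1) E.j_simps(1)[OF m]] sq[OF m] by simp_all
    note im = i[OF b(1) m] and im' = i'[OF cl[OF b(1)] cl2[OF m]]
    have "xe_j E' (\<mu> (lact (induced_module E) c m)) = xe_j E' (lact (induced_module E') (\<gamma> c) (\<mu> m))"
      unfolding b(2) g[unfolded b(2)] sq[OF im(1), symmetric] im(2) im'(2) by (rule ac)
    moreover have "xe_j E' (\<mu> (ract (induced_module E) m c)) = xe_j E' (ract (induced_module E') (\<mu> m) (\<gamma> c))"
      unfolding b(2) g[unfolded b(2)] sq[OF im(3), symmetric] im(4) im'(4) by (rule ac)
    ultimately show ?thesis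
      using E'.j_eq[OF cl2[OF im(1)] im'(1)] E'.j_eq[OF cl2[OF im(3)] im'(3)]
      unfolding b(2) g[unfolded b(2)] by simp
  qed
  then show ?thesis
    unfolding module_maps_iff[OF is_module_induced[OF E] is_module_induced[OF E']]
    using F(1,3) unfolding action_compatible_def by simp
qed

abbreviation ends where
  "ends \<equiv> (\<lambda>(\<gamma>, \<beta>, \<alpha>, \<mu>). (\<gamma>, \<mu>))"

abbreviation xext_compose where
  "xext_compose \<equiv> (\<lambda>E (\<gamma>', \<beta>', \<alpha>', \<mu>') (\<gamma>, \<beta>, \<alpha>, \<mu>).
        (compose (carrier (xe_C E)) \<gamma>' \<gamma>, compose (carrier (xe_B E)) \<beta>' \<beta>,
         compose (carrier (xe_A E)) \<alpha>' \<alpha>, compose (carrier (xe_M E)) \<mu>' \<mu>))"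

lemma is_functor_Pi_XExt: "is_functor XExt ModAssAlg Pi_XExt"
  unfolding ModAssAlg_def XExt_def Pi_XExt_def
  by (rule is_functor_concrete[OF category_XExt[unfolded XExt_def] category_ModAssAlg[unfolded ModAssAlg_def]])
     (auto simp: is_module_induced Pi_map)

section \<open>Base change of crossed extensions\<close>

text \<open>Carriers are subsets of one type, so fibre products and direct sums have to be coded in it. An injective
  coding of pairs with its two decoding functions is all that is required.\<close>

locale pairing =
  fixes pr :: "'u \<Rightarrow> 'u \<Rightarrow> 'u" and pr1 pr2 :: "'u \<Rightarrow> 'u"
  assumes pr_simps [simp]: "pr1 (pr x y) = x" "pr2 (pr x y) = y"
begin

lemma pr_eq [simp]: "pr x y = pr x' y' \<longleftrightarrow> x = x' \<and> y = y'"
  by (metis pr_simps)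

definition fibre_product ::
  "('k, 'u) alg \<Rightarrow> ('k, 'u) alg \<Rightarrow> ('u \<Rightarrow> 'u) \<Rightarrow> ('u \<Rightarrow> 'u) \<Rightarrow> ('k, 'u) alg" where
  "fibre_product B D p u = (let P = {pr b c | b c. b \<in> carrier B \<and> c \<in> carrier D \<and> p b = u c} in
     \<lparr>carrier = P,
      vadd = (\<lambda>x y. if x \<in> P \<and> y \<in> P
        then pr (vadd B (pr1 x) (pr1 y)) (vadd D (pr2 x) (pr2 y)) else undefined),
      vzero = pr (vzero B) (vzero D),
      vscale = (\<lambda>s x. if x \<in> P then pr (vscale B s (pr1 x)) (vscale D s (pr2 x)) else undefined),
      amult = (\<lambda>x y. if x \<in> P \<and> y \<in> P
        then pr (amult B (pr1 x) (pr1 y)) (amult D (pr2 x) (pr2 y)) else undefined)\<rparr>)"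

lemma fibre_product_carrier:
  "x \<in> carrier (fibre_product B D p u) \<longleftrightarrow>
     (\<exists>b c. x = pr b c \<and> b \<in> carrier B \<and> c \<in> carrier D \<and> p b = u c)"
  by (simp add: fibre_product_def Let_def)

lemma fibre_product_pr [simp]:
  "pr b c \<in> carrier (fibre_product B D p u) \<longleftrightarrow> b \<in> carrier B \<and> c \<in> carrier D \<and> p b = u c"
  by (simp add: fibre_product_carrier)

lemma fibre_product_cases:
  assumes "x \<in> carrier (fibre_product B D p u)"
  obtains b c where "x = pr b c" "b \<in> carrier B" "c \<in> carrier D" "p b = u c"
  using assms by (auto simp: fibre_product_carrier)

lemma fibre_product_ops:
  "vadd (fibre_product B D p u) x y =
    (if x \<in> carrier (fibre_product B D p u) \<and> y \<in> carrier (fibre_product B D p u)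
     then pr (vadd B (pr1 x) (pr1 y)) (vadd D (pr2 x) (pr2 y)) else undefined)"
  "vzero (fibre_product B D p u) = pr (vzero B) (vzero D)"
  "vscale (fibre_product B D p u) s x =
    (if x \<in> carrier (fibre_product B D p u) then pr (vscale B s (pr1 x)) (vscale D s (pr2 x)) else undefined)"
  "amult (fibre_product B D p u) x y =
    (if x \<in> carrier (fibre_product B D p u) \<and> y \<in> carrier (fibre_product B D p u)
     then pr (amult B (pr1 x) (pr1 y)) (amult D (pr2 x) (pr2 y)) else undefined)"
  by (simp_all add: fibre_product_def Let_def)

lemma assoc_algebra_fibre_product:
  assumes B: "assoc_algebra B" and D: "assoc_algebra D" and C: "assoc_algebra C"
    and p: "p \<in> algebra_maps B C" and u: "u \<in> algebra_maps D C"
  shows "assoc_algebra (fibre_product B D p u)"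
proof -
  note VB = assoc_algebraD(1)[OF B] and VD = assoc_algebraD(1)[OF D] and VC = assoc_algebraD(1)[OF C]
  note mB = bilinear_opD[OF assoc_algebraD(2)[OF B]] and mD = bilinear_opD[OF assoc_algebraD(2)[OF D]]
  note P = algebra_mapsD(2-5)[OF p] linear_maps_zero[OF algebra_mapsD(1)[OF p] VB VC]
  note U = algebra_mapsD(2-5)[OF u] linear_maps_zero[OF algebra_mapsD(1)[OF u] VD VC]
  note S = P U vspaceD(1,4,6)[OF VB] vspaceD(1,4,6)[OF VD] fibre_product_ops
  let ?P = "fibre_product B D p u"
  have V: "vspace ?P"
  proof (rule vspaceI)
    fix x y z and r s :: 'a assume x: "x \<in> carrier ?P" and y: "y \<in> carrier ?P" and z: "z \<in> carrier ?P"
    then show "vadd ?P (vadd ?P x y) z = vadd ?P x (vadd ?P y z)"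
      by (elim fibre_product_cases) (simp add: S vspaceD(2)[OF VB] vspaceD(2)[OF VD])
  next
    fix x y and r s :: 'a assume x: "x \<in> carrier ?P" and y: "y \<in> carrier ?P"
    then show "vadd ?P x y \<in> carrier ?P"
      by (elim fibre_product_cases) (simp add: S)
    from x y show "vadd ?P x y = vadd ?P y x"
      by (elim fibre_product_cases) (simp add: S vspaceD(3)[OF VB] vspaceD(3)[OF VD])
    from x y show "vscale ?P r (vadd ?P x y) = vadd ?P (vscale ?P r x) (vscale ?P r y)"
      by (elim fibre_product_cases) (simp add: S vspaceD(7)[OF VB] vspaceD(7)[OF VD])
  next
    fix x and r s :: 'a assume x: "x \<in> carrier ?P"
    then show "vadd ?P (vzero ?P) x = x" "vscale ?P r x \<in> carrier ?P" "vscale ?P 1 x = x"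
      "vscale ?P 0 x = vzero ?P" "vscale ?P (r + s) x = vadd ?P (vscale ?P r x) (vscale ?P s x)"
      "vscale ?P (r * s) x = vscale ?P r (vscale ?P s x)"
      by (elim fibre_product_cases; simp add: S vspaceD(5,8-10,14)[OF VB] vspaceD(5,8-10,14)[OF VD])+
  qed (auto simp: S)
  have "bilinear_op ?P ?P ?P (amult ?P)"
  proof (rule bilinear_opI[OF _ _ _ _ _ _ V V])
    fix x y z and k :: 'a assume x: "x \<in> carrier ?P" and y: "y \<in> carrier ?P" and z: "z \<in> carrier ?P"
    then show "amult ?P x (vadd ?P y z) = vadd ?P (amult ?P x y) (amult ?P x z)"
      by (elim fibre_product_cases) (simp add: S mB mD)
    from x y z show "amult ?P (vadd ?P x y) z = vadd ?P (amult ?P x z) (amult ?P y z)"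
      by (elim fibre_product_cases) (simp add: S mB mD)
  next
    fix x y and k :: 'a assume x: "x \<in> carrier ?P" and y: "y \<in> carrier ?P"
    then show "amult ?P x y \<in> carrier ?P" 
      by (elim fibre_product_cases) (simp add: S mB mD)
    from x y show "amult ?P x (vscale ?P k y) = vscale ?P k (amult ?P x y)"
      by (elim fibre_product_cases) (simp add: S mB mD)
    from x y show "amult ?P (vscale ?P k x) y = vscale ?P k (amult ?P x y)"
      by (elim fibre_product_cases) (simp add: S mB mD)
  qed (auto simp: S)
  moreover have "amult ?P (amult ?P x y) z = amult ?P x (amult ?P y z)"
    if "x \<in> carrier ?P" "y \<in> carrier ?P" "z \<in> carrier ?P" for x y z
    using that by (elim fibre_product_cases) (simp add: S mB mD assoc_algebraD(3)[OF B] assoc_algebraD(3)[OF D])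
  ultimately show ?thesis using V by (simp add: assoc_algebra_def)
qed

lemma fibre_product_projections:
  "(\<lambda>x\<in>carrier (fibre_product B D p u). pr1 x) \<in> algebra_maps (fibre_product B D p u) B"
  "(\<lambda>x\<in>carrier (fibre_product B D p u). pr2 x) \<in> algebra_maps (fibre_product B D p u) D"
  if "assoc_algebra (fibre_product B D p u)"
proof -
  note S = vspaceD(1,6)[OF assoc_algebraD(1)[OF that]] assoc_algebraD(4)[OF that]
  let ?P = "fibre_product B D p u"
  show "(\<lambda>x\<in>carrier ?P. pr1 x) \<in> algebra_maps ?P B"
    unfolding algebra_maps_def
    by (auto intro!: linear_mapsI simp: S; auto simp: fibre_product_ops fibre_product_carrier)
  show "(\<lambda>x\<in>carrier ?P. pr2 x) \<in> algebra_maps ?P D"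
    unfolding algebra_maps_def
    by (auto intro!: linear_mapsI simp: S; auto simp: fibre_product_ops fibre_product_carrier)
qed

text \<open>The sequence \<open>0 \<rightarrow> M \<rightarrow> A \<rightarrow> B \<times>\<^sub>C D \<rightarrow> D \<rightarrow> 0\<close> with \<open>d' a = (d a, 0)\<close>, where the fibre product acts on \<open>A\<close>
  through its first projection.\<close>

definition pullback_xext :: "('k, 'u) alg \<Rightarrow> ('u \<Rightarrow> 'u) \<Rightarrow> ('k, 'u) xext \<Rightarrow> ('k, 'u) xext" where
  "pullback_xext D u E = (let P = fibre_product (xe_B E) D (xe_p E) u in
     \<lparr>xe_M = xe_M E,
      xe_act = \<lparr>acting = P, acted = xe_A E,
        lact = (\<lambda>x a. if x \<in> carrier P \<and> a \<in> carrier (xe_A E)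
          then xe_l E ((\<lambda>x\<in>carrier P. pr1 x) x) a else undefined),
        ract = (\<lambda>a x. if a \<in> carrier (xe_A E) \<and> x \<in> carrier P
          then xe_r E a ((\<lambda>x\<in>carrier P. pr1 x) x) else undefined)\<rparr>,
      xe_C = D, xe_j = xe_j E,
      xe_d = (\<lambda>a\<in>carrier (xe_A E). pr (xe_d E a) (vzero D)),
      xe_p = (\<lambda>x\<in>carrier P. pr2 x)\<rparr>)"

definition pullback_map :: "('k, 'u) alg \<Rightarrow> ('u \<Rightarrow> 'u) \<Rightarrow> ('k, 'u) xext \<Rightarrow> 'u maps4" where
  "pullback_map D u E = (u, (\<lambda>x\<in>carrier (fibre_product (xe_B E) D (xe_p E) u). pr1 x),
     id_map (xe_A E), id_map (xe_M E))"

end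

locale xext_base_change = pairing pr pr1 pr2 for pr :: "'u \<Rightarrow> 'u \<Rightarrow> 'u" and pr1 pr2 +
  fixes E :: "('k::field, 'u) xext" and D :: "('k, 'u) alg" and u :: "'u \<Rightarrow> 'u"
  assumes E: "is_xext E" and D: "assoc_algebra D" and u: "u \<in> algebra_maps D (xe_C E)"
begin

sublocale crossed_sequence "xe_M E" "xe_A E" "xe_B E" "xe_C E" "xe_l E" "xe_r E" "xe_j E" "xe_d E" "xe_p E"
  by (rule is_xextD(1)[OF E])

abbreviation P where "P \<equiv> fibre_product (xe_B E) D (xe_p E) u"
abbreviation F where "F \<equiv> pullback_xext D u E"

lemma P: "assoc_algebra P"
  by (rule assoc_algebra_fibre_product[OF B D C p u])

lemmas VD = assoc_algebraD(1)[OF D]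
lemmas u_simps = algebra_mapsD(2-5)[OF u] linear_maps_zero[OF algebra_mapsD(1)[OF u] VD VC]

lemma F_simps [simp]:
  "xe_M F = xe_M E" "xe_B F = P" "xe_A F = xe_A E" "xe_C F = D" "xe_j F = xe_j E"
  by (simp_all add: pullback_xext_def Let_def)

lemma F_l [simp]: "\<lbrakk>pr b c \<in> carrier P; a \<in> carrier (xe_A E)\<rbrakk> \<Longrightarrow> xe_l F (pr b c) a = xe_l E b a"
  and F_r [simp]: "\<lbrakk>pr b c \<in> carrier P; a \<in> carrier (xe_A E)\<rbrakk> \<Longrightarrow> xe_r F a (pr b c) = xe_r E a b"
  and F_d [simp]: "a \<in> carrier (xe_A E) \<Longrightarrow> xe_d F a = pr (xe_d E a) (vzero D)"
  and F_p [simp]: "pr b c \<in> carrier P \<Longrightarrow> xe_p F (pr b c) = c"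
  by (simp_all add: pullback_xext_def Let_def)

lemma biaction_F: "biaction P (xe_A E) (xe_l F) (xe_r F)"
  using biaction_restrict[OF act P fibre_product_projections(1)[OF P]]
  by (simp only: pullback_xext_def Let_def xext.simps action.simps)

lemma precrossed_F: "precrossed P (xe_A E) (xe_l F) (xe_r F) (xe_d F)"
  unfolding precrossed_def
proof (intro conjI ballI biaction_F)
  have pd: "pr (xe_d E a) (vzero D) \<in> carrier P" if "a \<in> carrier (xe_A E)" for a
    using that by (simp add: d_simps p_d u_simps vspaceD(4)[OF VD])
  show "xe_d F \<in> linear_maps (xe_A E) P"
  proof (rule linear_mapsI)
    show "xe_d F x = undefined" if "x \<notin> carrier (xe_A E)" for x
      using that by (simp add: pullback_xext_def Let_def)
  qed (simp_all add: closed d_simps fibre_product_ops p_d u_simps vspaceD(4,5,17)[OF VD])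
  fix a x assume a: "a \<in> carrier (xe_A E)" and "x \<in> carrier P"
  then obtain b c where x: "x = pr b c" "b \<in> carrier (xe_B E)" "c \<in> carrier D" "xe_p E b = u c"
    by (elim fibre_product_cases)
  have xP: "pr b c \<in> carrier P" using x by simp
  note z = bilinear_op_zero[OF assoc_algebraD(2)[OF D] VD VD VD]
  show "xe_d F (xe_l F x a) = amult P x (xe_d F a)"
    unfolding x(1) using xP a x pd[OF a] by (simp add: F_l[OF xP a] l(1) d_simps fibre_product_ops z p_d u_simps vspaceD(4)[OF VD])
  show "xe_d F (xe_r F a x) = amult P (xe_d F a) x"
    unfolding x(1) using xP a x pd[OF a] by (simp add: F_r[OF xP a] r(1) d_simps fibre_product_ops z p_d u_simps vspaceD(4)[OF VD])
next
  fix a a' assume a: "a \<in> carrier (xe_A E)" and a': "a' \<in> carrier (xe_A E)"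
  have pd: "pr (xe_d E a) (vzero D) \<in> carrier P" if "a \<in> carrier (xe_A E)" for a
    using that by (simp add: d_simps p_d u_simps vspaceD(4)[OF VD])
  show "xe_l F (xe_d F a) a' = xe_r F a (xe_d F a')"
    unfolding F_d[OF a] F_d[OF a'] F_l[OF pd[OF a] a'] F_r[OF pd[OF a'] a] by (rule peiffer[OF a a'])
qed

lemma exact_F: "exact_seq (xe_M E) (xe_A E) P D (xe_j E) (xe_d F) (xe_p F)"
  unfolding exact_seq_def
proof (intro conjI equalityI subsetI)
  show "inj_on (xe_j E) (carrier (xe_M E))" by (simp add: inj_on_def j_eq)
  show "a \<in> kernel_of (xe_A E) P (xe_d F)" if "a \<in> xe_j E ` carrier (xe_M E)" for a
    using that by (auto simp: kernel_of_def j_simps(1) d_j fibre_product_ops)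
  show "a \<in> xe_j E ` carrier (xe_M E)" if "a \<in> kernel_of (xe_A E) P (xe_d F)" for a
    using that ker_d[of a] by (auto simp: kernel_of_def fibre_product_ops)
  show "x \<in> kernel_of P D (xe_p F)" if "x \<in> xe_d F ` carrier (xe_A E)" for x
    using that by (auto simp: kernel_of_def d_simps p_d u_simps vspaceD(4)[OF VD])
  show "x \<in> xe_d F ` carrier (xe_A E)" if "x \<in> kernel_of P D (xe_p F)" for x
  proof -
    have xP: "x \<in> carrier P" and x0: "xe_p F x = vzero D" using that by (auto simp: kernel_of_def)
    obtain b c where x: "x = pr b c" "b \<in> carrier (xe_B E)" "c \<in> carrier D" "xe_p E b = u c"
      by (rule fibre_product_cases[OF xP])
    have "c = vzero D" using x0 xP unfolding x(1) by simp
    then obtain a where "a \<in> carrier (xe_A E)" "b = xe_d E a" using ker_p[of b] x u_simps by auto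
    then show ?thesis using x \<open>c = vzero D\<close> by (intro image_eqI[of _ _ a]) simp_all
  qed
  show "c \<in> carrier D" if "c \<in> xe_p F ` carrier P" for c
    using that by (auto elim!: fibre_product_cases)
  \<comment> \<open>the second projection is surjective since \<open>p\<close> is\<close>
  show "c \<in> xe_p F ` carrier P" if c: "c \<in> carrier D" for c
  proof -
    obtain b where "b \<in> carrier (xe_B E)" "u c = xe_p E b" using p_surj[OF u_simps(1)[OF c]] by blast
    then show ?thesis using c by (intro image_eqI[of _ _ "pr b c"]) simp_all
  qed
qed

lemma sequence_F: "xext_sequence F"
  unfolding crossed_sequence_def F_simps
  using M D precrossed_F j exact_F fibre_product_projections(2)[OF P]
  by (simp add: pullback_xext_def Let_def)

lemma is_xext_F: "is_xext F"
proof -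
  have "has_mult (xe_A E) (\<lambda>a a'. xe_l F (xe_d F a) a')"
    using is_xextD(2)[OF E] unfolding has_mult_def
    by (auto simp: d_simps p_d u_simps vspaceD(4)[OF VD])
  then show ?thesis
    unfolding is_xext_iff using sequence_F is_xextD(3)[OF E] by simp
qed

lemma pullback_map: "pullback_map D u E \<in> xext_maps F E"
  unfolding pullback_map_def xext_maps_iff[OF is_xext_F E]
proof (intro conjI ballI)
  show "(\<lambda>x\<in>carrier P. pr1 x) \<in> algebra_maps (xe_B F) (xe_B E)"
    using fibre_product_projections(1)[OF P] by simp
  show "action_compatible (xe_act F) (xe_act E) (\<lambda>x\<in>carrier P. pr1 x) (id_map (xe_A E))"
    unfolding action_compatible_def
    by (auto elim!: fibre_product_cases simp: l(1) r(1))
qed (auto elim!: fibre_product_cases simp: u A M id_map_linear j_simps(1) d_simps(1) p_d u_simps vspaceD(4)[OF VD])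

text \<open>The lift is the identity on \<open>A\<close> and \<open>M\<close>, so a comparison map is determined there. On \<open>B\<close> it must be the map
  into the fibre product with components \<open>\<beta>\<close> and \<open>v \<circ> p\<close>, and this map is compatible with all structure
  because its components are.\<close>

lemma cartesian_pullback_map:
  "cartesian_hom {E. is_xext E} xext_maps xext_compose (acting \<circ> induced_module) (fst \<circ> ends)
     algebra_maps algebra_compose F E (pullback_map D u E)"
  unfolding cartesian_hom_def
proof (intro ballI impI)
  fix W h v assume W0: "W \<in> {E. is_xext E}" and h0: "h \<in> xext_maps W E"
    and v0: "v \<in> algebra_maps ((acting \<circ> induced_module) W) ((acting \<circ> induced_module) F)"
    and e0: "compose (carrier ((acting \<circ> induced_module) W)) ((fst \<circ> ends) (pullback_map D u E)) v =
      (fst \<circ> ends) h"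
  have W: "is_xext W" using W0 by simp
  interpret W: crossed_sequence "xe_M W" "xe_A W" "xe_B W" "xe_C W" "xe_l W" "xe_r W" "xe_j W" "xe_d W" "xe_p W"
    by (rule is_xextD(1)[OF W])
  obtain \<gamma> \<beta> \<alpha> \<mu> where h: "h = (\<gamma>, \<beta>, \<alpha>, \<mu>)" by (cases h)
  have v: "v \<in> algebra_maps (xe_C W) D" using v0 by simp
  have e: "compose (carrier (xe_C W)) u v = \<gamma>" using e0 by (simp add: h pullback_map_def)
  have f: "\<gamma> \<in> algebra_maps (xe_C W) (xe_C E)" "\<beta> \<in> algebra_maps (xe_B W) (xe_B E)"
    "\<alpha> \<in> linear_maps (xe_A W) (xe_A E)" "\<mu> \<in> linear_maps (xe_M W) (xe_M E)"
    "\<forall>m\<in>carrier (xe_M W). \<alpha> (xe_j W m) = xe_j E (\<mu> m)"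
    "\<forall>a\<in>carrier (xe_A W). \<beta> (xe_d W a) = xe_d E (\<alpha> a)"
    "\<forall>b\<in>carrier (xe_B W). \<gamma> (xe_p W b) = xe_p E (\<beta> b)"
    "action_compatible (xe_act W) (xe_act E) \<beta> \<alpha>"
    using h0 unfolding h xext_maps_iff[OF W E] by simp_all
  note vs = algebra_mapsD(2-5)[OF v] linear_maps_zero[OF algebra_mapsD(1)[OF v] W.VC VD]
  note bs = algebra_mapsD(2-5)[OF f(2)]
  have uv: "u (v c) = \<gamma> c" if "c \<in> carrier (xe_C W)" for c by (rule compose_eqD[OF e that])
  let ?b = "\<lambda>b\<in>carrier (xe_B W). pr (\<beta> b) (v (xe_p W b))"
  have bP: "pr (\<beta> b) (v (xe_p W b)) \<in> carrier P" if "b \<in> carrier (xe_B W)" for b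
    using that f(7) by (simp add: bs vs uv W.p_simps)
  have b: "?b \<in> algebra_maps (xe_B W) P"
    unfolding algebra_maps_def
  proof (intro CollectI conjI linear_mapsI ballI)
    fix x y assume xy: "x \<in> carrier (xe_B W)" "y \<in> carrier (xe_B W)"
    note bP[OF xy(1)] bP[OF xy(2)]
    then show "?b (vadd (xe_B W) x y) = vadd P (?b x) (?b y)" "?b (amult (xe_B W) x y) = amult P (?b x) (?b y)"
      using xy by (simp_all add: bs vs W.p_simps W.closed fibre_product_ops del: fibre_product_pr)
  next
    fix x r assume x: "x \<in> carrier (xe_B W)"
    then show "?b (vscale (xe_B W) r x) = vscale P r (?b x)"
      using bP[OF x] by (simp add: bs vs W.p_simps W.closed fibre_product_ops del: fibre_product_pr)
  qed (use bP in \<open>simp_all del: fibre_product_pr\<close>)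
  have ac: "action_compatible (xe_act W) (xe_act F) ?b \<alpha>"
    unfolding action_compatible_def
  proof (intro ballI)
    fix b a assume ba: "b \<in> carrier (xe_B W)" "a \<in> carrier (xe_A W)"
    have "\<alpha> a \<in> carrier (xe_A E)" by (rule linear_mapsD(1)[OF f(3) ba(2)])
    then show "\<alpha> (xe_l W b a) = xe_l F (?b b) (\<alpha> a) \<and> \<alpha> (xe_r W a b) = xe_r F (\<alpha> a) (?b b)"
      using ba bP[OF ba(1)] f(8)[unfolded action_compatible_def, rule_format, OF ba] by simp
  qed
  have g: "(v, ?b, \<alpha>, \<mu>) \<in> xext_maps W F"
    unfolding xext_maps_iff[OF W is_xext_F] F_simps
  proof (intro conjI v b f(3,4) ac ballI)
    show "\<alpha> (xe_j W m) = xe_j E (\<mu> m)" if "m \<in> carrier (xe_M W)" for m using f(5) that by simp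
    show "?b (xe_d W a) = xe_d F (\<alpha> a)" if "a \<in> carrier (xe_A W)" for a
      using that f(6) linear_mapsD(1)[OF f(3) that] by (simp add: W.d_simps W.p_d vs)
    show "v (xe_p W b) = xe_p F (?b b)" if "b \<in> carrier (xe_B W)" for b
      using that bP[OF that] by simp
  qed
  show "\<exists>!g. g \<in> xext_maps W F \<and> (fst \<circ> ends) g = v \<and>
      xext_compose W (pullback_map D u E) g = h"
  proof (intro ex1I[of _ "(v, ?b, \<alpha>, \<mu>)"] conjI)
    show "(v, ?b, \<alpha>, \<mu>) \<in> xext_maps W F" by (rule g)
    have "compose (carrier (xe_B W)) (\<lambda>x\<in>carrier P. pr1 x) ?b = \<beta>"
      by (rule linear_maps_eqI[OF linear_maps_compose[OF algebra_mapsD(1)[OF b] _ W.VB] algebra_mapsD(1)[OF f(2)]])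
         (use bP fibre_product_projections(1)[OF P, THEN algebra_mapsD(1)] in \<open>simp_all del: fibre_product_pr\<close>)
    then show "xext_compose W (pullback_map D u E) (v, ?b, \<alpha>, \<mu>) = h"
      by (simp add: pullback_map_def h e linear_maps_compose_id(2)[OF f(3)] linear_maps_compose_id(2)[OF f(4)])
    fix g assume g0: "g \<in> xext_maps W F \<and> (fst \<circ> ends) g = v \<and>
      xext_compose W (pullback_map D u E) g = h"
    obtain v' \<beta>' \<alpha>' \<mu>' where gg0: "g = (v', \<beta>', \<alpha>', \<mu>')" by (cases g)
    have gg: "g = (v, \<beta>', \<alpha>', \<mu>')" using g0 unfolding gg0 by simp
    have g1: "(v, \<beta>', \<alpha>', \<mu>') \<in> xext_maps W F"
      "compose (carrier (xe_B W)) (\<lambda>x\<in>carrier P. pr1 x) \<beta>' = \<beta>"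
      "compose (carrier (xe_A W)) (id_map (xe_A E)) \<alpha>' = \<alpha>"
      "compose (carrier (xe_M W)) (id_map (xe_M E)) \<mu>' = \<mu>"
      using g0 unfolding gg h pullback_map_def by simp_all
    have g2: "\<beta>' \<in> algebra_maps (xe_B W) P" "\<alpha>' \<in> linear_maps (xe_A W) (xe_A E)"
      "\<mu>' \<in> linear_maps (xe_M W) (xe_M E)" "\<forall>b\<in>carrier (xe_B W). v (xe_p W b) = xe_p F (\<beta>' b)"
      using g1(1) unfolding xext_maps_iff[OF W is_xext_F] by simp_all
    have "\<alpha>' = \<alpha>" "\<mu>' = \<mu>"
      using g1(3,4) linear_maps_compose_id(2)[OF g2(2)] linear_maps_compose_id(2)[OF g2(3)] by simp_all
    moreover have "\<beta>' = ?b"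
    proof (rule linear_maps_eqI[OF algebra_mapsD(1)[OF g2(1)] algebra_mapsD(1)[OF b]])
      fix x assume x: "x \<in> carrier (xe_B W)"
      have bx: "\<beta>' x \<in> carrier P" by (rule algebra_mapsD(2)[OF g2(1) x])
      obtain y c where y: "\<beta>' x = pr y c" "y \<in> carrier (xe_B E)" "c \<in> carrier D" "xe_p E y = u c"
        by (rule fibre_product_cases[OF bx])
      have "y = \<beta> x" using compose_eqD[OF g1(2) x] bx unfolding y(1) by simp
      moreover have "c = v (xe_p W x)" using g2(4) x bx unfolding y(1) by (simp add: y)
      ultimately show "\<beta>' x = ?b x" using x y by simp
    qed
    ultimately show "g = (v, ?b, \<alpha>, \<mu>)" using gg by simp
  qed (simp add: comp_def)
qed

end

section \<open>Pushout of crossed extensions\<close>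

text \<open>The situation of an opcartesian lift: \<open>\<mu>\<close> is a vertical arrow out of the module induced by \<open>E\<close>.\<close>

locale xext_pushout = pairing pr pr1 pr2 for pr :: "'u \<Rightarrow> 'u \<Rightarrow> 'u" and pr1 pr2 +
  fixes E :: "('k::field, 'u) xext" and T :: "('k, 'u) action" and \<mu> :: "'u \<Rightarrow> 'u"
  assumes E: "is_xext E" and T: "is_module T" and acting_T: "acting T = xe_C E"
    and \<mu>: "(id_map (xe_C E), \<mu>) \<in> module_maps (induced_module E) T"
begin

sublocale crossed_sequence "xe_M E" "xe_A E" "xe_B E" "xe_C E" "xe_l E" "xe_r E" "xe_j E" "xe_d E" "xe_p E"
  by (rule is_xextD(1)[OF E])

abbreviation N where "N \<equiv> acted T"

lemmas actT = is_moduleD(1)[OF T, unfolded acting_T]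
lemmas VN = is_moduleD(6)[OF T]
lemmas lT = bilinear_opD[OF biactionD(3)[OF actT]]
lemmas rT = bilinear_opD[OF biactionD(4)[OF actT]]

lemma \<mu>_linear: "\<mu> \<in> linear_maps (xe_M E) N"
  using \<mu> is_module_induced[OF E] T by (simp add: module_maps_iff)

lemmas \<mu>_simps = linear_mapsD(1-3)[OF \<mu>_linear] linear_maps_zero[OF \<mu>_linear M VN]

text \<open>The subspace of pairs \<open>(j n, - \<mu> n)\<close>, by which the pushout is a quotient, is stable under the left
  action of \<open>B\<close>, and likewise under the right action.\<close>

lemma \<mu>_act:
  assumes b: "b \<in> carrier (xe_B E)" and n: "n \<in> carrier (xe_M E)"
  obtains n' where "n' \<in> carrier (xe_M E)" "xe_j E n' = xe_l E b (xe_j E n)" "\<mu> n' = lact T (xe_p E b) (\<mu> n)"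
  using \<mu>[unfolded module_maps_iff[OF is_module_induced[OF E] T] action_compatible_def, THEN conjunct2, THEN conjunct2,
      rule_format, of "xe_p E b" n] induced_moduleD[OF is_xextD(1)[OF E] b n] b n p_simps(1)[OF b]
  by simp

lemma \<mu>_act':
  assumes b: "b \<in> carrier (xe_B E)" and n: "n \<in> carrier (xe_M E)"
  obtains n' where "n' \<in> carrier (xe_M E)" "xe_j E n' = xe_r E (xe_j E n) b" "\<mu> n' = ract T (\<mu> n) (xe_p E b)"
  using \<mu>[unfolded module_maps_iff[OF is_module_induced[OF E] T] action_compatible_def, THEN conjunct2, THEN conjunct2,
      rule_format, of "xe_p E b" n] induced_moduleD[OF is_xextD(1)[OF E] b n] b n p_simps(1)[OF b]
  by simp

text \<open>The pairs \<open>(a, m)\<close> and \<open>(a', m')\<close> in the direct sum of \<open>A\<close> and \<open>N\<close> differ by \<open>(j n, - \<mu> n)\<close>. Moving the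
  sign to the other side avoids subtraction.\<close>

definition equivalent :: "'u \<Rightarrow> 'u \<Rightarrow> 'u \<Rightarrow> 'u \<Rightarrow> bool" where
  "equivalent a m a' m' \<longleftrightarrow>
     (\<exists>n\<in>carrier (xe_M E). a = vadd (xe_A E) a' (xe_j E n) \<and> m' = vadd N m (\<mu> n))"

lemma equivalent_refl: "\<lbrakk>a \<in> carrier (xe_A E); m \<in> carrier N\<rbrakk> \<Longrightarrow> equivalent a m a m"
  unfolding equivalent_def
  by (intro bexI[of _ "vzero (xe_M E)"]) (simp_all add: j_simps \<mu>_simps vspaceD(12)[OF A] vspaceD(12)[OF VN] closed)

lemma equivalent_trans:
  assumes "a'' \<in> carrier (xe_A E)" "m \<in> carrier N" "equivalent a m a' m'" "equivalent a' m' a'' m''"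
  shows "equivalent a m a'' m''"
proof -
  obtain n n' where n: "n \<in> carrier (xe_M E)" "a = vadd (xe_A E) a' (xe_j E n)" "m' = vadd N m (\<mu> n)"
    "n' \<in> carrier (xe_M E)" "a' = vadd (xe_A E) a'' (xe_j E n')" "m'' = vadd N m' (\<mu> n')"
    using assms(3,4) unfolding equivalent_def by metis
  then show ?thesis
    unfolding equivalent_def using assms(1,2)
    by (intro bexI[of _ "vadd (xe_M E) n n'"])
       (simp_all add: j_simps \<mu>_simps vspaceD(2,3,11)[OF A] vspaceD(2,3,11)[OF VN] closed vspaceD(1)[OF VN])
qed

lemma equivalent_sym:
  assumes "a' \<in> carrier (xe_A E)" "m \<in> carrier N" "equivalent a m a' m'"
  shows "equivalent a' m' a m"
proof -
  obtain n where n: "n \<in> carrier (xe_M E)" "a = vadd (xe_A E) a' (xe_j E n)" "m' = vadd N m (\<mu> n)"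
    using assms(3) unfolding equivalent_def by metis
  then show ?thesis
    unfolding equivalent_def using assms(1,2)
    by (intro bexI[of _ "vscale (xe_M E) (-1) n"])
       (simp_all add: j_simps \<mu>_simps vspaceD(2,12,15)[OF A] vspaceD(2,12,15)[OF VN] closed vspaceD(6)[OF VN])
qed

text \<open>The quotient map. The carrier of the pushout has to be a set of elements of the universe, so a class is
  coded by a chosen representative.\<close>

definition q :: "'u \<Rightarrow> 'u \<Rightarrow> 'u" where
  "q a m = (SOME z. \<exists>a'\<in>carrier (xe_A E). \<exists>m'\<in>carrier N. z = pr a' m' \<and> equivalent a m a' m')"

lemma q_representative:
  assumes "a \<in> carrier (xe_A E)" "m \<in> carrier N"
  obtains a' m' where "q a m = pr a' m'" "a' \<in> carrier (xe_A E)" "m' \<in> carrier N" "equivalent a m a' m'"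
proof -
  have "\<exists>z. \<exists>a'\<in>carrier (xe_A E). \<exists>m'\<in>carrier N. z = pr a' m' \<and> equivalent a m a' m'"
    using equivalent_refl[OF assms] assms by blast
  from someI_ex[OF this] show thesis using that unfolding q_def by blast
qed

lemma q_eq:
  assumes a: "a \<in> carrier (xe_A E)" "m \<in> carrier N" and a': "a' \<in> carrier (xe_A E)" "m' \<in> carrier N"
  shows "q a m = q a' m' \<longleftrightarrow> equivalent a m a' m'"
proof
  assume eq: "q a m = q a' m'"
  obtain x y where 1: "q a m = pr x y" "x \<in> carrier (xe_A E)" "y \<in> carrier N" "equivalent a m x y"
    by (rule q_representative[OF a])
  obtain x' y' where 2: "q a' m' = pr x' y'" "equivalent a' m' x' y'"
    by (rule q_representative[OF a'])
  have "equivalent a' m' x y" using 1 2 eq by simp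
  then have "equivalent x y a' m'" using equivalent_sym 1 a' by blast
  then show "equivalent a m a' m'" using equivalent_trans[OF a'(1) a(2) 1(4)] by blast
next
  assume eq: "equivalent a m a' m'"
  have "equivalent a m x y \<longleftrightarrow> equivalent a' m' x y" if "x \<in> carrier (xe_A E)" "y \<in> carrier N" for x y
    using equivalent_trans[OF that(1) a(2) eq] equivalent_trans[OF that(1) a'(2) equivalent_sym[OF a'(1) a(2) eq]] by blast
  then show "q a m = q a' m'"
    unfolding q_def by (intro arg_cong[of _ _ Eps] ext) blast
qed

text \<open>The pushout of \<open>j\<close> and \<open>\<mu>\<close>, with operations computed on representatives. The lemmas \<open>Q_add\<close> to \<open>Q_d\<close> show
  that the results depend only on the classes. From then on only these equations are used.\<close>

definition Q :: "('k, 'u) vect" where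
  "Q = (let S = {q a m | a m. a \<in> carrier (xe_A E) \<and> m \<in> carrier N} in
     \<lparr>carrier = S,
      vadd = (\<lambda>x y. if x \<in> S \<and> y \<in> S
        then q (vadd (xe_A E) (pr1 x) (pr1 y)) (vadd N (pr2 x) (pr2 y)) else undefined),
      vzero = q (vzero (xe_A E)) (vzero N),
      vscale = (\<lambda>s x. if x \<in> S then q (vscale (xe_A E) s (pr1 x)) (vscale N s (pr2 x)) else undefined)\<rparr>)"

lemma Q_carrier: "x \<in> carrier Q \<longleftrightarrow> (\<exists>a\<in>carrier (xe_A E). \<exists>m\<in>carrier N. x = q a m)"
  by (auto simp: Q_def Let_def)

lemma Q_q [simp]: "\<lbrakk>a \<in> carrier (xe_A E); m \<in> carrier N\<rbrakk> \<Longrightarrow> q a m \<in> carrier Q"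
  unfolding Q_carrier by blast

lemma Q_cases:
  assumes "x \<in> carrier Q"
  obtains a m where "x = q a m" "a \<in> carrier (xe_A E)" "m \<in> carrier N"
  using assms unfolding Q_carrier by blast

lemma Q_cases':
  assumes "x \<in> carrier (with_mult Q f)"
  obtains a m where "x = q a m" "a \<in> carrier (xe_A E)" "m \<in> carrier N"
  by (rule Q_cases[OF _ that]) (use assms in simp)

definition lQ where
  "lQ b x = (if b \<in> carrier (xe_B E) \<and> x \<in> carrier Q
     then q (xe_l E b (pr1 x)) (lact T (xe_p E b) (pr2 x)) else undefined)"

definition rQ where
  "rQ x b = (if x \<in> carrier Q \<and> b \<in> carrier (xe_B E)
     then q (xe_r E (pr1 x) b) (ract T (pr2 x) (xe_p E b)) else undefined)"

definition dQ where "dQ = (\<lambda>x\<in>carrier Q. xe_d E (pr1 x))"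

lemma Q_zero: "vzero Q = q (vzero (xe_A E)) (vzero N)"
  by (simp add: Q_def Let_def)

lemma Q_add:
  assumes a: "a \<in> carrier (xe_A E)" "m \<in> carrier N" and a': "a' \<in> carrier (xe_A E)" "m' \<in> carrier N"
  shows "vadd Q (q a m) (q a' m') = q (vadd (xe_A E) a a') (vadd N m m')"
proof -
  obtain x y where 1: "q a m = pr x y" "x \<in> carrier (xe_A E)" "y \<in> carrier N" "equivalent a m x y"
    by (rule q_representative[OF a])
  obtain x' y' where 2: "q a' m' = pr x' y'" "x' \<in> carrier (xe_A E)" "y' \<in> carrier N" "equivalent a' m' x' y'"
    by (rule q_representative[OF a'])
  obtain n n' where n: "n \<in> carrier (xe_M E)" "a = vadd (xe_A E) x (xe_j E n)" "y = vadd N m (\<mu> n)"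
    "n' \<in> carrier (xe_M E)" "a' = vadd (xe_A E) x' (xe_j E n')" "y' = vadd N m' (\<mu> n')"
    using 1 2 unfolding equivalent_def by blast
  have "equivalent (vadd (xe_A E) a a') (vadd N m m') (vadd (xe_A E) x x') (vadd N y y')"
    unfolding equivalent_def
    by (rule bexI[of _ "vadd (xe_M E) n n'"])
       (use n 1(2,3) 2(2,3) a a' in \<open>simp_all add: j_simps \<mu>_simps vspaceD(2,3,11)[OF A] vspaceD(2,3,11)[OF VN] closed
         vspaceD(1)[OF VN]\<close>)
  then have "q (vadd (xe_A E) a a') (vadd N m m') = q (vadd (xe_A E) x x') (vadd N y y')"
    by (subst q_eq) (use 1 2 a a' in \<open>simp_all add: closed vspaceD(1)[OF VN]\<close>)
  moreover have "vadd Q (q a m) (q a' m') = q (vadd (xe_A E) (pr1 (q a m)) (pr1 (q a' m'))) (vadd N (pr2 (q a m)) (pr2 (q a' m')))"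
    using Q_q[OF a] Q_q[OF a'] by (simp add: Q_def Let_def)
  ultimately show ?thesis unfolding 1(1) 2(1) by simp
qed

text \<open>An additive endomorphism of the direct sum that preserves the subspace of all \<open>(j n, - \<mu> n)\<close> descends to the
  quotient. Scalar multiplication and both actions are of this form.\<close>

lemma Q_map:
  assumes a: "a \<in> carrier (xe_A E)" "m \<in> carrier N"
    and f: "\<And>a. a \<in> carrier (xe_A E) \<Longrightarrow> f a \<in> carrier (xe_A E)"
      "\<And>a a'. \<lbrakk>a \<in> carrier (xe_A E); a' \<in> carrier (xe_A E)\<rbrakk> \<Longrightarrow> f (vadd (xe_A E) a a') = vadd (xe_A E) (f a) (f a')"
    and g: "\<And>m. m \<in> carrier N \<Longrightarrow> g m \<in> carrier N"
      "\<And>m m'. \<lbrakk>m \<in> carrier N; m' \<in> carrier N\<rbrakk> \<Longrightarrow> g (vadd N m m') = vadd N (g m) (g m')"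
    and fg: "\<And>n. n \<in> carrier (xe_M E) \<Longrightarrow> \<exists>n'\<in>carrier (xe_M E). xe_j E n' = f (xe_j E n) \<and> \<mu> n' = g (\<mu> n)"
  shows "q (f (pr1 (q a m))) (g (pr2 (q a m))) = q (f a) (g m)"
proof -
  obtain x y where 1: "q a m = pr x y" "x \<in> carrier (xe_A E)" "y \<in> carrier N" "equivalent a m x y"
    by (rule q_representative[OF a])
  obtain n where n: "n \<in> carrier (xe_M E)" "a = vadd (xe_A E) x (xe_j E n)" "y = vadd N m (\<mu> n)"
    using 1 unfolding equivalent_def by blast
  obtain n' where n': "n' \<in> carrier (xe_M E)" "xe_j E n' = f (xe_j E n)" "\<mu> n' = g (\<mu> n)" using fg[OF n(1)] by blast
  have "equivalent (f a) (g m) (f x) (g y)"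
    unfolding equivalent_def
    by (rule bexI[OF _ n'(1)]) (use n n' 1 a in \<open>simp add: f g j_simps \<mu>_simps\<close>)
  then show ?thesis
    unfolding 1(1) pr_simps using q_eq[OF f(1)[OF a(1)] g(1)[OF a(2)] f(1)[OF 1(2)] g(1)[OF 1(3)]] by simp
qed

lemma Q_scale:
  assumes a: "a \<in> carrier (xe_A E)" "m \<in> carrier N"
  shows "vscale Q s (q a m) = q (vscale (xe_A E) s a) (vscale N s m)"
proof -
  have "q (vscale (xe_A E) s (pr1 (q a m))) (vscale N s (pr2 (q a m))) = q (vscale (xe_A E) s a) (vscale N s m)"
  proof (rule Q_map[OF a])
    show "\<exists>n'\<in>carrier (xe_M E). xe_j E n' = vscale (xe_A E) s (xe_j E n) \<and> \<mu> n' = vscale N s (\<mu> n)"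
      if "n \<in> carrier (xe_M E)" for n
      using that by (intro bexI[of _ "vscale (xe_M E) s n"]) (simp_all add: j_simps \<mu>_simps closed)
  qed (simp_all add: vspaceD(6,7)[OF A] vspaceD(6,7)[OF VN])
  then show ?thesis using Q_q[OF a] by (simp add: Q_def Let_def)
qed

lemma Q_l:
  assumes b: "b \<in> carrier (xe_B E)" and a: "a \<in> carrier (xe_A E)" "m \<in> carrier N"
  shows "lQ b (q a m) = q (xe_l E b a) (lact T (xe_p E b) m)"
proof -
  have "q (xe_l E b (pr1 (q a m))) (lact T (xe_p E b) (pr2 (q a m))) = q (xe_l E b a) (lact T (xe_p E b) m)"
    by (rule Q_map[OF a])
       (simp_all add: b l(1,2) lT(1,2) p_simps closed vspaceD(1)[OF VN], metis \<mu>_act[OF b])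
  then show ?thesis using b a by (simp add: lQ_def)
qed

lemma Q_r:
  assumes b: "b \<in> carrier (xe_B E)" and a: "a \<in> carrier (xe_A E)" "m \<in> carrier N"
  shows "rQ (q a m) b = q (xe_r E a b) (ract T m (xe_p E b))"
proof -
  have "q (xe_r E (pr1 (q a m)) b) (ract T (pr2 (q a m)) (xe_p E b)) = q (xe_r E a b) (ract T m (xe_p E b))"
    by (rule Q_map[OF a])
       (simp_all add: b r(1,4) rT(1,4) p_simps closed vspaceD(1)[OF VN], metis \<mu>_act'[OF b])
  then show ?thesis using b a by (simp add: rQ_def)
qed

lemma Q_d:
  assumes a: "a \<in> carrier (xe_A E)" "m \<in> carrier N"
  shows "dQ (q a m) = xe_d E a"
proof -
  obtain x y where 1: "q a m = pr x y" "x \<in> carrier (xe_A E)" "y \<in> carrier N" "equivalent a m x y"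
    by (rule q_representative[OF a])
  obtain n where "n \<in> carrier (xe_M E)" "a = vadd (xe_A E) x (xe_j E n)" "y = vadd N m (\<mu> n)"
    using 1 unfolding equivalent_def by blast
  then have "xe_d E a = xe_d E x" using 1(2) by (simp add: d_simps j_simps d_j vspaceD(12)[OF VB])
  then show ?thesis using Q_q[OF a] 1(1) by (simp add: dQ_def)
qed

lemma vspace_Q: "vspace Q"
proof (rule vspaceI)
  note S = Q_add Q_scale Q_zero closed vspaceD(1,4,6)[OF VN]
  fix x y z assume "x \<in> carrier Q" "y \<in> carrier Q" "z \<in> carrier Q"
  then show "vadd Q (vadd Q x y) z = vadd Q x (vadd Q y z)"
    by (elim Q_cases) (simp add: S vspaceD(2)[OF A] vspaceD(2)[OF VN])
next
  note S = Q_add Q_scale Q_zero closed vspaceD(1,4,6)[OF VN]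
  fix x y and s :: 'k assume x: "x \<in> carrier Q" "y \<in> carrier Q"
  then show "vadd Q x y \<in> carrier Q"
    by (elim Q_cases) (simp add: S)
  from x show "vadd Q x y = vadd Q y x"
    by (elim Q_cases) (simp add: S vspaceD(3)[OF A] vspaceD(3)[OF VN])
  from x show "vscale Q s (vadd Q x y) = vadd Q (vscale Q s x) (vscale Q s y)"
    by (elim Q_cases) (simp add: S vspaceD(7)[OF A] vspaceD(7)[OF VN])
next
  note S = Q_add Q_scale Q_zero closed vspaceD(1,4,6)[OF VN]
  fix x and s t :: 'k assume "x \<in> carrier Q"
  then show "vadd Q (vzero Q) x = x" "vscale Q s x \<in> carrier Q" "vscale Q 1 x = x" "vscale Q 0 x = vzero Q"
    "vscale Q (s + t) x = vadd Q (vscale Q s x) (vscale Q t x)" "vscale Q (s * t) x = vscale Q s (vscale Q t x)"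
    by (elim Q_cases; simp add: S vspaceD(5,8-10,14)[OF A] vspaceD(5,8-10,14)[OF VN])+
qed (auto simp: Q_zero closed vspaceD(4)[OF VN], auto simp: Q_def Let_def)

lemmas Q_ops = Q_add Q_scale Q_zero Q_l Q_r Q_d closed vspaceD(1,4,6)[OF VN]

lemma biaction_Q: "biaction (xe_B E) Q lQ rQ"
  unfolding biaction_def
proof (intro conjI ballI B vspace_Q)
  note S = Q_ops l r lT rT p_simps
  show "bilinear_op (xe_B E) Q Q lQ"
  proof (rule bilinear_opI[OF _ _ _ _ _ _ VB vspace_Q])
    fix b x y and s :: 'k assume "b \<in> carrier (xe_B E)" "x \<in> carrier Q" "y \<in> carrier Q"
    then show "lQ b (vadd Q x y) = vadd Q (lQ b x) (lQ b y)"
      by (elim Q_cases) (simp add: S)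
  next
    fix b c x and s :: 'k assume "b \<in> carrier (xe_B E)" "c \<in> carrier (xe_B E)" "x \<in> carrier Q"
    then show "lQ (vadd (xe_B E) b c) x = vadd Q (lQ b x) (lQ c x)"
      by (elim Q_cases) (simp add: S)
  next
    fix b x and s :: 'k assume "b \<in> carrier (xe_B E)" "x \<in> carrier Q"
    then show "lQ b x \<in> carrier Q" "lQ b (vscale Q s x) = vscale Q s (lQ b x)"
      "lQ (vscale (xe_B E) s b) x = vscale Q s (lQ b x)"
      by (elim Q_cases; simp add: S)+
  qed (auto simp: lQ_def)
  show "bilinear_op Q (xe_B E) Q rQ"
  proof (rule bilinear_opI[OF _ _ _ _ _ _ vspace_Q VB])
    fix b x y and s :: 'k assume "x \<in> carrier Q" "y \<in> carrier Q" "b \<in> carrier (xe_B E)" 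
    then show "rQ (vadd Q x y) b = vadd Q (rQ x b) (rQ y b)"
      by (elim Q_cases) (simp add: S)
  next
    fix b c x and s :: 'k assume "x \<in> carrier Q" "b \<in> carrier (xe_B E)" "c \<in> carrier (xe_B E)" 
    then show "rQ x (vadd (xe_B E) b c) = vadd Q (rQ x b) (rQ x c)"
      by (elim Q_cases) (simp add: S)
  next
    fix b x and s :: 'k assume "x \<in> carrier Q" "b \<in> carrier (xe_B E)" 
    then show "rQ x b \<in> carrier Q" "rQ (vscale Q s x) b = vscale Q s (rQ x b)"
      "rQ x (vscale (xe_B E) s b) = vscale Q s (rQ x b)"
      by (elim Q_cases; simp add: S)+
  qed (auto simp: rQ_def)
  fix x b b' assume "x \<in> carrier Q" "b \<in> carrier (xe_B E)" "b' \<in> carrier (xe_B E)" 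
  then show "rQ x (amult (xe_B E) b b') = rQ (rQ x b) b'" "lQ (amult (xe_B E) b b') x = lQ b (lQ b' x)"
    "rQ (lQ b x) b' = lQ b (rQ x b')"
    by (elim Q_cases; simp add: S actions biactionD(6-8)[OF actT])+
qed

text \<open>The Peiffer identity holds because \<open>d\<close> ignores the summand \<open>N\<close> and elements of the image of \<open>d\<close> act as
  zero on \<open>N\<close>.\<close>

lemma precrossed_Q: "precrossed (xe_B E) Q lQ rQ dQ"
  unfolding precrossed_def
proof (intro conjI ballI biaction_Q)
  note S = Q_ops l(1) r(1) lT(1) rT(1) p_simps d_simps
  show "dQ \<in> linear_maps Q (xe_B E)"
  proof (rule linear_mapsI)
    fix x y assume "x \<in> carrier Q" "y \<in> carrier Q"
    then show "dQ (vadd Q x y) = vadd (xe_B E) (dQ x) (dQ y)" by (elim Q_cases) (simp add: S)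
  next
    fix x s assume "x \<in> carrier Q"
    then show "dQ x \<in> carrier (xe_B E)" "dQ (vscale Q s x) = vscale (xe_B E) s (dQ x)"
      by (elim Q_cases; simp add: S)+
  qed (simp add: dQ_def)
  fix x b assume "x \<in> carrier Q" "b \<in> carrier (xe_B E)"
  then show "dQ (lQ b x) = amult (xe_B E) b (dQ x)" "dQ (rQ x b) = amult (xe_B E) (dQ x) b"
    by (elim Q_cases; simp add: S)+
next
  note S = Q_ops l(1) r(1) lT(1) rT(1) p_simps d_simps
  fix x y assume "x \<in> carrier Q" "y \<in> carrier Q"
  then show "lQ (dQ x) y = rQ x (dQ y)"
    by (elim Q_cases) (simp add: S p_d peiffer bilinear_op_zero[OF biactionD(3)[OF actT] VC VN VN]
      bilinear_op_zero[OF biactionD(4)[OF actT] VN VC VN])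
qed

definition jQ where "jQ = (\<lambda>m\<in>carrier N. q (vzero (xe_A E)) m)"

text \<open>This is commutativity of the pushout square. It also shows that the class of a pair with first component
  in the kernel of \<open>d\<close> comes from \<open>N\<close>.\<close>

lemma q_j: "n \<in> carrier (xe_M E) \<Longrightarrow> m \<in> carrier N \<Longrightarrow>
   q (xe_j E n) m = q (vzero (xe_A E)) (vadd N m (\<mu> n))"
  by (subst q_eq) (auto simp: j_simps \<mu>_simps closed vspaceD(1)[OF VN] vspaceD(5)[OF A] equivalent_def)

lemma sequence_Q: "crossed_sequence N Q (xe_B E) (xe_C E) lQ rQ jQ dQ (xe_p E)"
proof
  show "jQ \<in> linear_maps N Q"
    by (rule linear_mapsI) (simp_all add: jQ_def Q_ops vspaceD(5,17)[OF A])
  show "exact_seq N Q (xe_B E) (xe_C E) jQ dQ (xe_p E)"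
    unfolding exact_seq_def
  proof (intro conjI equalityI subsetI)
    show "inj_on jQ (carrier N)"
    proof (rule inj_onI)
      fix m m' assume m: "m \<in> carrier N" "m' \<in> carrier N" "jQ m = jQ m'"
      then have "equivalent (vzero (xe_A E)) m (vzero (xe_A E)) m'"
        by (subst q_eq[symmetric]) (simp_all add: jQ_def closed)
      then obtain n where n: "n \<in> carrier (xe_M E)" "vzero (xe_A E) = vadd (xe_A E) (vzero (xe_A E)) (xe_j E n)"
        "m' = vadd N m (\<mu> n)" unfolding equivalent_def by blast
      then have "xe_j E n = xe_j E (vzero (xe_M E))" by (simp add: vspaceD(5)[OF A] j_simps)
      then have "n = vzero (xe_M E)" using n(1) by (simp add: j_eq closed)
      then show "m = m'" using n m by (simp add: \<mu>_simps vspaceD(12)[OF VN])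
    qed
    show "x \<in> kernel_of Q (xe_B E) dQ" if x: "x \<in> jQ ` carrier N" for x
      using x by (auto simp: jQ_def kernel_of_def Q_ops d_simps)
    show "x \<in> jQ ` carrier N" if x: "x \<in> kernel_of Q (xe_B E) dQ" for x
    proof -
      have xQ: "x \<in> carrier Q" and dx: "dQ x = vzero (xe_B E)" using x by (auto simp: kernel_of_def)
      obtain a m where am: "x = q a m" "a \<in> carrier (xe_A E)" "m \<in> carrier N" by (rule Q_cases[OF xQ])
      obtain n where n: "n \<in> carrier (xe_M E)" "a = xe_j E n" using ker_d[of a] am dx Q_d by auto
      show ?thesis
        using am n q_j[OF n(1) am(3)] by (intro image_eqI[of _ _ "vadd N m (\<mu> n)"])
          (simp_all add: jQ_def \<mu>_simps vspaceD(1)[OF VN])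
    qed
    show "x \<in> kernel_of (xe_B E) (xe_C E) (xe_p E)" if x: "x \<in> dQ ` carrier Q" for x
      using x by (auto simp: kernel_of_def Q_d d_simps p_d elim!: Q_cases)
    show "x \<in> dQ ` carrier Q" if x: "x \<in> kernel_of (xe_B E) (xe_C E) (xe_p E)" for x
    proof -
      obtain a where a: "a \<in> carrier (xe_A E)" "x = xe_d E a" using x ker_p[of x] by (auto simp: kernel_of_def)
      then show ?thesis by (intro image_eqI[of _ _ "q a (vzero N)"]) (simp_all add: Q_ops)
    qed
    show "c \<in> carrier (xe_C E)" if "c \<in> xe_p E ` carrier (xe_B E)" for c using that by (auto simp: p_simps)
    show "c \<in> xe_p E ` carrier (xe_B E)" if "c \<in> carrier (xe_C E)" for c using p_surj[OF that] by blast
  qed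
qed (rule VN C precrossed_Q p)+

definition pushout_xext :: "('k, 'u) xext" where
  "pushout_xext = \<lparr>xe_M = N,
     xe_act = \<lparr>acting = xe_B E, acted = with_mult Q (\<lambda>x y. lQ (dQ x) y), lact = lQ, ract = rQ\<rparr>,
     xe_C = xe_C E, xe_j = jQ, xe_d = dQ, xe_p = xe_p E\<rparr>"

definition pushout_map :: "'u maps4" where
  "pushout_map = (id_map (xe_C E), id_map (xe_B E), (\<lambda>a\<in>carrier (xe_A E). q a (vzero N)), \<mu>)"

lemma pushout_simps [simp]:
  "xe_M pushout_xext = N" "xe_B pushout_xext = xe_B E" "xe_C pushout_xext = xe_C E"
  "xe_A pushout_xext = with_mult Q (\<lambda>x y. lQ (dQ x) y)" "xe_l pushout_xext = lQ" "xe_r pushout_xext = rQ"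
  "xe_j pushout_xext = jQ" "xe_d pushout_xext = dQ" "xe_p pushout_xext = xe_p E"
  by (simp_all add: pushout_xext_def)

lemma is_xext_pushout: "is_xext pushout_xext"
  unfolding is_xext_iff pushout_simps
  using sequence_Q is_moduleD(2)[OF T]
  by (simp add: crossed_sequence_def has_mult_def) (simp add: exact_seq_def kernel_of_def)

lemma induced_module_pushout: "induced_module pushout_xext = T"
proof (rule induced_module_eqI[OF is_xextD(1)[OF is_xext_pushout]])
  show "crossed_sequence.induced (xe_M pushout_xext) (xe_B pushout_xext) (xe_C pushout_xext) (xe_l pushout_xext)
     (xe_r pushout_xext) (xe_j pushout_xext) (xe_p pushout_xext) (lact T) (ract T)"
    unfolding crossed_sequence.induced_def[OF is_xextD(1)[OF is_xext_pushout]]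
    unfolding pushout_simps
    by (auto simp: lT(1,6) rT(1,6) p_simps jQ_def Q_ops l_zero r_zero bilinear_op_zero[OF biactionD(3)[OF act] VB A A]
      bilinear_op_zero[OF biactionD(4)[OF act] A VB A])
qed (simp_all add: acting_T)

lemma pushout_map: "pushout_map \<in> xext_maps E pushout_xext"
  unfolding pushout_map_def xext_maps_iff[OF E is_xext_pushout] pushout_simps
proof (intro conjI ballI)
  show "(\<lambda>a\<in>carrier (xe_A E). q a (vzero N)) \<in> linear_maps (xe_A E) (with_mult Q (\<lambda>x y. lQ (dQ x) y))"
    unfolding linear_maps_with_mult
    by (rule linear_mapsI) (simp_all add: Q_ops vspaceD(5,17)[OF VN])
  show "action_compatible (xe_act E) (xe_act pushout_xext) (id_map (xe_B E)) (\<lambda>a\<in>carrier (xe_A E). q a (vzero N))"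
    unfolding action_compatible_def pushout_simps
    by (auto simp: Q_ops l(1) r(1) p_simps bilinear_op_zero[OF biactionD(3)[OF actT] VC VN VN]
      bilinear_op_zero[OF biactionD(4)[OF actT] VN VC VN])
  show "(\<lambda>a\<in>carrier (xe_A E). q a (vzero N)) (xe_j E n) = jQ (\<mu> n)" if "n \<in> carrier (xe_M E)" for n
    using that q_j[OF that, of "vzero N"] by (simp add: j_simps jQ_def \<mu>_simps vspaceD(4,5)[OF VN])
qed (simp_all add: C B id_map_algebra \<mu>_linear Q_ops d_simps p_simps)

text \<open>A comparison map out of the pushout agrees with \<open>\<beta>\<close> on \<open>B\<close> and with the given \<open>\<nu>\<close> on \<open>N\<close>. On the quotient it
  has to be \<open>\<alpha> a + j (\<nu> m)\<close> at the class of \<open>(a, m)\<close>, which is well defined since \<open>\<alpha> (j n) = j (\<nu> (\<mu> n))\<close>.\<close>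

lemma opcartesian_pushout_map:
  "vertical_opcartesian_hom {E. is_xext E} xext_maps xext_compose (acting \<circ> induced_module)
     (fst \<circ> ends) id_map module_maps module_compose induced_module
     ends fst E pushout_xext pushout_map"
  unfolding vertical_opcartesian_hom_def
proof (intro ballI impI)
  fix Z h w assume Z0: "Z \<in> {E. is_xext E}" and h0: "h \<in> xext_maps E Z"
    and w0: "w \<in> module_maps (induced_module pushout_xext) (induced_module Z)"
    and C0: "(acting \<circ> induced_module) Z = (acting \<circ> induced_module) E"
    and hi: "(fst \<circ> ends) h = id_map ((acting \<circ> induced_module) E)"
    and wi: "fst w = id_map ((acting \<circ> induced_module) E)"
    and wh: "module_compose (induced_module E) w (ends pushout_map) = ends h"
  have Z: "is_xext Z" using Z0 by simp
  interpret Z: crossed_sequence "xe_M Z" "xe_A Z" "xe_B Z" "xe_C Z" "xe_l Z" "xe_r Z" "xe_j Z" "xe_d Z" "xe_p Z"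
    by (rule is_xextD(1)[OF Z])
  have CZ: "xe_C Z = xe_C E" using C0 by simp
  obtain \<beta> \<alpha> \<kappa> where h: "h = (id_map (xe_C E), \<beta>, \<alpha>, \<kappa>)" using hi by (cases h) simp
  obtain \<nu> where w: "w = (id_map (xe_C E), \<nu>)" using wi by (cases w) simp
  have \<nu>\<mu>: "compose (carrier (xe_M E)) \<nu> \<mu> = \<kappa>" using wh by (simp add: w h pushout_map_def)
  have f: "\<beta> \<in> algebra_maps (xe_B E) (xe_B Z)" "\<alpha> \<in> linear_maps (xe_A E) (xe_A Z)"
    "\<kappa> \<in> linear_maps (xe_M E) (xe_M Z)"
    "\<forall>m\<in>carrier (xe_M E). \<alpha> (xe_j E m) = xe_j Z (\<kappa> m)"
    "\<forall>a\<in>carrier (xe_A E). \<beta> (xe_d E a) = xe_d Z (\<alpha> a)"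
    "\<forall>b\<in>carrier (xe_B E). id_map (xe_C E) (xe_p E b) = xe_p Z (\<beta> b)"
    "action_compatible (xe_act E) (xe_act Z) \<beta> \<alpha>"
    using h0 unfolding h xext_maps_iff[OF E Z] by simp_all
  have w1: "\<nu> \<in> linear_maps N (xe_M Z)" "action_compatible T (induced_module Z) (id_map (xe_C E)) \<nu>"
    using w0 unfolding w induced_module_pushout module_maps_iff[OF T is_module_induced[OF Z]] by simp_all
  note as = linear_mapsD(1-3)[OF f(2)] linear_maps_zero[OF f(2) A Z.A]
  note ns = linear_mapsD(1-3)[OF w1(1)] linear_maps_zero[OF w1(1) VN Z.M]
  note bs = algebra_mapsD(2)[OF f(1)]
  have pb: "xe_p E b = xe_p Z (\<beta> b)" if "b \<in> carrier (xe_B E)" for b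
    using f(6)[rule_format, OF that] p_simps(1)[OF that] by simp
  have \<nu>l: "xe_j Z (\<nu> (lact T (xe_p E b) m)) = xe_l Z (\<beta> b) (xe_j Z (\<nu> m))"
    and \<nu>r: "xe_j Z (\<nu> (ract T m (xe_p E b))) = xe_r Z (xe_j Z (\<nu> m)) (\<beta> b)"
    if b: "b \<in> carrier (xe_B E)" and m: "m \<in> carrier N" for b m
    using w1(2)[unfolded action_compatible_def acting_T, rule_format, OF p_simps(1)[OF b] m]
      induced_moduleD(2,4)[OF is_xextD(1)[OF Z] bs[OF b] ns(1)[OF m]] p_simps(1)[OF b]
    unfolding pb[OF b, symmetric] by simp_all
  define \<phi> where "\<phi> = (\<lambda>x\<in>carrier Q. vadd (xe_A Z) (\<alpha> (pr1 x)) (xe_j Z (\<nu> (pr2 x))))"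
  have aq: "\<phi> (q a m) = vadd (xe_A Z) (\<alpha> a) (xe_j Z (\<nu> m))" if a: "a \<in> carrier (xe_A E)" "m \<in> carrier N" for a m
  proof -
    obtain x y where 1: "q a m = pr x y" "x \<in> carrier (xe_A E)" "y \<in> carrier N" "equivalent a m x y"
      by (rule q_representative[OF a])
    obtain n where n: "n \<in> carrier (xe_M E)" "a = vadd (xe_A E) x (xe_j E n)" "y = vadd N m (\<mu> n)"
      using 1 unfolding equivalent_def by blast
    have "\<kappa> n = \<nu> (\<mu> n)" using compose_eqD[OF \<nu>\<mu> n(1)] by simp
    then have "vadd (xe_A Z) (\<alpha> a) (xe_j Z (\<nu> m)) = vadd (xe_A Z) (\<alpha> x) (xe_j Z (\<nu> y))"
      using f(4) n a 1 by (simp add: as ns j_simps \<mu>_simps Z.j_simps vspaceD(2,3,11)[OF Z.A] Z.closed)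
    then show ?thesis using Q_q[OF a] 1(1) by (simp add: \<phi>_def)
  qed
  have a: "\<phi> \<in> linear_maps Q (xe_A Z)"
  proof (rule linear_mapsI)
    fix x y assume "x \<in> carrier Q" "y \<in> carrier Q"
    then show "\<phi> (vadd Q x y) = vadd (xe_A Z) (\<phi> x) (\<phi> y)"
      by (elim Q_cases) (simp add: aq Q_ops as ns Z.j_simps Z.closed vspaceD(2,3,11)[OF Z.A])
  next
    fix x s assume "x \<in> carrier Q"
    then show "\<phi> x \<in> carrier (xe_A Z)" "\<phi> (vscale Q s x) = vscale (xe_A Z) s (\<phi> x)"
      by (elim Q_cases; simp add: aq Q_ops as ns Z.j_simps Z.closed vspaceD(7)[OF Z.A])+
  qed (simp add: \<phi>_def)
  have g: "(id_map (xe_C E), \<beta>, \<phi>, \<nu>) \<in> xext_maps pushout_xext Z"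
    unfolding xext_maps_iff[OF is_xext_pushout Z] pushout_simps linear_maps_with_mult
  proof (intro conjI f(1) a w1(1) ballI)
    show "id_map (xe_C E) \<in> algebra_maps (xe_C E) (xe_C Z)" by (simp add: CZ id_map_algebra C)
    show "\<phi> (jQ m) = xe_j Z (\<nu> m)" if "m \<in> carrier N" for m
    proof -
      have "jQ m = q (vzero (xe_A E)) m" using that by (simp add: jQ_def)
      then show ?thesis
        using that by (simp only: aq[OF vspaceD(4)[OF A] that]) (simp add: as ns Z.j_simps vspaceD(5)[OF Z.A])
    qed
    show "\<beta> (dQ x) = xe_d Z (\<phi> x)" if x: "x \<in> carrier (with_mult Q (\<lambda>x y. lQ (dQ x) y))" for x
    proof -
      obtain a m where am: "x = q a m" "a \<in> carrier (xe_A E)" "m \<in> carrier N"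
        by (rule Q_cases'[OF x])
      show ?thesis
        unfolding am(1) aq[OF am(2,3)] using am f(5)
        by (simp add: Q_d Z.d_simps as ns Z.j_simps Z.d_j vspaceD(12)[OF Z.VB])
    qed
    show "id_map (xe_C E) (xe_p E b) = xe_p Z (\<beta> b)" if "b \<in> carrier (xe_B E)" for b using f(6) that by simp
    show "action_compatible (xe_act pushout_xext) (xe_act Z) \<beta> \<phi>"
      unfolding action_compatible_def pushout_simps
    proof (intro ballI)
      fix b x assume b: "b \<in> carrier (xe_B E)" and x: "x \<in> carrier (with_mult Q (\<lambda>x y. lQ (dQ x) y))"
      obtain a m where am: "x = q a m" "a \<in> carrier (xe_A E)" "m \<in> carrier N"
        by (rule Q_cases'[OF x])
      note fa = f(7)[unfolded action_compatible_def, rule_format, OF b am(2)]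
      have cl: "xe_l E b a \<in> carrier (xe_A E)" "xe_r E a b \<in> carrier (xe_A E)"
        "lact T (xe_p E b) m \<in> carrier N" "ract T m (xe_p E b) \<in> carrier N"
        using b am by (simp_all add: l(1) r(1) lT(1) rT(1) p_simps)
      show "\<phi> (lQ b x) = xe_l Z (\<beta> b) (\<phi> x) \<and> \<phi> (rQ x b) = xe_r Z (\<phi> x) (\<beta> b)"
        unfolding am(1) Q_l[OF b am(2,3)] Q_r[OF b am(2,3)] aq[OF am(2,3)] aq[OF cl(1,3)] aq[OF cl(2,4)]
          \<nu>l[OF b am(3)] \<nu>r[OF b am(3)]
        using fa b am by (simp add: Z.l(2) Z.r(4) as bs ns Z.j_simps Z.closed)
    qed
  qed
  show "\<exists>!g. g \<in> xext_maps pushout_xext Z \<and> ends g = w \<and> xext_compose E g pushout_map = h"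
  proof (intro ex1I[of _ "(id_map (xe_C E), \<beta>, \<phi>, \<nu>)"] conjI)
    show "(id_map (xe_C E), \<beta>, \<phi>, \<nu>) \<in> xext_maps pushout_xext Z" by (rule g)
    show "ends (id_map (xe_C E), \<beta>, \<phi>, \<nu>) = w" by (simp add: w)
    have am: "(\<lambda>a\<in>carrier (xe_A E). q a (vzero N)) \<in> linear_maps (xe_A E) Q"
      using pushout_map unfolding pushout_map_def xext_maps_iff[OF E is_xext_pushout] by simp
    have "compose (carrier (xe_A E)) \<phi> (\<lambda>a\<in>carrier (xe_A E). q a (vzero N)) = \<alpha>"
      by (rule linear_maps_eqI[OF linear_maps_compose[OF am a A] f(2)])
         (simp add: aq as ns Z.j_simps vspaceD(12)[OF Z.A] vspaceD(4)[OF VN])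
    then show "xext_compose E (id_map (xe_C E), \<beta>, \<phi>, \<nu>) pushout_map = h"
      unfolding pushout_map_def h
      by (simp add: \<nu>\<mu> linear_maps_compose_id(1)[OF algebra_mapsD(1)[OF f(1)]]
        linear_maps_compose_id(1)[OF id_map_linear[OF VC]])
    fix g assume g0: "g \<in> xext_maps pushout_xext Z \<and> ends g = w \<and> xext_compose E g pushout_map = h"
    obtain \<beta>' \<alpha>' where gg: "g = (id_map (xe_C E), \<beta>', \<alpha>', \<nu>)" using g0 by (cases g) (auto simp: w)
    have g1: "(id_map (xe_C E), \<beta>', \<alpha>', \<nu>) \<in> xext_maps pushout_xext Z"
      "compose (carrier (xe_B E)) \<beta>' (id_map (xe_B E)) = \<beta>"
      "compose (carrier (xe_A E)) \<alpha>' (\<lambda>a\<in>carrier (xe_A E). q a (vzero N)) = \<alpha>"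
      using g0 unfolding gg h pushout_map_def by simp_all
    have g2: "\<beta>' \<in> algebra_maps (xe_B E) (xe_B Z)" "\<alpha>' \<in> linear_maps Q (xe_A Z)"
      "\<forall>m\<in>carrier N. \<alpha>' (jQ m) = xe_j Z (\<nu> m)"
      using g1(1) unfolding xext_maps_iff[OF is_xext_pushout Z] by simp_all
    have "\<beta>' = \<beta>" using g1(2) linear_maps_compose_id(1)[OF algebra_mapsD(1)[OF g2(1)]] by simp
    moreover have "\<alpha>' = \<phi>"
    proof (rule linear_maps_eqI[OF g2(2) a])
      fix x assume "x \<in> carrier Q"
      then obtain a m where am: "x = q a m" "a \<in> carrier (xe_A E)" "m \<in> carrier N" by (rule Q_cases)
      have x: "x = vadd Q (q a (vzero N)) (jQ m)"
        using am by (simp add: jQ_def Q_ops vspaceD(5)[OF VN] vspaceD(12)[OF A])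
      have jm: "jQ m \<in> carrier Q" using am by (simp add: jQ_def closed)
      have "\<alpha>' x = vadd (xe_A Z) (\<alpha>' (q a (vzero N))) (\<alpha>' (jQ m))"
        unfolding x using linear_mapsD(2)[OF g2(2) _ jm] am by (simp add: vspaceD(4)[OF VN])
      also have "\<dots> = vadd (xe_A Z) (\<alpha> a) (xe_j Z (\<nu> m))"
        using compose_eqD[OF g1(3) am(2)] g2(3) am by simp
      also have "\<dots> = \<phi> x" unfolding am(1) by (rule aq[OF am(2,3), symmetric])
      finally show "\<alpha>' x = \<phi> x" .
    qed
    ultimately show "g = (id_map (xe_C E), \<beta>, \<phi>, \<nu>)" using gg by simp
  qed
qed

end

section \<open>Unital algebras, bimodules and crossed biextensions\<close>

lemma unit_of_eqI:
  assumes "is_unit_of A e"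
  shows "unit_of A = e"
  unfolding unit_of_def
  using assms by (rule the_equality) (use assms in \<open>unfold is_unit_of_def, metis\<close>)

lemma unital_algebraD:
  assumes "unital_algebra A"
  shows "assoc_algebra A" "unit_of A \<in> carrier A"
    "x \<in> carrier A \<Longrightarrow> amult A (unit_of A) x = x" "x \<in> carrier A \<Longrightarrow> amult A x (unit_of A) = x"
proof -
  obtain e where "is_unit_of A e" using assms by (auto simp: unital_algebra_def)
  with unit_of_eqI[OF this] have "is_unit_of A (unit_of A)" by simp
  then show "unit_of A \<in> carrier A"
    "x \<in> carrier A \<Longrightarrow> amult A (unit_of A) x = x" "x \<in> carrier A \<Longrightarrow> amult A x (unit_of A) = x"
    by (simp_all add: is_unit_of_def)
  show "assoc_algebra A" using assms by (simp add: unital_algebra_def)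
qed

lemma unital_mapsD:
  assumes "f \<in> unital_maps A B"
  shows "f \<in> algebra_maps A B" "f (unit_of A) = unit_of B"
  using assms by (simp_all add: unital_maps_def)

lemma unital_maps_compose:
  "\<lbrakk>f \<in> unital_maps U V; g \<in> unital_maps V W; unital_algebra U\<rbrakk> \<Longrightarrow> compose (carrier U) g f \<in> unital_maps U W"
  using algebra_maps_compose[of f U V g W] unital_algebraD(1,2)[of U] by (simp add: unital_maps_def)

lemma id_map_unital: "unital_algebra A \<Longrightarrow> id_map A \<in> unital_maps A A"
  using id_map_algebra[of A] unital_algebraD(1,2)[of A] by (simp add: unital_maps_def)

lemma embedding_AssAlg1: "embedding AssAlg1 AssAlg incl_AssAlg1"
  unfolding AssAlg1_def AssAlg_def incl_AssAlg1_def
  by (rule concrete_subcategory[OF category_AssAlg[unfolded AssAlg_def]]; (elim CollectE)?; simp?)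
     (auto simp: unital_algebraD(1) id_map_unital intro: unital_maps_compose unital_mapsD(1))

lemmas category_AssAlg1 = embedding_category[OF embedding_AssAlg1]

definition unital_action :: "('k, 'u) alg \<Rightarrow> 'u set \<Rightarrow> ('u \<Rightarrow> 'u \<Rightarrow> 'u) \<Rightarrow> ('u \<Rightarrow> 'u \<Rightarrow> 'u) \<Rightarrow> bool" where
  "unital_action B S l r \<longleftrightarrow> (\<forall>a\<in>S. l (unit_of B) a = a \<and> r a (unit_of B) = a)"

lemma is_bimodule_iff:
  "is_bimodule X \<longleftrightarrow> unital_algebra (bm_alg X) \<and> biaction (bm_alg X) (bm_space X) (bm_l X) (bm_r X) \<and>
     unital_action (bm_alg X) (carrier (bm_space X)) (bm_l X) (bm_r X)"
  unfolding is_bimodule_def biaction_def unital_action_def Let_def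
  using unital_algebraD(1)[of "bm_alg X"] by (intro iffI; elim conjE; intro conjI; blast?)

lemma bimod_to_module_simps [simp]:
  "acting (bimod_to_module X) = bm_alg X" "acted (bimod_to_module X) = zero_mult (bm_space X)"
  "lact (bimod_to_module X) = bm_l X" "ract (bimod_to_module X) = bm_r X"
  by (simp_all add: bimod_to_module_def)

lemma has_mult_zero_mult: "has_mult (zero_mult V) (\<lambda>_ _. vzero V)"
  by (simp add: has_mult_def zero_mult_def)

lemma is_module_bimod: "is_bimodule X \<Longrightarrow> is_module (bimod_to_module X)"
  using has_mult_zero_mult[of "bm_space X"] by (simp add: is_bimodule_iff is_module_iff)

text \<open>Inverse to \<open>bimod_to_module\<close> on modules whose action is unital.\<close>

definition module_to_bimod :: "('k, 'u) action \<Rightarrow> ('k, 'u) bimod" where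
  "module_to_bimod T = \<lparr>bm_alg = acting T, bm_space = vect.truncate (acted T), bm_l = lact T, bm_r = ract T\<rparr>"

lemma module_to_bimod_inverse [simp]:
  fixes X :: "('k::field, 'u) bimod"
  shows "module_to_bimod (bimod_to_module X) = X"
  by (simp add: module_to_bimod_def)

lemma bimod_to_module_inverse:
  assumes "is_module T"
  shows "bimod_to_module (module_to_bimod T) = T"
  using is_moduleD(2)[OF assms] unfolding has_mult_iff_with_mult
  by (simp add: module_to_bimod_def bimod_to_module_def zero_mult_def)

lemma is_bimodule_module_to_bimod:
  "\<lbrakk>is_module T; unital_algebra (acting T); unital_action (acting T) (carrier (acted T)) (lact T) (ract T)\<rbrakk> \<Longrightarrow>
    is_bimodule (module_to_bimod T)"
  using is_moduleD(1)[of T] by (simp add: is_bimodule_iff module_to_bimod_def)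

text \<open>Between bimodules, a map of modules is a map of bimodules as soon as its base component preserves the unit,
  because the linear component is multiplicative for the zero products.\<close>

lemma bimod_maps_iff:
  assumes "is_bimodule X" "is_bimodule Y"
  shows "f \<in> bimod_maps X Y \<longleftrightarrow>
    f \<in> module_maps (bimod_to_module X) (bimod_to_module Y) \<and> fst f \<in> unital_maps (bm_alg X) (bm_alg Y)"
  using module_maps_iff[OF is_module_bimod[OF assms(1)] is_module_bimod[OF assms(2)], of "fst f" "snd f"]
    unital_mapsD(1)[of "fst f" "bm_alg X" "bm_alg Y"]
  by (cases f) (auto simp: bimod_maps_def bimod_compatible_def action_compatible_def)

lemma embedding_Bimod: "embedding Bimod ModAssAlg incl_Bimod"
  unfolding Bimod_def ModAssAlg_def incl_Bimod_def
proof (rule concrete_subcategory[OF category_ModAssAlg[unfolded ModAssAlg_def]]; (elim CollectE)?)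
  show "inj_on bimod_to_module {X. is_bimodule X}"
    by (rule inj_on_inverseI[of _ module_to_bimod]) simp
  fix X :: "('k::field, 'u) bimod" assume X: "is_bimodule X"
  show m: "bimod_to_module X \<in> {T. is_module T}" using is_module_bimod[OF X] by simp
  have U: "unital_algebra (bm_alg X)" using X by (simp add: is_bimodule_iff)
  show "(id_map (bm_alg X), id_map (bm_space X)) \<in> bimod_maps X X"
    using X id_map_unital[OF U] category_concreteD(1)[OF category_ModAssAlg[unfolded ModAssAlg_def] m]
    by (simp add: bimod_maps_iff id_map_def)
  fix Y assume Y: "is_bimodule (Y :: ('k::field, 'u) bimod)"
  show "bimod_maps X Y \<subseteq> module_maps (bimod_to_module X) (bimod_to_module Y)"
    using bimod_maps_iff[OF X Y] by blast
  fix Z :: "('k::field, 'u) bimod" and f g assume Z: "is_bimodule Z" and fg: "f \<in> bimod_maps X Y" "g \<in> bimod_maps Y Z"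
  show "module_compose (bimod_to_module X) g f \<in> bimod_maps X Z"
    using fg category_concreteD(2)[OF category_ModAssAlg[unfolded ModAssAlg_def] m, of "bimod_to_module Y" "bimod_to_module Z" f g]
      is_module_bimod[OF Y] is_module_bimod[OF Z] unital_maps_compose[OF _ _ U, of "fst f" "bm_alg Y" "fst g" "bm_alg Z"]
    unfolding bimod_maps_iff[OF X Y] bimod_maps_iff[OF Y Z] bimod_maps_iff[OF X Z]
    by (simp add: case_prod_unfold)
qed (simp_all add: id_map_def)

lemmas category_Bimod = embedding_category[OF embedding_Bimod]

abbreviation bimod_compose where
  "bimod_compose \<equiv> (\<lambda>X (\<gamma>', \<mu>') (\<gamma>, \<mu>). (compose (carrier (bm_alg X)) \<gamma>' \<gamma>,
     compose (carrier (bm_space X)) \<mu>' \<mu>))"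

abbreviation xb_l where "xb_l E \<equiv> bm_l (xb_BA E)"
abbreviation xb_r where "xb_r E \<equiv> bm_r (xb_BA E)"

abbreviation xbiext_sequence where
  "xbiext_sequence E \<equiv> crossed_sequence (xb_M E) (xb_A E) (xb_B E) (xb_C E) (xb_l E) (xb_r E) (xb_j E) (xb_d E) (xb_p E)"

text \<open>The bimodule structure on \<open>M\<close>, although part of the data, is the induced one.\<close>

lemma is_xbiext_iff:
  "is_xbiext E \<longleftrightarrow> is_bimodule (xb_CM E) \<and> xbiext_sequence E \<and>
     crossed_sequence.induced (xb_M E) (xb_B E) (xb_C E) (xb_l E) (xb_r E) (xb_j E) (xb_p E)
       (bm_l (xb_CM E)) (bm_r (xb_CM E)) \<and>
     unital_algebra (xb_B E) \<and> xb_p E \<in> unital_maps (xb_B E) (xb_C E) \<and>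
     unital_action (xb_B E) (carrier (xb_A E)) (xb_l E) (xb_r E)"
  (is "?L \<longleftrightarrow> ?R")
proof
  assume L: ?L
  have bm: "is_bimodule (xb_CM E)" "is_bimodule (xb_BA E)" and up: "xb_p E \<in> unital_maps (xb_B E) (xb_C E)"
    using L by (simp_all add: is_xbiext_def is_crossed_bimodule_def Let_def)
  note CM = bm(1)[unfolded is_bimodule_iff] and BA = bm(2)[unfolded is_bimodule_iff]
  have seq: "xbiext_sequence E"
    unfolding crossed_sequence_def precrossed_def
    using L CM BA unital_mapsD(1)[OF up] unital_algebraD(1)[of "xb_C E"] biactionD(2)[of "xb_C E" "xb_M E" "bm_l (xb_CM E)" "bm_r (xb_CM E)"]
    by (simp add: is_xbiext_def is_crossed_bimodule_def Let_def)
  then interpret crossed_sequence "xb_M E" "xb_A E" "xb_B E" "xb_C E" "xb_l E" "xb_r E" "xb_j E" "xb_d E" "xb_p E" .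
  note l' = bilinear_opD(1,6)[OF biactionD(3)[of "xb_C E" "xb_M E" "bm_l (xb_CM E)" "bm_r (xb_CM E)"]]
  note r' = bilinear_opD(1,6)[OF biactionD(4)[of "xb_C E" "xb_M E" "bm_l (xb_CM E)" "bm_r (xb_CM E)"]]
  have "induced (bm_l (xb_CM E)) (bm_r (xb_CM E))"
    unfolding induced_def
    using L CM l' r' p_simps(1) by (auto simp: is_xbiext_def)
  then show ?R using bm seq up BA by simp
next
  assume R: ?R
  then interpret crossed_sequence "xb_M E" "xb_A E" "xb_B E" "xb_C E" "xb_l E" "xb_r E" "xb_j E" "xb_d E" "xb_p E"
    by simp
  have "is_bimodule (xb_BA E)" using R act by (simp add: is_bimodule_iff)
  then show ?L
    using R j d exact d_simps(5,6) peiffer unfolding induced_def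
    by (simp add: is_xbiext_def is_crossed_bimodule_def Let_def)
qed

lemma xbiext_to_xext_simps [simp]:
  "xe_M (xbiext_to_xext E) = zero_mult (xb_M E)" "xe_B (xbiext_to_xext E) = xb_B E"
  "xe_A (xbiext_to_xext E) = with_mult (xb_A E) (\<lambda>a1 a2. xb_l E (xb_d E a1) a2)"
  "xe_l (xbiext_to_xext E) = xb_l E" "xe_r (xbiext_to_xext E) = xb_r E" "xe_C (xbiext_to_xext E) = xb_C E"
  "xe_j (xbiext_to_xext E) = xb_j E" "xe_d (xbiext_to_xext E) = xb_d E" "xe_p (xbiext_to_xext E) = xb_p E"
  by (simp_all add: xbiext_to_xext_def)

lemma crossed_sequence_with_mult:
  "crossed_sequence (zero_mult V) (with_mult W g) B C l r j d p = crossed_sequence V W B C l r j d p"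
  "crossed_sequence (vect.truncate V') (vect.truncate W') B C l r j d p = crossed_sequence V' W' B C l r j d p"
  unfolding crossed_sequence_def by (simp_all add: zero_mult_def)

lemma sequence_xbiext: "is_xbiext E \<Longrightarrow> xext_sequence (xbiext_to_xext E)"
  unfolding xbiext_to_xext_simps crossed_sequence_with_mult is_xbiext_iff by blast

lemma is_xext_xbiext:
  assumes E: "is_xbiext E"
  shows "is_xext (xbiext_to_xext E)"
  unfolding is_xext_iff
proof (intro conjI sequence_xbiext[OF E])
  show "has_zero_mult (xe_M (xbiext_to_xext E))"
    using has_mult_zero_mult by (simp add: xbiext_to_xext_simps)
qed (simp add: has_mult_def)

lemma induced_module_xbiext:
  assumes E: "is_xbiext E"
  shows "induced_module (xbiext_to_xext E) = bimod_to_module (xb_CM E)"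
proof (rule induced_module_eqI[OF sequence_xbiext[OF E]])
  have R: "xbiext_sequence E" "crossed_sequence.induced (xb_M E) (xb_B E) (xb_C E) (xb_l E) (xb_r E) (xb_j E) (xb_p E)
       (bm_l (xb_CM E)) (bm_r (xb_CM E))" using E by (simp_all add: is_xbiext_iff)
  show "crossed_sequence.induced (xe_M (xbiext_to_xext E)) (xe_B (xbiext_to_xext E)) (xe_C (xbiext_to_xext E))
     (xe_l (xbiext_to_xext E)) (xe_r (xbiext_to_xext E)) (xe_j (xbiext_to_xext E)) (xe_p (xbiext_to_xext E))
     (lact (bimod_to_module (xb_CM E))) (ract (bimod_to_module (xb_CM E)))"
    using R(2) unfolding crossed_sequence.induced_def[OF sequence_xbiext[OF E]] crossed_sequence.induced_def[OF R(1)]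
    by simp
qed simp_all

text \<open>The image of \<open>xbiext_to_xext\<close>, with \<open>xext_to_xbiext\<close> as inverse. Membership is a property, so the
  constructions for crossed extensions can be reused once they are seen to preserve it.\<close>

definition unital_xext :: "('k::field, 'u) xext \<Rightarrow> bool" where
  "unital_xext E \<longleftrightarrow> is_xext E \<and> unital_algebra (xe_B E) \<and> unital_algebra (xe_C E) \<and>
     xe_p E \<in> unital_maps (xe_B E) (xe_C E) \<and>
     unital_action (xe_B E) (carrier (xe_A E)) (xe_l E) (xe_r E)"

definition xext_to_xbiext :: "('k, 'u) xext \<Rightarrow> ('k, 'u) xbiext" where
  "xext_to_xbiext E = \<lparr>xb_CM = module_to_bimod (induced_module E),
     xb_BA = \<lparr>bm_alg = xe_B E, bm_space = vect.truncate (xe_A E), bm_l = xe_l E, bm_r = xe_r E\<rparr>,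
     xb_j = xe_j E, xb_d = xe_d E, xb_p = xe_p E\<rparr>"

lemma unital_xext_xbiext: "is_xbiext E \<Longrightarrow> unital_xext (xbiext_to_xext E)"
  unfolding unital_xext_def using is_xext_xbiext[of E]
  by (simp add: is_xbiext_iff is_bimodule_iff)

lemma xext_to_xbiext_inverse: "is_xbiext E \<Longrightarrow> xext_to_xbiext (xbiext_to_xext E) = E"
  by (simp add: xext_to_xbiext_def induced_module_xbiext)

lemma xbiext_to_xext_inverse:
  assumes "is_xext E"
  shows "xbiext_to_xext (xext_to_xbiext E) = E"
proof -
  have A: "with_mult (vect.truncate (xe_A E)) (\<lambda>a a'. xe_l E (xe_d E a) a') = xe_A E"
    using is_xextD(2)[OF assms] unfolding has_mult_iff_with_mult by simp
  have M: "zero_mult (vect.truncate (xe_M E)) = xe_M E"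
    using is_xextD(3)[OF assms] unfolding has_mult_iff_with_mult by (simp add: zero_mult_def)
  show ?thesis
    by (simp add: xext_to_xbiext_def xbiext_to_xext_def module_to_bimod_def A M)
qed

lemma unital_induced_module:
  assumes "unital_xext E"
  shows "is_bimodule (module_to_bimod (induced_module E))"
proof (rule is_bimodule_module_to_bimod)
  have E: "is_xext E" and up: "xe_p E \<in> unital_maps (xe_B E) (xe_C E)" and UB: "unital_algebra (xe_B E)"
    and UC: "unital_algebra (xe_C E)" and u: "unital_action (xe_B E) (carrier (xe_A E)) (xe_l E) (xe_r E)"
    using assms by (simp_all add: unital_xext_def)
  interpret crossed_sequence "xe_M E" "xe_A E" "xe_B E" "xe_C E" "xe_l E" "xe_r E" "xe_j E" "xe_d E" "xe_p E"
    by (rule is_xextD(1)[OF E])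
  show "is_module (induced_module E)" by (rule is_module_induced[OF E])
  show "unital_algebra (acting (induced_module E))" using UC by simp
  show "unital_action (acting (induced_module E)) (carrier (acted (induced_module E)))
     (lact (induced_module E)) (ract (induced_module E))"
    unfolding unital_action_def
  proof
    fix m assume "m \<in> carrier (acted (induced_module E))"
    then have m: "m \<in> carrier (xe_M E)" by simp
    note i = induced_moduleD[OF is_xextD(1)[OF E] unital_algebraD(2)[OF UB] m, unfolded unital_mapsD(2)[OF up]]
    have "xe_j E (lact (induced_module E) (unit_of (xe_C E)) m) = xe_j E m"
      "xe_j E (ract (induced_module E) m (unit_of (xe_C E))) = xe_j E m"
      using i u j_simps(1)[OF m] by (simp_all add: unital_action_def)
    then show "lact (induced_module E) (unit_of (acting (induced_module E))) m = m \<and>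
      ract (induced_module E) m (unit_of (acting (induced_module E))) = m"
      using i m by (simp add: j_eq)
  qed
qed

lemma is_xbiext_xext_to_xbiext:
  assumes E: "unital_xext E"
  shows "is_xbiext (xext_to_xbiext E)"
proof -
  have X: "is_xext E" using E by (simp add: unital_xext_def)
  let ?X = "xext_to_xbiext E"
  have seq: "xbiext_sequence ?X"
    using is_xextD(1)[OF X] by (simp add: xext_to_xbiext_def module_to_bimod_def crossed_sequence_with_mult)
  have "crossed_sequence.induced (xb_M ?X) (xb_B ?X) (xb_C ?X) (xb_l ?X) (xb_r ?X) (xb_j ?X) (xb_p ?X)
       (bm_l (xb_CM ?X)) (bm_r (xb_CM ?X))"
    using induced_module_induced[OF is_xextD(1)[OF X]]
    unfolding crossed_sequence.induced_def[OF seq] crossed_sequence.induced_def[OF is_xextD(1)[OF X]]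
    by (simp add: xext_to_xbiext_def module_to_bimod_def)
  then show ?thesis
    unfolding is_xbiext_iff using seq unital_induced_module[OF E] E
    by (simp add: unital_xext_def) (simp add: xext_to_xbiext_def module_to_bimod_def)
qed

text \<open>Only the two unit conditions separate the two notions of morphism, as \<open>\<alpha>\<close> and \<open>\<mu>\<close> are automatically
  multiplicative by \<open>xext_maps_iff\<close>.\<close>

lemma xbiext_maps_iff:
  assumes E: "is_xbiext E" and E': "is_xbiext E'"
  shows "(\<gamma>, \<beta>, \<alpha>, \<mu>) \<in> xbiext_maps E E' \<longleftrightarrow>
    (\<gamma>, \<beta>, \<alpha>, \<mu>) \<in> xext_maps (xbiext_to_xext E) (xbiext_to_xext E') \<and>
    \<gamma> \<in> unital_maps (xb_C E) (xb_C E') \<and> \<beta> \<in> unital_maps (xb_B E) (xb_B E')"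
  unfolding xext_maps_iff[OF is_xext_xbiext[OF E] is_xext_xbiext[OF E']]
  using unital_mapsD(1)[of \<gamma> "xb_C E" "xb_C E'"] unital_mapsD(1)[of \<beta> "xb_B E" "xb_B E'"]
  by (auto simp: xbiext_maps_def bimod_compatible_def action_compatible_def)

lemma embedding_XBiext: "embedding XBiext XExt incl_XBiext"
  unfolding XBiext_def XExt_def incl_XBiext_def
proof (rule concrete_subcategory[OF category_XExt[unfolded XExt_def]]; (elim CollectE)?)
  note cat = category_concreteD[OF category_XExt[unfolded XExt_def]]
  show "inj_on xbiext_to_xext {X. is_xbiext X}"
    by (rule inj_on_inverseI[of _ xext_to_xbiext]) (simp add: xext_to_xbiext_inverse)
  fix X :: "('k::field, 'u) xbiext" assume X: "is_xbiext X"
  show m: "xbiext_to_xext X \<in> {E. is_xext E}" using is_xext_xbiext[OF X] by simp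
  have U: "unital_algebra (xb_C X)" "unital_algebra (xb_B X)"
    using X by (simp_all add: is_xbiext_iff is_bimodule_iff)
  show "(id_map (xb_C X), id_map (xb_B X), id_map (xb_A X), id_map (xb_M X)) =
    (id_map (xe_C (xbiext_to_xext X)), id_map (xe_B (xbiext_to_xext X)), id_map (xe_A (xbiext_to_xext X)),
     id_map (xe_M (xbiext_to_xext X)))" by (simp add: id_map_def)
  show "(id_map (xb_C X), id_map (xb_B X), id_map (xb_A X), id_map (xb_M X)) \<in> xbiext_maps X X"
    unfolding xbiext_maps_iff[OF X X] using cat(1)[OF m] id_map_unital[OF U(1)] id_map_unital[OF U(2)]
    by (simp add: id_map_def)
  fix Y assume Y: "is_xbiext (Y :: ('k::field, 'u) xbiext)"
  show "xbiext_maps X Y \<subseteq> xext_maps (xbiext_to_xext X) (xbiext_to_xext Y)"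
    using xbiext_maps_iff[OF X Y] by auto
  fix Z :: "('k::field, 'u) xbiext" and f g assume Z: "is_xbiext Z" and fg: "f \<in> xbiext_maps X Y" "g \<in> xbiext_maps Y Z"
  show "xext_compose (xbiext_to_xext X) g f \<in> xbiext_maps X Z"
  proof -
    obtain \<gamma> \<beta> \<alpha> \<mu> \<gamma>' \<beta>' \<alpha>' \<mu>' where e: "f = (\<gamma>, \<beta>, \<alpha>, \<mu>)" "g = (\<gamma>', \<beta>', \<alpha>', \<mu>')" by (cases f, cases g)
    show ?thesis
      using fg cat(2)[OF m, of "xbiext_to_xext Y" "xbiext_to_xext Z" f g] is_xext_xbiext[OF Y] is_xext_xbiext[OF Z]
        unital_maps_compose[OF _ _ U(1), of \<gamma> "xb_C Y" \<gamma>' "xb_C Z"]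
        unital_maps_compose[OF _ _ U(2), of \<beta> "xb_B Y" \<beta>' "xb_B Z"]
      unfolding e xbiext_maps_iff[OF X Y] xbiext_maps_iff[OF Y Z] by (simp add: xbiext_maps_iff[OF X Z])
  qed
qed (simp_all add: id_map_def)

lemmas category_XBiext = embedding_category[OF embedding_XBiext]

lemma is_functor_base_Bimod: "is_functor Bimod AssAlg1 base_Bimod"
  unfolding Bimod_def AssAlg1_def base_Bimod_def
  by (rule is_functor_concrete[OF category_Bimod[unfolded Bimod_def] category_AssAlg1[unfolded AssAlg1_def]])
     (auto simp: is_bimodule_iff bimod_maps_def)

lemma is_functor_Pi_XBiext: "is_functor XBiext Bimod Pi_XBiext"
  unfolding Bimod_def XBiext_def Pi_XBiext_def
proof (rule is_functor_concrete[OF category_XBiext[unfolded XBiext_def] category_Bimod[unfolded Bimod_def]])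
  fix X Y :: "('k::field, 'u) xbiext" and f assume X0: "X \<in> {X. is_xbiext X}" "Y \<in> {X. is_xbiext X}" and f: "f \<in> xbiext_maps X Y"
  have X: "is_xbiext X" "is_xbiext Y" using X0 by simp_all
  obtain \<gamma> \<beta> \<alpha> \<mu> where e: "f = (\<gamma>, \<beta>, \<alpha>, \<mu>)" by (cases f)
  have b: "is_bimodule (xb_CM X)" "is_bimodule (xb_CM Y)" using X by (simp_all add: is_xbiext_iff)
  note fm = f[unfolded e xbiext_maps_iff[OF X]]
  show "ends f \<in> bimod_maps (xb_CM X) (xb_CM Y)"
    unfolding bimod_maps_iff[OF b] e
    using fm Pi_map[OF is_xext_xbiext[OF X(1)] is_xext_xbiext[OF X(2)] conjunct1[OF fm]]
    by (simp add: induced_module_xbiext[OF X(1)] induced_module_xbiext[OF X(2)])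
qed (auto simp: is_xbiext_iff)

section \<open>The two fiberwise opfibrations\<close>

text \<open>An infinite type is equinumerous with its square.\<close>

lemma exists_pairing:
  assumes "infinite (UNIV :: 'u set)"
  obtains pr :: "'u \<Rightarrow> 'u \<Rightarrow> 'u" and pr1 pr2 where "pairing pr pr1 pr2"
proof -
  have "(card_of (UNIV \<times> UNIV :: ('u \<times> 'u) set), card_of (UNIV :: 'u set)) \<in> ordIso"
    by (rule card_of_Times_same_infinite[OF assms])
  then obtain f :: "'u \<times> 'u \<Rightarrow> 'u" where "bij_betw f (UNIV \<times> UNIV) UNIV"
    using card_of_ordIso by blast
  then have "inj f" by (simp add: bij_betw_def)
  then have "pairing (\<lambda>x y. f (x, y)) (\<lambda>z. fst (inv_into UNIV f z)) (\<lambda>z. snd (inv_into UNIV f z))"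
    by unfold_locales simp_all
  with that show thesis by blast
qed

lemmas functor_Pi_concrete = is_functor_Pi_XExt[unfolded XExt_def ModAssAlg_def Pi_XExt_def]
lemmas functor_base_concrete = is_functor_base_Mod[unfolded ModAssAlg_def AssAlg_def base_Mod_def]

context pairing
begin

lemma fiberwise_opfibration_XExt:
  "fiberwise_opfibration (AssAlg :: (('k::field, 'u) alg, ('k, 'u) alg_arrow) cat)
     XExt Pi0_XExt ModAssAlg base_Mod Pi_XExt"
  unfolding Pi0_XExt_def AssAlg_def XExt_def ModAssAlg_def base_Mod_def Pi_XExt_def
proof (rule fiberwise_opfibration_concrete[OF functor_Pi_concrete functor_base_concrete], goal_cases)
  \<comment> \<open>the cartesian lift of \<open>u\<close> is the base change of \<open>E\<close>, and its image in the category of modules is cartesian\<close>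
  case (1 E D u)
  then interpret xext_base_change pr pr1 pr2 E D u
    by unfold_locales simp_all
  have Pi: "ends (pullback_map D u E) = (u, id_map (acted (induced_module E)))"
    by (simp add: pullback_map_def)
  have "cartesian_hom {T. is_module T} module_maps module_compose acting fst algebra_maps
     algebra_compose (induced_module F) (induced_module E)
     (ends (pullback_map D u E))"
    unfolding Pi
    by (rule cartesian_hom_module[OF is_module_induced[OF is_xext_F] is_module_induced[OF E]])
       (use Pi_map[OF is_xext_F E, of u _ _ "id_map (xe_M E)"] pullback_map in \<open>simp_all add: pullback_map_def\<close>)
  then show ?case
    using is_xext_F pullback_map cartesian_pullback_map
    by (intro exI[of _ F] exI[of _ "pullback_map D u E"]) (simp add: Pi)
next
  \<comment> \<open>modules are lifted by restriction of the action along \<open>u\<close>\<close>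
  case (2 T D u)
  then have T: "is_module T" and D: "assoc_algebra D" and u: "u \<in> algebra_maps D (acting T)" by simp_all
  note m = is_module_pullback[OF T D u] and f = pullback_module_map[OF T D u]
  have "cartesian_hom {T. is_module T} module_maps module_compose acting fst algebra_maps
     algebra_compose (pullback_module D u T) T (u, id_map (acted T))"
    by (rule cartesian_hom_module[OF m T _ f]) (simp add: pullback_module_def)
  then show ?case
    using m f by (intro exI[of _ "pullback_module D u T"] exI[of _ "(u, id_map (acted T))"])
      (simp add: pullback_module_def)
next
  \<comment> \<open>the opcartesian lift of a vertical map is the pushout\<close>
  case (3 E T v)
  then have v: "v = (id_map (xe_C E), snd v)" by (cases v) simp
  have vm: "(id_map (xe_C E), snd v) \<in> module_maps (induced_module E) T" using 3(3) v by simp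
  interpret xext_pushout pr pr1 pr2 E T "snd v"
    by unfold_locales (use 3 vm in simp_all)
  have "ends pushout_map = v" by (subst v) (simp add: pushout_map_def)
  then show ?case
    using is_xext_pushout induced_module_pushout pushout_map opcartesian_pushout_map
    by (intro exI[of _ pushout_xext] exI[of _ pushout_map]) simp
qed

lemma unital_fibre_product:
  assumes B: "unital_algebra B" and D: "unital_algebra D" and P: "assoc_algebra (fibre_product B D p u)"
    and pu: "p (unit_of B) = u (unit_of D)"
  shows "unital_algebra (fibre_product B D p u)" "unit_of (fibre_product B D p u) = pr (unit_of B) (unit_of D)"
proof -
  have "is_unit_of (fibre_product B D p u) (pr (unit_of B) (unit_of D))"
    using unital_algebraD(2-4)[OF B] unital_algebraD(2-4)[OF D] pu
    by (auto simp: is_unit_of_def fibre_product_ops elim!: fibre_product_cases)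
  then show "unital_algebra (fibre_product B D p u)" "unit_of (fibre_product B D p u) = pr (unit_of B) (unit_of D)"
    using P by (auto simp: unital_algebra_def intro: unit_of_eqI)
qed

end

context xext_base_change
begin

lemma unital_base_change:
  assumes uE: "unital_xext E" and uD: "unital_algebra D" and uu: "u \<in> unital_maps D (xe_C E)"
  shows "unital_xext F" "unit_of P = pr (unit_of (xe_B E)) (unit_of D)"
proof -
  have e: "unital_algebra (xe_B E)" "xe_p E \<in> unital_maps (xe_B E) (xe_C E)"
    "unital_action (xe_B E) (carrier (xe_A E)) (xe_l E) (xe_r E)"
    using uE by (simp_all add: unital_xext_def)
  have pu: "xe_p E (unit_of (xe_B E)) = u (unit_of D)"
    using unital_mapsD(2)[OF e(2)] unital_mapsD(2)[OF uu] by simp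
  note uP = unital_fibre_product[OF e(1) uD P pu]
  show "unit_of P = pr (unit_of (xe_B E)) (unit_of D)" by (rule uP)
  have m: "pr (unit_of (xe_B E)) (unit_of D) \<in> carrier P" using unital_algebraD(2)[OF uP(1)] uP(2) by simp
  have "xe_p F \<in> unital_maps P D"
    using crossed_sequence.p[OF sequence_F] F_p[OF m] unfolding unital_maps_def by (simp add: uP(2))
  moreover have "unital_action P (carrier (xe_A E)) (xe_l F) (xe_r F)"
    using e(3) F_l[OF m] F_r[OF m] by (simp add: unital_action_def uP(2))
  ultimately show "unital_xext F"
    using is_xext_F uP(1) uD by (simp add: unital_xext_def)
qed

end

lemma (in xext_pushout) unital_pushout:
  assumes uE: "unital_xext E" and uT: "unital_action (xe_C E) (carrier N) (lact T) (ract T)"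
  shows "unital_xext pushout_xext"
proof -
  have e: "unital_algebra (xe_B E)" "unital_algebra (xe_C E)" "xe_p E \<in> unital_maps (xe_B E) (xe_C E)"
    "unital_action (xe_B E) (carrier (xe_A E)) (xe_l E) (xe_r E)"
    using uE by (simp_all add: unital_xext_def)
  have "unital_action (xe_B E) (carrier Q) lQ rQ"
    unfolding unital_action_def
  proof
    fix x assume "x \<in> carrier Q"
    then obtain a m where am: "x = q a m" "a \<in> carrier (xe_A E)" "m \<in> carrier N" by (rule Q_cases)
    then show "lQ (unit_of (xe_B E)) x = x \<and> rQ x (unit_of (xe_B E)) = x"
      using e(4) uT unital_algebraD(2)[OF e(1)] by (simp add: Q_l Q_r unital_mapsD(2)[OF e(3)] unital_action_def)
  qed
  then show ?thesis using is_xext_pushout e by (simp add: unital_xext_def)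
qed

text \<open>A comparison map is unital because its base component is prescribed by a unital map.\<close>

lemma cartesian_hom_bimod:
  assumes x: "is_bimodule x" and y: "is_bimodule y" and "bm_space x = bm_space y"
    and f: "(u, id_map (bm_space y)) \<in> bimod_maps x y"
  shows "cartesian_hom {X. is_bimodule X} bimod_maps
     bimod_compose
     bm_alg fst unital_maps algebra_compose x y (u, id_map (bm_space y))"
proof (rule cartesian_hom_subcategory[where \<iota> = bimod_to_module and H = module_maps])
  have id: "id_map (bm_space y) = id_map (acted (bimod_to_module y))" by (simp add: id_map_def)
  show "cartesian_hom {T. is_module T} module_maps module_compose acting fst algebra_maps
     algebra_compose (bimod_to_module x) (bimod_to_module y) (u, id_map (bm_space y))"
    unfolding id
    by (rule cartesian_hom_module[OF is_module_bimod[OF x] is_module_bimod[OF y]])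
       (use f assms bimod_maps_iff[OF x y] in \<open>simp_all add: id_map_def\<close>)
qed (use x y in \<open>auto simp: is_module_bimod bimod_maps_iff intro: unital_mapsD(1)\<close>)

lemmas functor_Pi_unital_concrete = is_functor_Pi_XBiext[unfolded XBiext_def Bimod_def Pi_XBiext_def]
lemmas functor_base_unital_concrete = is_functor_base_Bimod[unfolded Bimod_def AssAlg1_def base_Bimod_def]

abbreviation xbiext_compose where
  "xbiext_compose \<equiv> (\<lambda>E (\<gamma>', \<beta>', \<alpha>', \<mu>') (\<gamma>, \<beta>, \<alpha>, \<mu>).
        (compose (carrier (xb_C E)) \<gamma>' \<gamma>, compose (carrier (xb_B E)) \<beta>' \<beta>,
         compose (carrier (xb_A E)) \<alpha>' \<alpha>, compose (carrier (xb_M E)) \<mu>' \<mu>))"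

context pairing
begin

lemma fiberwise_opfibration_XBiext:
  "fiberwise_opfibration (AssAlg1 :: (('k::field, 'u) alg, ('k, 'u) alg_arrow) cat)
     XBiext Pi0_XBiext Bimod base_Bimod Pi_XBiext"
  unfolding Pi0_XBiext_def AssAlg1_def XBiext_def Bimod_def base_Bimod_def Pi_XBiext_def
proof (rule fiberwise_opfibration_concrete[OF functor_Pi_unital_concrete functor_base_unital_concrete], goal_cases)
  case (1 Y D u)
  then have Y: "is_xbiext Y" and uD: "unital_algebra D" and uu: "u \<in> unital_maps D (xb_C Y)" by simp_all
  let ?E = "xbiext_to_xext Y"
  interpret xext_base_change pr pr1 pr2 ?E D u
    by unfold_locales (simp_all add: is_xext_xbiext[OF Y] unital_algebraD(1)[OF uD] unital_mapsD(1)[OF uu])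
  have uF: "unital_xext F" and unitP: "unit_of P = pr (unit_of (xb_B Y)) (unit_of D)"
    using unital_base_change[OF unital_xext_xbiext[OF Y] uD] uu by simp_all
  have uP: "unital_algebra P" and up: "xe_p F \<in> unital_maps P D" using uF by (simp_all add: unital_xext_def)
  let ?X = "xext_to_xbiext F"
  have X: "is_xbiext ?X" by (rule is_xbiext_xext_to_xbiext[OF uF])
  have XF: "xbiext_to_xext ?X = F" by (rule xbiext_to_xext_inverse[OF is_xext_F])
  have bX: "xb_B ?X = P" "xb_C ?X = D"
    using XF xbiext_to_xext_simps(2,6)[of ?X] by simp_all
  have MX: "xb_M ?X = xb_M Y" using XF xbiext_to_xext_simps(1)[of ?X]
    by (metis F_simps(1) xbiext_to_xext_simps(1) zero_mult_simps(5))
  note bm = X[unfolded is_xbiext_iff, THEN conjunct1] Y[unfolded is_xbiext_iff, THEN conjunct1]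
  define \<beta> where "\<beta> = (\<lambda>x\<in>carrier P. pr1 x)"
  have pm: "pullback_map D u ?E = (u, \<beta>, id_map (xe_A ?E), id_map (xb_M Y))"
    by (simp add: pullback_map_def \<beta>_def id_map_def)
  have "\<beta> \<in> unital_maps P (xb_B Y)"
    using fibre_product_projections(1)[OF P] unital_algebraD(2)[OF uP] unitP by (simp add: unital_maps_def \<beta>_def)
  then have fX: "pullback_map D u ?E \<in> xbiext_maps ?X Y"
    using pullback_map uu unfolding pm xbiext_maps_iff[OF X Y] XF bX by simp
  have Pi: "(u, id_map (xb_M Y)) \<in> bimod_maps (xb_CM ?X) (xb_CM Y)"
    using functorD(4)[OF functor_Pi_unital_concrete, of "Arrow ?X Y (pullback_map D u ?E)"] fX X Y
    by (simp add: pm)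
  have cM: "cartesian_hom {X. is_bimodule X} bimod_maps
     bimod_compose
     bm_alg fst unital_maps algebra_compose (xb_CM ?X) (xb_CM Y) (u, id_map (xb_M Y))"
    by (rule cartesian_hom_bimod[OF bm MX Pi])
  have cX: "cartesian_hom {E. is_xbiext E} xbiext_maps xbiext_compose (bm_alg \<circ> xb_CM)
      (fst \<circ> ends) unital_maps algebra_compose ?X Y (pullback_map D u ?E)"
  proof (rule cartesian_hom_subcategory[where \<iota> = xbiext_to_xext and H = xext_maps])
    show "cartesian_hom {E. is_xext E} xext_maps xext_compose (acting \<circ> induced_module) (fst \<circ> ends)
     algebra_maps algebra_compose (xbiext_to_xext ?X) ?E (pullback_map D u ?E)"
      unfolding XF by (rule cartesian_pullback_map)
    fix W g assume W0: "W \<in> {E. is_xbiext E}" and g0: "g \<in> xext_maps (xbiext_to_xext W) (xbiext_to_xext ?X)"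
      "(fst \<circ> ends) g \<in> unital_maps ((bm_alg \<circ> xb_CM) W) ((bm_alg \<circ> xb_CM) ?X)"
      "xext_compose (xbiext_to_xext W) (pullback_map D u ?E) g \<in> xbiext_maps W Y"
    have W: "is_xbiext W" using W0 by simp
    obtain v \<beta>' \<alpha> \<mu> where g: "g = (v, \<beta>', \<alpha>, \<mu>)" by (cases g)
    have v: "v \<in> unital_maps (xb_C W) D" using g0(2) by (simp add: g bX)
    have gF: "(v, \<beta>', \<alpha>, \<mu>) \<in> xext_maps (xbiext_to_xext W) F" using g0(1) unfolding XF g .
    have b: "\<beta>' \<in> algebra_maps (xb_B W) P" "\<forall>b\<in>carrier (xb_B W). v (xb_p W b) = xe_p F (\<beta>' b)"
      using gF unfolding xext_maps_iff[OF is_xext_xbiext[OF W] is_xext_F] by simp_all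
    have c: "compose (carrier (xb_B W)) \<beta> \<beta>' \<in> unital_maps (xb_B W) (xb_B Y)"
      using g0(3) unfolding g pm by (simp add: xbiext_maps_iff[OF W Y])
    have uW: "unital_algebra (xb_B W)" "xb_p W \<in> unital_maps (xb_B W) (xb_C W)" using W by (simp_all add: is_xbiext_iff)
    note e = unital_algebraD(2)[OF uW(1)]
    \<comment> \<open>the comparison map preserves the unit since both of its components do\<close>
    have eP: "\<beta>' (unit_of (xb_B W)) \<in> carrier P" by (rule algebra_mapsD(2)[OF b(1) e])
    obtain y z where yz: "\<beta>' (unit_of (xb_B W)) = pr y z" by (rule fibre_product_cases[OF eP])
    have "y = unit_of (xb_B Y)"
      using unital_mapsD(2)[OF c] e eP unfolding \<beta>_def by (simp add: yz)
    moreover have "z = unit_of D"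
      using b(2)[rule_format, OF e] F_p[OF eP[unfolded yz]]
      unfolding yz unital_mapsD(2)[OF uW(2)] unital_mapsD(2)[OF v] by simp
    ultimately have "\<beta>' \<in> unital_maps (xb_B W) P" using b(1) yz unitP by (simp add: unital_maps_def)
    then show "g \<in> xbiext_maps W ?X"
      unfolding g xbiext_maps_iff[OF W X] XF bX using gF v by simp
  qed (use X Y in \<open>auto simp: is_xext_xbiext induced_module_xbiext xbiext_maps_iff intro: unital_mapsD(1)\<close>)
  show ?case
    by (intro exI[of _ ?X] exI[of _ "pullback_map D u ?E"]) (use X bX fX cX cM in \<open>simp add: pm\<close>)
next
  case (2 T D u)
  then have T: "is_bimodule T" and D: "unital_algebra D" and u: "u \<in> unital_maps D (bm_alg T)" by simp_all
  let ?S = "pullback_module D u (bimod_to_module T)"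
  note TM = is_module_bimod[OF T]
  have u': "u \<in> algebra_maps D (acting (bimod_to_module T))" using unital_mapsD(1)[OF u] by simp
  note m = is_module_pullback[OF TM unital_algebraD(1)[OF D] u']
    and f = pullback_module_map[OF TM unital_algebraD(1)[OF D] u']
  have S: "is_bimodule (module_to_bimod ?S)"
    by (rule is_bimodule_module_to_bimod[OF m])
       (use D T unital_algebraD(2)[OF D] unital_mapsD(2)[OF u] in
         \<open>simp_all add: pullback_module_def unital_action_def is_bimodule_iff\<close>)
  have sp: "bm_space (module_to_bimod ?S) = bm_space T" "bm_alg (module_to_bimod ?S) = D"
    by (simp_all add: module_to_bimod_def pullback_module_def)
  have f1: "(u, id_map (bm_space T)) \<in> bimod_maps (module_to_bimod ?S) T"
    unfolding bimod_maps_iff[OF S T] bimod_to_module_inverse[OF m] using f u by (simp add: sp id_map_def)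
  show ?case
    by (intro exI[of _ "module_to_bimod ?S"] exI[of _ "(u, id_map (bm_space T))"])
       (use S sp f1 cartesian_hom_bimod[OF S T sp(1) f1] in simp)
next
  case (3 X T v)
  then have X: "is_xbiext X" and bT: "is_bimodule T" and vm: "v \<in> bimod_maps (xb_CM X) T"
    and CT: "bm_alg T = xb_C X" and vi: "fst v = id_map (xb_C X)" by simp_all
  let ?E = "xbiext_to_xext X"
  have v: "v = (id_map (xb_C X), snd v)" using vi by (cases v) simp
  have bX: "is_bimodule (xb_CM X)" using X by (simp add: is_xbiext_iff)
  have vm': "v \<in> module_maps (bimod_to_module (xb_CM X)) (bimod_to_module T)"
    using vm unfolding bimod_maps_iff[OF bX bT] by simp
  interpret xext_pushout pr pr1 pr2 ?E "bimod_to_module T" "snd v"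
    by unfold_locales
      (use is_xext_xbiext[OF X] is_module_bimod[OF bT] CT vm' v in \<open>simp_all add: induced_module_xbiext[OF X]\<close>)
  have up: "unital_xext pushout_xext"
    by (rule unital_pushout[OF unital_xext_xbiext[OF X]]) (use bT CT in \<open>simp add: is_bimodule_iff\<close>)
  let ?Y = "xext_to_xbiext pushout_xext"
  have Y: "is_xbiext ?Y" by (rule is_xbiext_xext_to_xbiext[OF up])
  have YF: "xbiext_to_xext ?Y = pushout_xext" by (rule xbiext_to_xext_inverse[OF is_xext_pushout])
  have YM: "xb_CM ?Y = T" by (simp add: xext_to_xbiext_def induced_module_pushout)
  have bY: "xb_B ?Y = xb_B X" "xb_C ?Y = xb_C X"
    using YF xbiext_to_xext_simps(2,6)[of ?Y] by simp_all
  have uX: "unital_algebra (xb_B X)" "unital_algebra (xb_C X)" using X by (simp_all add: is_xbiext_iff is_bimodule_iff)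
  have fX: "pushout_map \<in> xbiext_maps X ?Y"
    using pushout_map id_map_unital[OF uX(1)] id_map_unital[OF uX(2)]
    unfolding pushout_map_def xbiext_maps_iff[OF X Y] YF bY by simp
  have cX: "vertical_opcartesian_hom {E. is_xbiext E} xbiext_maps xbiext_compose (bm_alg \<circ> xb_CM)
      (fst \<circ> ends) id_map bimod_maps
      bimod_compose
      xb_CM ends fst X ?Y pushout_map"
  proof (rule vertical_opcartesian_hom_subcategory[where \<iota> = xbiext_to_xext and H = xext_maps])
    show "vertical_opcartesian_hom {E. is_xext E} xext_maps xext_compose (acting \<circ> induced_module)
     (fst \<circ> ends) id_map module_maps module_compose induced_module
     ends fst ?E (xbiext_to_xext ?Y) pushout_map"
      unfolding YF by (rule opcartesian_pushout_map)
    fix Z g assume Z0: "Z \<in> {E. is_xbiext E}" and g0: "g \<in> xext_maps (xbiext_to_xext ?Y) (xbiext_to_xext Z)"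
      "ends g \<in> bimod_maps (xb_CM ?Y) (xb_CM Z)"
      "xext_compose ?E g pushout_map \<in> xbiext_maps X Z"
    have Z: "is_xbiext Z" using Z0 by simp
    obtain \<gamma> \<beta> \<alpha> \<mu> where g: "g = (\<gamma>, \<beta>, \<alpha>, \<mu>)" by (cases g)
    have c: "\<gamma> \<in> unital_maps (xb_C X) (xb_C Z)" using g0(2) CT by (simp add: g YM bimod_maps_def)
    have b: "\<beta> \<in> algebra_maps (xb_B X) (xb_B Z)"
      using g0(1) unfolding g YF by (simp add: xext_maps_def)
    have "\<beta> \<in> unital_maps (xb_B X) (xb_B Z)"
      using g0(3) linear_maps_compose_id(1)[OF algebra_mapsD(1)[OF b]]
      unfolding g pushout_map_def by (simp add: xbiext_maps_iff[OF X Z])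
    with c g0(1) show "g \<in> xbiext_maps ?Y Z"
      unfolding g xbiext_maps_iff[OF Y Z] bY by simp
  next
    show "xbiext_maps W Z \<subseteq> xext_maps (xbiext_to_xext W) (xbiext_to_xext Z)"
      if "W \<in> {E. is_xbiext E}" "Z \<in> {E. is_xbiext E}" for W Z
      using that by (auto simp: xbiext_maps_iff)
    show "bimod_maps (xb_CM W) (xb_CM Z) \<subseteq> module_maps (induced_module (xbiext_to_xext W)) (induced_module (xbiext_to_xext Z))"
      if "W \<in> {E. is_xbiext E}" "Z \<in> {E. is_xbiext E}" for W Z
      using that bimod_maps_iff[of "xb_CM W" "xb_CM Z"] by (auto simp: induced_module_xbiext is_xbiext_iff)
  qed (use X Y in \<open>auto simp: is_xext_xbiext induced_module_xbiext\<close>)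
  have "ends pushout_map = v" by (subst v) (simp add: pushout_map_def)
  then show ?case
    by (intro exI[of _ ?Y] exI[of _ pushout_map]) (use Y YM fX cX in simp)
qed

end

section \<open>Compatibility of the inclusions\<close>

lemma Pi_XBiext_restricts: "functor_eq XBiext (Pi_XExt \<cdot>\<^sub>F incl_XBiext) (incl_Bimod \<cdot>\<^sub>F Pi_XBiext)"
  unfolding functor_eq_def XBiext_def Pi_XExt_def incl_XBiext_def incl_Bimod_def Pi_XBiext_def fcomp_concrete
  by (simp add: induced_module_xbiext)

lemma base_Bimod_restricts: "functor_eq Bimod (base_Mod \<cdot>\<^sub>F incl_Bimod) (incl_AssAlg1 \<cdot>\<^sub>F base_Bimod)"
  unfolding functor_eq_def Bimod_def base_Mod_def incl_AssAlg1_def incl_Bimod_def base_Bimod_def fcomp_concrete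
  by simp

lemma Pi0_XBiext_restricts: "functor_eq XBiext (Pi0_XExt \<cdot>\<^sub>F incl_XBiext) (incl_AssAlg1 \<cdot>\<^sub>F Pi0_XBiext)"
  unfolding functor_eq_def XBiext_def Pi0_XExt_def Pi0_XBiext_def base_Mod_def base_Bimod_def
    incl_AssAlg1_def incl_XBiext_def Pi_XExt_def Pi_XBiext_def fcomp_concrete
  by simp

section \<open>The inclusions are not full\<close>

text \<open>The element \<open>undefined\<close> serves as the only point, because functions that are constantly \<open>undefined\<close>
  are extensional on every domain.\<close>

definition zero_algebra :: "('k, 'u) alg" where
  "zero_algebra = \<lparr>carrier = {undefined}, vadd = \<lambda>_ _. undefined, vzero = undefined,
     vscale = \<lambda>_ _. undefined, amult = \<lambda>_ _. undefined\<rparr>"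

lemma zero_algebra_simps [simp]:
  "carrier zero_algebra = {undefined}" "vadd zero_algebra = (\<lambda>_ _. undefined)"
  "vzero zero_algebra = undefined" "vscale zero_algebra = (\<lambda>_ _. undefined)"
  "amult zero_algebra = (\<lambda>_ _. undefined)"
  by (simp_all add: zero_algebra_def)

lemma unital_zero_algebra: "unital_algebra (zero_algebra :: ('k::field, 'u) alg)"
proof -
  have V: "vspace (zero_algebra :: ('k, 'u) alg)" by (rule vspaceI) auto
  have "bilinear_op zero_algebra zero_algebra (zero_algebra :: ('k, 'u) alg) (amult (zero_algebra :: ('k, 'u) alg))"
    by (rule bilinear_opI[OF _ _ _ _ _ _ V V]) auto
  then show ?thesis using V by (auto simp: unital_algebra_def assoc_algebra_def is_unit_of_def)
qed

text \<open>The ground field, transported along an injection into the universe.\<close>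

definition ground_algebra :: "('k::field \<Rightarrow> 'u) \<Rightarrow> ('k, 'u) alg" where
  "ground_algebra \<iota> = \<lparr>carrier = range \<iota>,
     vadd = (\<lambda>x y. if x \<in> range \<iota> \<and> y \<in> range \<iota> then \<iota> (inv_into UNIV \<iota> x + inv_into UNIV \<iota> y) else undefined),
     vzero = \<iota> 0,
     vscale = (\<lambda>s x. if x \<in> range \<iota> then \<iota> (s * inv_into UNIV \<iota> x) else undefined),
     amult = (\<lambda>x y. if x \<in> range \<iota> \<and> y \<in> range \<iota> then \<iota> (inv_into UNIV \<iota> x * inv_into UNIV \<iota> y) else undefined)\<rparr>"

lemma ground_algebra_simps:
  "carrier (ground_algebra \<iota>) = range \<iota>" "vzero (ground_algebra \<iota>) = \<iota> 0"
  "inj \<iota> \<Longrightarrow> vadd (ground_algebra \<iota>) (\<iota> x) (\<iota> y) = \<iota> (x + y)"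
  "inj \<iota> \<Longrightarrow> vscale (ground_algebra \<iota>) s (\<iota> x) = \<iota> (s * x)"
  "inj \<iota> \<Longrightarrow> amult (ground_algebra \<iota>) (\<iota> x) (\<iota> y) = \<iota> (x * y)"
  "a \<notin> range \<iota> \<or> b \<notin> range \<iota> \<Longrightarrow> vadd (ground_algebra \<iota>) a b = undefined"
  "a \<notin> range \<iota> \<Longrightarrow> vscale (ground_algebra \<iota>) s a = undefined"
  "a \<notin> range \<iota> \<or> b \<notin> range \<iota> \<Longrightarrow> amult (ground_algebra \<iota>) a b = undefined"
  by (auto simp: ground_algebra_def)

lemma unital_ground_algebra:
  assumes "inj \<iota>"
  shows "unital_algebra (ground_algebra \<iota>)" "unit_of (ground_algebra \<iota>) = \<iota> 1"
proof -
  note S = ground_algebra_simps(1,2,6-8) ground_algebra_simps(3-5)[OF assms]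
  have V: "vspace (ground_algebra \<iota>)"
    by (rule vspaceI) (auto simp: S algebra_simps)
  have "bilinear_op (ground_algebra \<iota>) (ground_algebra \<iota>) (ground_algebra \<iota>) (amult (ground_algebra \<iota>))"
    by (rule bilinear_opI[OF _ _ _ _ _ _ V V]) (auto simp: S algebra_simps)
  then have A: "assoc_algebra (ground_algebra \<iota>)"
    using V by (auto simp: assoc_algebra_def S algebra_simps)
  have u: "is_unit_of (ground_algebra \<iota>) (\<iota> 1)" by (auto simp: is_unit_of_def S)
  then show "unital_algebra (ground_algebra \<iota>)" "unit_of (ground_algebra \<iota>) = \<iota> 1"
    using A unit_of_eqI[OF u] by (auto simp: unital_algebra_def)
qed

definition zero_bimodule :: "('k::field, 'u) alg \<Rightarrow> ('k, 'u) bimod" where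
  "zero_bimodule C = \<lparr>bm_alg = C, bm_space = vect.truncate zero_algebra,
     bm_l = \<lambda>_ _. undefined, bm_r = \<lambda>_ _. undefined\<rparr>"

text \<open>The exact sequence \<open>0 \<rightarrow> 0 \<rightarrow> 0 \<rightarrow> C \<rightarrow> C \<rightarrow> 0\<close>.\<close>

definition zero_xbiext :: "('k::field, 'u) alg \<Rightarrow> ('k, 'u) xbiext" where
  "zero_xbiext C = \<lparr>xb_CM = zero_bimodule C, xb_BA = zero_bimodule C, xb_j = \<lambda>_. undefined,
     xb_d = (\<lambda>x\<in>{undefined}. vzero C), xb_p = id_map C\<rparr>"

lemma is_bimodule_zero:
  fixes C :: "('k::field, 'u) alg"
  assumes "unital_algebra C"
  shows "is_bimodule (zero_bimodule C)"
proof -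
  note C = unital_algebraD(1)[OF assms]
  note VC = assoc_algebraD(1)[OF C]
  let ?Z = "zero_algebra :: ('k, 'u) alg"
  have Z: "vspace ?Z" using unital_algebraD(1)[OF unital_zero_algebra] assoc_algebraD(1) by blast
  have "biaction C ?Z (\<lambda>_ _. undefined) (\<lambda>_ _. undefined)"
    unfolding biaction_def using C Z by (auto intro!: bilinear_opI VC)
  then show ?thesis
    using assms by (simp add: is_bimodule_iff zero_bimodule_def unital_action_def)
qed

lemma is_xbiext_zero:
  assumes C: "unital_algebra C"
  shows "is_xbiext (zero_xbiext C)"
proof -
  note A = unital_algebraD(1)[OF C]
  note V = assoc_algebraD(1)[OF A]
  have d: "(\<lambda>x\<in>{undefined}. vzero C) \<in> linear_maps zero_algebra C"
    by (rule linear_mapsI) (auto simp: vspaceD(4,5,17)[OF V])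
  have j: "(\<lambda>_. undefined) \<in> linear_maps zero_algebra zero_algebra"
    by (rule linear_mapsI) auto
  note z = bilinear_op_zero[OF assoc_algebraD(2)[OF A] V V V]
  show ?thesis
    unfolding is_xbiext_def is_crossed_bimodule_def Let_def
    using is_bimodule_zero[OF C] d j id_map_unital[OF C]
    by (simp add: zero_xbiext_def) (auto simp: zero_bimodule_def z exact_seq_def kernel_of_def vspaceD(4)[OF V] image_def)
qed

lemma full_concreteD:
  assumes "full (concrete_cat Ob1 H1 i1 c1) (concrete_cat Ob H i c) (concrete_functor \<iota> id)"
    and "x \<in> Ob1" "y \<in> Ob1" "\<iota> x \<in> Ob" "\<iota> y \<in> Ob" "g \<in> H (\<iota> x) (\<iota> y)"
  shows "g \<in> H1 x y"
proof -
  obtain f where f: "f \<in> arr (concrete_cat Ob1 H1 i1 c1)" "arrow_src f = x" "arrow_tgt f = y"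
    "on_arr (concrete_functor \<iota> id) f = Arrow (\<iota> x) (\<iota> y) g"
    using assms(1)[unfolded full_def, rule_format, of x y "Arrow (\<iota> x) (\<iota> y) g"] assms(2-) by auto
  then show ?thesis by (cases f) simp
qed

text \<open>The zero map from the zero algebra to the ground field is multiplicative but not unital. It extends to the
  crossed extensions and modules that are zero away from the algebra.\<close>

lemma not_full:
  assumes \<iota>: "inj (\<iota> :: 'k::field \<Rightarrow> 'u)"
  shows "\<not> full (XBiext :: (('k, 'u) xbiext, ('k, 'u) xbiext_arrow) cat) XExt incl_XBiext"
    "\<not> full (Bimod :: (('k, 'u) bimod, ('k, 'u) bimod_arrow) cat) ModAssAlg incl_Bimod"
proof -
  let ?Z = "zero_algebra :: ('k, 'u) alg" and ?K = "ground_algebra \<iota>"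
  define f where "f = (\<lambda>x\<in>{undefined :: 'u}. \<iota> 0)"
  note S = ground_algebra_simps(1,2,6-8) ground_algebra_simps(3-5)[OF \<iota>]
  have uZ: "unital_algebra ?Z" by (rule unital_zero_algebra)
  note uK = unital_ground_algebra[OF \<iota>]
  have f: "f \<in> algebra_maps ?Z ?K"
    unfolding algebra_maps_def f_def by (auto intro!: linear_mapsI simp: S)
  have "unit_of ?Z = undefined" using unital_algebraD(2)[OF uZ] by simp
  then have fn: "f \<notin> unital_maps ?Z ?K" using inj_eq[OF \<iota>, of 0 1] by (simp add: unital_maps_def uK(2) f_def)
  have j: "(\<lambda>_. undefined) \<in> linear_maps ?Z ?Z" by (rule linear_mapsI) auto
  note bZ = is_bimodule_zero[OF uZ] is_bimodule_zero[OF uK(1)]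
  note xZ = is_xbiext_zero[OF uZ] is_xbiext_zero[OF uK(1)]
  have m: "(f, \<lambda>_. undefined) \<in> module_maps (bimod_to_module (zero_bimodule ?Z)) (bimod_to_module (zero_bimodule ?K))"
    unfolding module_maps_iff[OF is_module_bimod[OF bZ(1)] is_module_bimod[OF bZ(2)]]
    using f j by (simp add: zero_bimodule_def action_compatible_def)
  have x: "(f, f, \<lambda>_. undefined, \<lambda>_. undefined) \<in>
      xext_maps (xbiext_to_xext (zero_xbiext ?Z)) (xbiext_to_xext (zero_xbiext ?K))"
    unfolding xext_maps_iff[OF is_xext_xbiext[OF xZ(1)] is_xext_xbiext[OF xZ(2)]]
    using f j by (simp add: zero_xbiext_def zero_bimodule_def action_compatible_def) (simp add: f_def S)
  show "\<not> full (Bimod :: (('k, 'u) bimod, ('k, 'u) bimod_arrow) cat) ModAssAlg incl_Bimod"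
  proof
    assume "full (Bimod :: (('k, 'u) bimod, ('k, 'u) bimod_arrow) cat) ModAssAlg incl_Bimod"
    then have "(f, \<lambda>_. undefined) \<in> bimod_maps (zero_bimodule ?Z) (zero_bimodule ?K)"
      unfolding Bimod_def ModAssAlg_def incl_Bimod_def
      by (rule full_concreteD) (use bZ is_module_bimod m in simp_all)
    then show False using fn by (simp add: bimod_maps_def zero_bimodule_def)
  qed
  show "\<not> full (XBiext :: (('k, 'u) xbiext, ('k, 'u) xbiext_arrow) cat) XExt incl_XBiext"
  proof
    assume "full (XBiext :: (('k, 'u) xbiext, ('k, 'u) xbiext_arrow) cat) XExt incl_XBiext"
    then have "(f, f, \<lambda>_. undefined, \<lambda>_. undefined) \<in> xbiext_maps (zero_xbiext ?Z) (zero_xbiext ?K)"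
      unfolding XBiext_def XExt_def incl_XBiext_def
      by (rule full_concreteD) (use xZ is_xext_xbiext x in simp_all)
    then show False using fn by (simp add: xbiext_maps_def zero_xbiext_def zero_bimodule_def)
  qed
qed

theorem theorem4p16:
  assumes "infinite (UNIV :: 'u set)"
  shows
    "fiberwise_opfibration (AssAlg :: (('k::field, 'u) alg, ('k, 'u) alg_arrow) cat)
       XExt Pi0_XExt ModAssAlg base_Mod Pi_XExt
     \<and>
     fiberwise_opfibration (AssAlg1 :: (('k, 'u) alg, ('k, 'u) alg_arrow) cat)
       XBiext Pi0_XBiext Bimod base_Bimod Pi_XBiext
     \<and>
     embedding (AssAlg1 :: (('k, 'u) alg, ('k, 'u) alg_arrow) cat) AssAlg incl_AssAlg1 \<and>
     embedding (Bimod :: (('k, 'u) bimod, ('k, 'u) bimod_arrow) cat) ModAssAlg incl_Bimod \<and>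
     embedding (XBiext :: (('k, 'u) xbiext, ('k, 'u) xbiext_arrow) cat) XExt incl_XBiext
     \<and>
     functor_eq (XBiext :: (('k, 'u) xbiext, ('k, 'u) xbiext_arrow) cat)
       (Pi_XExt \<cdot>\<^sub>F incl_XBiext) (incl_Bimod \<cdot>\<^sub>F Pi_XBiext) \<and>
     functor_eq (Bimod :: (('k, 'u) bimod, ('k, 'u) bimod_arrow) cat)
       (base_Mod \<cdot>\<^sub>F incl_Bimod) (incl_AssAlg1 \<cdot>\<^sub>F base_Bimod) \<and>
     functor_eq (XBiext :: (('k, 'u) xbiext, ('k, 'u) xbiext_arrow) cat)
       (Pi0_XExt \<cdot>\<^sub>F incl_XBiext) (incl_AssAlg1 \<cdot>\<^sub>F Pi0_XBiext)
     \<and>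
     ((\<exists>\<iota> :: 'k \<Rightarrow> 'u. inj \<iota>) \<longrightarrow>
       \<not> full (XBiext :: (('k, 'u) xbiext, ('k, 'u) xbiext_arrow) cat) XExt incl_XBiext \<and>
       \<not> full (Bimod :: (('k, 'u) bimod, ('k, 'u) bimod_arrow) cat) ModAssAlg incl_Bimod)"
proof -
  obtain pr :: "'u \<Rightarrow> 'u \<Rightarrow> 'u" and pr1 pr2 where "pairing pr pr1 pr2"
    by (rule exists_pairing[OF assms])
  then interpret pairing pr pr1 pr2 .
  show ?thesis
    using fiberwise_opfibration_XExt fiberwise_opfibration_XBiext embedding_AssAlg1 embedding_Bimod
      embedding_XBiext Pi_XBiext_restricts base_Bimod_restricts Pi0_XBiext_restricts not_full
    by (intro conjI impI; (elim exE)?) auto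
qed

end
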